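(* Let $a_0\in\mathcal{E}$ be a planar central configuration which is a nondegenerate minimizer and satisfies the collision nondegenerate condition. If $1-e>0$ is sufficiently small, then the elliptic relative equilibrium of eccentricity $e$ associated with $a_0$ is hyperbolic.
   Context: Central configurations. Let $n\ge 3$, masses $m_1,\dots,m_n>0$, $U(q)=\sum_{i<j}\frac{m_im_j}{\|q_i-q_j\|}$ on $\Lambda=\{x\in(\mathbb{R}^2)^n:\ x_i\ne x_j \text{ for } i\neq j,\ \sum m_ix_i=0\}$, $\mathcal{I}(x)=\sum m_i\|x_i\|^2$, $\mathcal{E}=\{x\in\Lambda:\mathcal{I}(x)=1\}$. A planar central configuration $a_0\in\mathcal{E}$ is a critical point of $U|_{\mathcal{E}}$. With $M=\mathrm{diag}(m_1,m_1,\dots,m_n,m_n)$, the Hessian $D^2U|_{\mathcal{E}}(a_0)$ is $M^{-1}D^2U(a_0)+U(a_0)\,\mathrm{Id}$ on the tangent space of $\mathcal{E}$ at $a_0$. It has a trivial eigenvalue $0$ coming from rotation invariance; $a_0$ is called a nondegenerate minimizer if all the other (nontrivial) eigenvalues are $>0$. Regularized Hessian. Put $k=2n-4$, $J_{2j}=\begin{pmatrix}0&-I_j\\ I_j&0\end{pmatrix}$, $\mathbb{J}_j=\mathrm{diag}(J_2,\dots,J_2)$ ($j$ copies). Choose a real $2n\times 2n$ matrix $P$ with $\mathbb{J}_nP=P\mathbb{J}_n$, $P^TMP=I_{2n}$, whose first two columns span the translation directions and whose next two columns span $\{a_0,\mathbb{J}_na_0\}$. Let $\mathcal{D}$ be the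 lower right $k\times k$ block of $\frac{1}{U(a_0)}P^TD^2U(a_0)P$ and $R=I_k+\mathcal{D}$. The nontrivial eigenvalues of $D^2U|_{\mathcal{E}}(a_0)$ are $U(a_0)$ times those of $R$. Hyperbolicity. The elliptic relative equilibrium (ERE) of eccentricity $e\in[0,1)$ is the homographic solution with shape $a_0$ in which each body moves on a Keplerian ellipse of eccentricity $e$. Its linearization splits symplectically as $E_1\oplus E_2\oplus E_3$, where $E_1,E_2$ come from the translation, and dilation/rotation symmetries; the ERE is hyperbolic if the monodromy matrix restricted to $E_3$ has no eigenvalue on the unit circle. In the Meyer–Schmidt reduction (rotating coordinates, true anomaly $t$) this restricted monodromy matrix is $\gamma_e(2\pi)$, where $\dot\gamma_e=J_{2k}\mathcal{B}(t)\gamma_e$, $\gamma_e(0)=I_{2k}$, $\mathcal{B}(t)=\begin{pmatrix} I_k&-\mathbb{J}_{k/2}\\ \mathbb{J}_{k/2}& I_k-\frac{R}{1+e\cos t}\end{pmatrix}$. Collision nondegeneracy: $a_0$ is collision nondegenerate if the system $z'=J_{2k}\hat B(\tau)z$, $\tau\in\mathbb{R}$, has no nonzero bounded solution on $\mathbb{R}$, where $\hat B=\begin{pmatrix} I_k&\frac Q4I_k-q\mathbb{J}_{k/2}\\ \frac Q4I_k+q\mathbb{J}_{k/2}& q^2I_k-R\end{pmatrix}$, $q(\tau)=\sqrt2/\cosh(\frac{\sqrt2\tau}{2})$, $Q(\tau)=\sqrt2\tanh(\frac{\sqrt2\tau}{2})$. *)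

theory Defs
  imports
    "HOL-Analysis.Derivative"
    "Jordan_Normal_Form.Char_Poly"
begin

(* A configuration of n bodies in the plane is a real vector of dimension 2n in which body i
   (counted from 0) occupies the coordinates 2i and 2i+1.  Masses are given by m :: nat => real,
   of which only the values m i with i < n are relevant. *)

definition body :: "real vec \<Rightarrow> nat \<Rightarrow> complex" where
  "body x i = Complex (x $ (2 * i)) (x $ (2 * i + 1))"

definition Jmat :: "nat \<Rightarrow> real mat" where
  "Jmat j = four_block_mat (0\<^sub>m j j) (- 1\<^sub>m j) (1\<^sub>m j) (0\<^sub>m j j)"

definition JJmat :: "nat \<Rightarrow> real mat" where
  "JJmat j = diag_block_mat (replicate j (Jmat 1))"

definition mass_mat :: "nat \<Rightarrow> (nat \<Rightarrow> real) \<Rightarrow> real mat" where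
  "mass_mat n m = mat_diag (2 * n) (\<lambda>i. m (i div 2))"

definition inv_mass_mat :: "nat \<Rightarrow> (nat \<Rightarrow> real) \<Rightarrow> real mat" where
  "inv_mass_mat n m = mat_diag (2 * n) (\<lambda>i. 1 / m (i div 2))"


section \<open>Central configurations\<close>

definition potential :: "nat \<Rightarrow> (nat \<Rightarrow> real) \<Rightarrow> real vec \<Rightarrow> real" where
  "potential n m x = (\<Sum>j<n. \<Sum>i<j. m i * m j / norm (body x i - body x j))"

definition partial_deriv :: "(real vec \<Rightarrow> real) \<Rightarrow> nat \<Rightarrow> real vec \<Rightarrow> real" where
  "partial_deriv f i x = deriv (\<lambda>s. f (x + s \<cdot>\<^sub>v unit_vec (dim_vec x) i)) 0"

definition gradient :: "(real vec \<Rightarrow> real) \<Rightarrow> real vec \<Rightarrow> real vec" where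
  "gradient f x = vec (dim_vec x) (\<lambda>i. partial_deriv f i x)"

definition hessian :: "(real vec \<Rightarrow> real) \<Rightarrow> real vec \<Rightarrow> real mat" where
  "hessian f x = mat (dim_vec x) (dim_vec x) (\<lambda>(i, j). partial_deriv (partial_deriv f j) i x)"

definition collision_free :: "nat \<Rightarrow> real vec \<Rightarrow> bool" where
  "collision_free n x \<longleftrightarrow> (\<forall>i<n. \<forall>j<n. i \<noteq> j \<longrightarrow> body x i \<noteq> body x j)"

definition centered :: "nat \<Rightarrow> (nat \<Rightarrow> real) \<Rightarrow> real vec \<Rightarrow> bool" where
  "centered n m x \<longleftrightarrow> (\<Sum>i<n. m i *\<^sub>R body x i) = 0"

definition moment_of_inertia :: "nat \<Rightarrow> (nat \<Rightarrow> real) \<Rightarrow> real vec \<Rightarrow> real" where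
  "moment_of_inertia n m x = (\<Sum>i<n. m i * (norm (body x i))\<^sup>2)"

definition config_space :: "nat \<Rightarrow> (nat \<Rightarrow> real) \<Rightarrow> real vec set" where
  "config_space n m = {x \<in> carrier_vec (2 * n). collision_free n x \<and> centered n m x}"

definition normalized_configs :: "nat \<Rightarrow> (nat \<Rightarrow> real) \<Rightarrow> real vec set" where
  "normalized_configs n m = {x \<in> config_space n m. moment_of_inertia n m x = 1}"

(* The tangent space at a of the manifold normalized_configs n m. *)
definition tangent_space :: "nat \<Rightarrow> (nat \<Rightarrow> real) \<Rightarrow> real vec \<Rightarrow> real vec set" where
  "tangent_space n m a =
     {v \<in> carrier_vec (2 * n). centered n m v \<and> (mass_mat n m *\<^sub>v a) \<bullet> v = 0}"

definition planar_central_configuration :: "nat \<Rightarrow> (nat \<Rightarrow> real) \<Rightarrow> real vec \<Rightarrow> bool" where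
  "planar_central_configuration n m a \<longleftrightarrow>
     a \<in> normalized_configs n m \<and>
     (\<forall>v \<in> tangent_space n m a. gradient (potential n m) a \<bullet> v = 0)"

definition restricted_hessian :: "nat \<Rightarrow> (nat \<Rightarrow> real) \<Rightarrow> real vec \<Rightarrow> real mat" where
  "restricted_hessian n m a =
     inv_mass_mat n m * hessian (potential n m) a + potential n m a \<cdot>\<^sub>m 1\<^sub>m (2 * n)"

(* The trivial eigenvalue is the zero belonging to the eigenvector JJmat n *v a.  Every eigenvector
   off that line has to have a positive eigenvalue, so eigenvalues are counted with multiplicity:
   the eigenvalue 0 is required to be simple.  (The operator is symmetric for the mass inner
   product, so its eigenvalues are real and semisimple.) *)
definition nondegenerate_minimizer :: "nat \<Rightarrow> (nat \<Rightarrow> real) \<Rightarrow> real vec \<Rightarrow> bool" where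
  "nondegenerate_minimizer n m a \<longleftrightarrow>
     (\<forall>v \<mu>. v \<in> tangent_space n m a \<and> eigenvector (restricted_hessian n m a) v \<mu> \<and>
            (\<nexists>c. v = c \<cdot>\<^sub>v (JJmat n *\<^sub>v a)) \<longrightarrow> \<mu> > 0)"


section \<open>The regularized Hessian\<close>

definition span2 :: "real vec \<Rightarrow> real vec \<Rightarrow> real vec set" where
  "span2 u v = {c \<cdot>\<^sub>v u + d \<cdot>\<^sub>v v | c d. True}"

definition translation_directions :: "nat \<Rightarrow> real vec set" where
  "translation_directions n = {vec (2 * n) (\<lambda>i. if even i then c else d) | c d. True}"

definition adapted_frame :: "nat \<Rightarrow> (nat \<Rightarrow> real) \<Rightarrow> real vec \<Rightarrow> real mat \<Rightarrow> bool" where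
  "adapted_frame n m a P \<longleftrightarrow>
     P \<in> carrier_mat (2 * n) (2 * n) \<and>
     JJmat n * P = P * JJmat n \<and>
     transpose_mat P * mass_mat n m * P = 1\<^sub>m (2 * n) \<and>
     span2 (col P 0) (col P 1) = translation_directions n \<and>
     span2 (col P 2) (col P 3) = span2 a (JJmat n *\<^sub>v a)"

definition regularized_hessian ::
  "nat \<Rightarrow> (nat \<Rightarrow> real) \<Rightarrow> real vec \<Rightarrow> real mat \<Rightarrow> real mat" where
  "regularized_hessian n m a P =
     (let k = 2 * n - 4;
          F = (1 / potential n m a) \<cdot>\<^sub>m (transpose_mat P * hessian (potential n m) a * P);
          D = mat k k (\<lambda>(i, j). F $$ (i + 4, j + 4))
      in 1\<^sub>m k + D)"


section \<open>Linear systems of differential equations\<close>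

definition linear_system_solution ::
  "nat \<Rightarrow> (real \<Rightarrow> real mat) \<Rightarrow> (real \<Rightarrow> real vec) \<Rightarrow> bool" where
  "linear_system_solution N A z \<longleftrightarrow>
     (\<forall>t. z t \<in> carrier_vec N \<and>
          (\<forall>i<N. ((\<lambda>s. z s $ i) has_real_derivative (A t *\<^sub>v z t) $ i) (at t)))"

definition fundamental_solution ::
  "nat \<Rightarrow> (real \<Rightarrow> real mat) \<Rightarrow> (real \<Rightarrow> real mat) \<Rightarrow> bool" where
  "fundamental_solution N A \<Gamma> \<longleftrightarrow>
     \<Gamma> 0 = 1\<^sub>m N \<and>
     (\<forall>t. \<Gamma> t \<in> carrier_mat N N \<and>
          (\<forall>i<N. \<forall>j<N. ((\<lambda>s. \<Gamma> s $$ (i, j)) has_real_derivative (A t * \<Gamma> t) $$ (i, j)) (at t)))"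


section \<open>Collision nondegeneracy\<close>

definition coll_q :: "real \<Rightarrow> real" where
  "coll_q \<tau> = sqrt 2 / cosh (sqrt 2 * \<tau> / 2)"

definition coll_Q :: "real \<Rightarrow> real" where
  "coll_Q \<tau> = sqrt 2 * tanh (sqrt 2 * \<tau> / 2)"

(* The matrix of the collision system, for a k x k matrix R with k = 2 * j. *)
definition coll_mat :: "nat \<Rightarrow> real mat \<Rightarrow> real \<Rightarrow> real mat" where
  "coll_mat j R \<tau> =
     (let k = 2 * j; q = coll_q \<tau>; Q = coll_Q \<tau>
      in four_block_mat
           (1\<^sub>m k)
           ((Q / 4) \<cdot>\<^sub>m 1\<^sub>m k - q \<cdot>\<^sub>m JJmat j)
           ((Q / 4) \<cdot>\<^sub>m 1\<^sub>m k + q \<cdot>\<^sub>m JJmat j)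
           (q\<^sup>2 \<cdot>\<^sub>m 1\<^sub>m k - R))"

(* P is an arbitrary adapted frame; replacing it by another one conjugates the regularized Hessian
   by an orthogonal matrix commuting with JJmat (n - 2), which does not affect the condition. *)
definition collision_nondegenerate ::
  "nat \<Rightarrow> (nat \<Rightarrow> real) \<Rightarrow> real vec \<Rightarrow> real mat \<Rightarrow> bool" where
  "collision_nondegenerate n m a P \<longleftrightarrow>
     (let k = 2 * n - 4; R = regularized_hessian n m a P
      in \<forall>z. linear_system_solution (2 * k) (\<lambda>\<tau>. Jmat k * coll_mat (n - 2) R \<tau>) z \<and>
             (\<exists>C. \<forall>\<tau>. \<forall>i<2 * k. \<bar>z \<tau> $ i\<bar> \<le> C)
             \<longrightarrow> (\<forall>\<tau>. z \<tau> = 0\<^sub>v (2 * k)))"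


section \<open>Elliptic relative equilibria and hyperbolicity\<close>

(* Hamilton's equations of the n-body problem, p being the momenta. *)
definition n_body_motion :: "nat \<Rightarrow> (nat \<Rightarrow> real) \<Rightarrow> (real \<Rightarrow> real vec) \<Rightarrow> bool" where
  "n_body_motion n m x \<longleftrightarrow>
     (\<forall>t. x t \<in> carrier_vec (2 * n) \<and> collision_free n (x t)) \<and>
     (\<exists>p. \<forall>t. p t \<in> carrier_vec (2 * n) \<and>
        (\<forall>i<2 * n.
          ((\<lambda>s. x s $ i) has_real_derivative (inv_mass_mat n m *\<^sub>v p t) $ i) (at t) \<and>
          ((\<lambda>s. p s $ i) has_real_derivative gradient (potential n m) (x t) $ i) (at t)))"

definition rotation_mat :: "nat \<Rightarrow> real \<Rightarrow> real mat" where
  "rotation_mat n \<phi> = cos \<phi> \<cdot>\<^sub>m 1\<^sub>m (2 * n) + sin \<phi> \<cdot>\<^sub>m JJmat n"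

(* A homographic motion of shape a along counterclockwise Kepler ellipses of eccentricity e, with
   true anomaly \<theta>, semi-latus rectum l (in units of the shape a), argument of pericenter \<omega> and
   minimal period T.  The size, the position of the pericenter and the origin of time are left
   free; for e = 0 the motion is a uniform rotation. *)
definition elliptic_relative_equilibrium ::
  "nat \<Rightarrow> (nat \<Rightarrow> real) \<Rightarrow> real vec \<Rightarrow> real \<Rightarrow> real \<Rightarrow> (real \<Rightarrow> real vec) \<Rightarrow> bool" where
  "elliptic_relative_equilibrium n m a e T x \<longleftrightarrow>
     0 \<le> e \<and> e < 1 \<and> T > 0 \<and> n_body_motion n m x \<and>
     (\<exists>l \<omega> \<theta>. l > 0 \<and>
        (\<forall>t. \<theta> differentiable (at t)) \<and>
        (\<forall>t. \<theta> (t + T) = \<theta> t + 2 * pi) \<and>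
        (\<forall>t. x t = (l / (1 + e * cos (\<theta> t))) \<cdot>\<^sub>v (rotation_mat n (\<omega> + \<theta> t) *\<^sub>v a)))"

(* The Hessian at (p, x) of the Hamiltonian (p . M^-1 p) / 2 - U x, with the momenta p listed
   first in phase space; with this order Hamilton's equations read z' = Jmat (2 * n) * grad H z. *)
definition hamiltonian_hessian :: "nat \<Rightarrow> (nat \<Rightarrow> real) \<Rightarrow> real vec \<Rightarrow> real mat" where
  "hamiltonian_hessian n m x =
     four_block_mat (inv_mass_mat n m) (0\<^sub>m (2 * n) (2 * n))
                    (0\<^sub>m (2 * n) (2 * n)) (- hessian (potential n m) x)"

(* The subspace of phase space in which positions vary in V and velocities vary in V. *)
definition phase_subspace :: "nat \<Rightarrow> (nat \<Rightarrow> real) \<Rightarrow> real vec set \<Rightarrow> real vec set" where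
  "phase_subspace n m V = {(mass_mat n m *\<^sub>v w) @\<^sub>v v | w v. w \<in> V \<and> v \<in> V}"

definition E1 :: "nat \<Rightarrow> (nat \<Rightarrow> real) \<Rightarrow> real vec set" where
  "E1 n m = phase_subspace n m (translation_directions n)"

definition E2 :: "nat \<Rightarrow> (nat \<Rightarrow> real) \<Rightarrow> real vec \<Rightarrow> real vec set" where
  "E2 n m a = phase_subspace n m (span2 a (JJmat n *\<^sub>v a))"

(* The symplectic complement of the sum of E1 and E2. *)
definition E3 :: "nat \<Rightarrow> (nat \<Rightarrow> real) \<Rightarrow> real vec \<Rightarrow> real vec set" where
  "E3 n m a =
     {z \<in> carrier_vec (4 * n). \<forall>w \<in> E1 n m \<union> E2 n m a. (Jmat (2 * n) *\<^sub>v z) \<bullet> w = 0}"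

(* \<Gamma> T is the monodromy matrix.  Its restriction to the invariant subspace E3 is real, so the
   complex eigenvectors of the restriction are those whose real and imaginary parts lie in E3.
   The motions x over which the definition quantifies differ only in size, orientation in the
   plane and origin of time, and \<Gamma> is uniquely determined by x. *)
definition ERE_hyperbolic :: "nat \<Rightarrow> (nat \<Rightarrow> real) \<Rightarrow> real vec \<Rightarrow> real \<Rightarrow> bool" where
  "ERE_hyperbolic n m a e \<longleftrightarrow>
     (\<forall>T x \<Gamma>. elliptic_relative_equilibrium n m a e T x \<and>
              fundamental_solution (4 * n)
                (\<lambda>t. Jmat (2 * n) * hamiltonian_hessian n m (x t)) \<Gamma> \<longrightarrow>
        (\<forall>v \<mu>. eigenvector (map_mat complex_of_real (\<Gamma> T)) v \<mu> \<and>
                map_vec Re v \<in> E3 n m a \<and> map_vec Im v \<in> E3 n m a \<longrightarrow>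
           cmod \<mu> \<noteq> 1))"

end

theory Submission
  imports Defs
begin

text \<open>
  Along the elliptic motion \<open>x = w a\<close>, where \<open>w\<close> runs on a Kepler ellipse of eccentricity \<open>e\<close>, the
  last \<open>k\<close> frame coordinates of a variation, divided by \<open>w\<close> and written in the true anomaly, satisfy
  \<open>X'' + 2 J X' = R X / (1 + e cos t)\<close>. A Floquet multiplier on the unit circle yields a nonzero
  solution that is bounded on the whole line. For \<open>f = \<bar>X\<bar>\<^sup>2\<close> and \<open>R \<ge> \<rho> > 0\<close> one has
  \<open>f'' \<ge> 2 (\<rho> / (1 + e cos t) - 1) f\<close>, so \<open>f\<close> has no maximum where \<open>1 + e cos t < \<rho>\<close>, and its
  supremum is comparable to the data at some multiple of \<open>2 \<pi>\<close>. If such solutions existed for a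
  sequence \<open>e \<rightarrow> 1\<close>, the normalized ones would converge to a nonzero bounded solution for \<open>e = 1\<close> on
  \<open>(-\<pi>, \<pi>)\<close>. The singular convexity forces \<open>f\<close> to vanish linearly at both ends, which is exactly
  what makes the transformed solution \<open>X / sqrt q\<close> of the collision system bounded, contradicting
  collision nondegeneracy.
\<close>

section \<open>Vectors as functions and comparison lemmas\<close>

text \<open>The obstacle is that \<open>1 / (1 + e cos t)\<close> blows up at the anomaly \<pi> as
  \<open>e\<close> tends to 1. Continuous dependence is uniform only on compact parts of the open
  interval, and a normalized sequence might concentrate at the collision and converge to 0.
  Convexity near \<pi> forbids this, and it costs only Cauchy-Schwarz: the Coriolis term is absorbed
  by the kinetic one, \<open>2 |Y|^2 - 4 <X, J Y> >= - 2 |X|^2\<close>. The decay comes from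
  \<open>f'' >= c f / (b - t)^2\<close>: the model equation has solutions \<open>(b - t)^s\<close>
  with one exponent above 1 and one negative, and boundedness excludes the latter. Linear order is
  the relevant one because \<open>q = sqrt 2 cos (t / 2)\<close> vanishes linearly at the ends. The
  momentum of the collision system is bounded by another mechanism: \<open>Q\<close> tends to
  \<open>sqrt 2\<close> and to \<open>- sqrt 2\<close> at the two ends, so its equation is damped
  forward in time at one end and backward at the other. The minimizer hypothesis enters as
  \<open>R \<ge> \<rho>\<close>, the central configuration equation as the decoupling of the last
  \<open>k\<close> frame coordinates from the first four.\<close>

definition ip :: "nat \<Rightarrow> (nat \<Rightarrow> real) \<Rightarrow> (nat \<Rightarrow> real) \<Rightarrow> real" where
  "ip k x y = (\<Sum>i<k. x i * y i)"

text \<open>Multiplication by \<open>i\<close> when the coordinates \<open>2 j\<close> and \<open>2 j + 1\<close> are read as a complex number;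
  this is the action of \<open>JJmat\<close>.\<close>

definition jj :: "(nat \<Rightarrow> real) \<Rightarrow> nat \<Rightarrow> real" where
  "jj x i = (if even i then - x (i + 1) else x (i - 1))"

text \<open>Vectors and matrices are plain functions that \<open>ip\<close> and \<open>app\<close>
  truncate at \<open>k\<close>. Values beyond \<open>k\<close> are junk, hence the congruence lemmas
  below.\<close>

definition app :: "nat \<Rightarrow> (nat \<Rightarrow> nat \<Rightarrow> real) \<Rightarrow> (nat \<Rightarrow> real) \<Rightarrow> nat \<Rightarrow> real" where
  "app k A x i = (\<Sum>j<k. A i j * x j)"

lemma ip_nonneg: "0 \<le> ip k x x"
  by (simp add: ip_def sum_nonneg)

lemma ip_eq_0_iff: "ip k x x = 0 \<longleftrightarrow> (\<forall>i<k. x i = 0)"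
  by (auto simp: ip_def sum_nonneg_eq_0_iff)

lemma ip_pos_iff: "0 < ip k x x \<longleftrightarrow> (\<exists>i<k. x i \<noteq> 0)"
  using ip_nonneg[of k x] ip_eq_0_iff[of k x] by (metis less_le)

lemma ip_commute: "ip k x y = ip k y x"
  by (simp add: ip_def mult.commute)

lemma ip_add_right: "ip k x (\<lambda>i. y i + z i) = ip k x y + ip k x z"
  by (simp add: ip_def sum.distrib algebra_simps)

lemma ip_diff_right: "ip k x (\<lambda>i. y i - z i) = ip k x y - ip k x z"
  by (simp add: ip_def sum_subtractf algebra_simps)

lemma ip_minus_right: "ip k x (\<lambda>i. - y i) = - ip k x y"
  by (simp add: ip_def sum_negf)

lemma ip_scale_right: "ip k x (\<lambda>i. c * y i) = c * ip k x y"
  by (simp add: ip_def sum_distrib_left algebra_simps)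

lemma ip_div_right: "ip k x (\<lambda>i. y i / c) = ip k x y / c"
  by (simp add: ip_def sum_divide_distrib)

lemma ip_add_left: "ip k (\<lambda>i. y i + z i) x = ip k y x + ip k z x"
  by (simp add: ip_def sum.distrib algebra_simps)

lemma ip_diff_left: "ip k (\<lambda>i. y i - z i) x = ip k y x - ip k z x"
  by (simp add: ip_def sum_subtractf algebra_simps)

lemma ip_minus_left: "ip k (\<lambda>i. - y i) x = - ip k y x"
  by (simp add: ip_def sum_negf)

lemma ip_scale_left: "ip k (\<lambda>i. c * y i) x = c * ip k y x"
  by (simp add: ip_def sum_distrib_left algebra_simps)

lemma ip_div_left: "ip k (\<lambda>i. y i / c) x = ip k y x / c"
  by (simp add: ip_def sum_divide_distrib)

lemmas ip_linear = ip_add_right ip_diff_right ip_minus_right ip_scale_right ip_div_right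
  ip_add_left ip_diff_left ip_minus_left ip_scale_left ip_div_left

lemma two_ip_le: "2 * \<bar>ip k x y\<bar> \<le> ip k x x + ip k y y"
proof -
  have "0 \<le> ip k (\<lambda>i. x i + y i) (\<lambda>i. x i + y i)" "0 \<le> ip k (\<lambda>i. x i - y i) (\<lambda>i. x i - y i)"
    by (rule ip_nonneg)+
  then show ?thesis
    unfolding ip_linear using ip_commute[of k x y] by linarith
qed

text \<open>For even \<open>k\<close> the truncation cuts no pair of coordinates, so the sum can be
  built up two indices at a time.\<close>

lemma ip_jj_jj:
  assumes "even k"
  shows "ip k (jj x) (jj y) = ip k x y"
proof -
  have "ip (2 * j) (jj x) (jj y) = ip (2 * j) x y" for j
    by (induction j) (auto simp: ip_def jj_def)
  then show ?thesis
    using assms by (auto elim: evenE)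
qed

lemma jj_jj: "jj (jj x) i = - x i"
  by (simp add: jj_def)

text \<open>An isometry with square -1 is skew: \<open>ip_jj_jj\<close> is applied to
  \<open>x\<close> and \<open>jj y\<close>.\<close>

lemma ip_jj_right:
  assumes "even k"
  shows "ip k x (jj y) = - ip k (jj x) y"
proof -
  have "ip k (jj x) (jj (jj y)) = ip k x (jj y)"
    by (rule ip_jj_jj[OF assms])
  moreover have "jj (jj y) = (\<lambda>i. - y i)"
    by (simp add: fun_eq_iff jj_jj)
  ultimately show ?thesis
    by (simp add: ip_minus_right)
qed

lemma ip_jj_self: "even k \<Longrightarrow> ip k x (jj x) = 0"
  using ip_jj_right[of k x x] ip_commute[of k x "jj x"] by linarith

lemma jj_add: "jj (\<lambda>i. x i + y i) = (\<lambda>i. jj x i + jj y i)"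
  and jj_diff: "jj (\<lambda>i. x i - y i) = (\<lambda>i. jj x i - jj y i)"
  and jj_scale: "jj (\<lambda>i. c * x i) = (\<lambda>i. c * jj x i)"
  and jj_div: "jj (\<lambda>i. x i / c) = (\<lambda>i. jj x i / c)"
  by (auto simp: jj_def fun_eq_iff)

lemma app_add: "app k A (\<lambda>i. x i + y i) = (\<lambda>i. app k A x i + app k A y i)"
  and app_diff: "app k A (\<lambda>i. x i - y i) = (\<lambda>i. app k A x i - app k A y i)"
  and app_scale: "app k A (\<lambda>i. c * x i) = (\<lambda>i. c * app k A x i)"
  and app_div: "app k A (\<lambda>i. x i / c) = (\<lambda>i. app k A x i / c)"
  by (auto simp: app_def fun_eq_iff sum.distrib sum_subtractf sum_distrib_left sum_divide_distrib
      algebra_simps)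

text \<open>The squared Frobenius norm, a bound for the squared operator norm by Cauchy-Schwarz
  alone.\<close>

definition sqnorm :: "nat \<Rightarrow> (nat \<Rightarrow> nat \<Rightarrow> real) \<Rightarrow> real" where
  "sqnorm k A = (\<Sum>i<k. \<Sum>j<k. (A i j)\<^sup>2)"

lemma sqnorm_nonneg: "0 \<le> sqnorm k A"
  by (simp add: sqnorm_def sum_nonneg)

lemma app_bound: "ip k (app k A x) (app k A x) \<le> sqnorm k A * ip k x x"
proof -
  have "(app k A x i)\<^sup>2 \<le> (\<Sum>j<k. (A i j)\<^sup>2) * (\<Sum>j<k. (x j)\<^sup>2)" for i
    unfolding app_def by (rule Cauchy_Schwarz_ineq_sum)
  then show ?thesis
    unfolding ip_def sqnorm_def sum_distrib_right
    by (intro sum_mono) (simp add: power2_eq_square sum_distrib_right)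
qed

lemma DERIV_ip:
  assumes "\<And>i. i < k \<Longrightarrow> ((\<lambda>s. X s i) has_real_derivative X' i) (at t)"
    and "\<And>i. i < k \<Longrightarrow> ((\<lambda>s. Y s i) has_real_derivative Y' i) (at t)"
  shows "((\<lambda>s. ip k (X s) (Y s)) has_real_derivative (ip k X' (Y t) + ip k (X t) Y')) (at t)"
  unfolding ip_def
  by (rule derivative_eq_intros assms | simp add: sum.distrib mult.commute)+

lemma DERIV_ip_self:
  assumes "\<And>i. i < k \<Longrightarrow> ((\<lambda>s. X s i) has_real_derivative X' i) (at t)"
  shows "((\<lambda>s. ip k (X s) (X s)) has_real_derivative 2 * ip k (X t) X') (at t)"
  using DERIV_ip[of k X X' t X X'] assms by (simp add: ip_commute[of k X'])

lemma jj_cong: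
  assumes "even k" "\<And>i. i < k \<Longrightarrow> x i = y i" "i < k"
  shows "jj x i = jj y i"
proof (cases "even i")
  case True
  with assms(1,3) have "i + 1 < k" by (metis Suc_eq_plus1 Suc_lessI even_Suc)
  with True assms show ?thesis by (simp add: jj_def)
qed (use assms in \<open>simp add: jj_def\<close>)

lemma app_cong: "(\<And>j. j < k \<Longrightarrow> x j = y j) \<Longrightarrow> app k A x i = app k A y i"
  unfolding app_def by (intro sum.cong) auto

lemma DERIV_jj:
  assumes "even k" "\<And>i. i < k \<Longrightarrow> ((\<lambda>s. X s i) has_real_derivative X' i) (at t)" "i < k"
  shows "((\<lambda>s. jj (X s) i) has_real_derivative jj X' i) (at t)"
proof (cases "even i")
  case True
  with assms(1,3) have "i + 1 < k" by (metis Suc_eq_plus1 Suc_lessI even_Suc)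
  with True assms(2) show ?thesis by (auto simp: jj_def intro!: derivative_intros)
qed (use assms in \<open>simp add: jj_def\<close>)

section \<open>Scalar comparison principles\<close>

lemma gronwall_right:
  fixes N :: "real \<Rightarrow> real"
  assumes "\<And>s. 0 \<le> s \<Longrightarrow> s \<le> t \<Longrightarrow> (N has_real_derivative N' s) (at s)"
    and "\<And>s. 0 \<le> s \<Longrightarrow> s \<le> t \<Longrightarrow> N' s \<le> L * N s"
    and "0 \<le> t"
  shows "N t \<le> N 0 * exp (L * t)"
proof -
  have "N t * exp (- L * t) \<le> N 0 * exp (- L * 0)"
  proof (rule DERIV_nonpos_imp_nonincreasing[OF assms(3)])
    fix s assume s: "0 \<le> s" "s \<le> t"
    have "((\<lambda>s. N s * exp (- L * s)) has_real_derivative (N' s - L * N s) * exp (- L * s)) (at s)"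
      by (rule derivative_eq_intros assms(1)[OF s] refl | simp add: algebra_simps)+
    moreover have "(N' s - L * N s) * exp (- L * s) \<le> 0"
      using assms(2)[OF s] by (simp add: mult_le_0_iff)
    ultimately show "\<exists>y. ((\<lambda>s. N s * exp (- L * s)) has_real_derivative y) (at s) \<and> y \<le> 0"
      by blast
  qed
  then have "N t * exp (- L * t) * exp (L * t) \<le> N 0 * exp (L * t)"
    by simp
  then show ?thesis
    by (simp add: mult.assoc flip: exp_add)
qed

text \<open>Negative times follow from \<open>gronwall_right\<close> by reversing time, which is why
  the hypothesis bounds the absolute value of the derivative.\<close>

lemma gronwall:
  fixes N :: "real \<Rightarrow> real"
  assumes d: "\<And>s. \<bar>s\<bar> \<le> b \<Longrightarrow> (N has_real_derivative N' s) (at s)"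
    and le: "\<And>s. \<bar>s\<bar> \<le> b \<Longrightarrow> \<bar>N' s\<bar> \<le> L * N s"
    and "\<bar>t\<bar> \<le> b"
  shows "N t \<le> N 0 * exp (L * \<bar>t\<bar>)"
proof (cases "0 \<le> t")
  case True
  have "N t \<le> N 0 * exp (L * t)"
  proof (rule gronwall_right[OF _ _ True])
    fix s assume "0 \<le> s" "s \<le> t"
    then have *: "\<bar>s\<bar> \<le> b" using assms by auto
    show "(N has_real_derivative N' s) (at s)" using d[OF *] .
    show "N' s \<le> L * N s" using le[OF *] by simp
  qed
  with True show ?thesis by simp
next
  case False
  have "N (- (- t)) \<le> N (- 0) * exp (L * (- t))"
  proof (rule gronwall_right[of "- t" "\<lambda>s. N (- s)" "\<lambda>s. - N' (- s)"])
    fix s assume "0 \<le> s" "s \<le> - t"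
    then have *: "\<bar>- s\<bar> \<le> b" using assms by auto
    show "((\<lambda>s. N (- s)) has_real_derivative - N' (- s)) (at s)"
      using DERIV_chain'[OF DERIV_minus[OF DERIV_ident] d[OF *]] by (simp add: o_def)
    show "- N' (- s) \<le> L * N (- s)" using le[OF *] by simp
  qed (use False in simp)
  with False show ?thesis by simp
qed

text \<open>At an interior positive maximum the derivative vanishes and the second derivative is
  positive, so \<open>f\<close> would increase just to the right. The sign condition is confined to
  \<open>0 < f t\<close>, the form in which it arises after a barrier is subtracted.\<close>

lemma max_principle:
  fixes f :: "real \<Rightarrow> real"
  assumes cont: "continuous_on {a..b} f"
    and d1: "\<And>t. a < t \<Longrightarrow> t < b \<Longrightarrow> (f has_real_derivative f' t) (at t)"
    and d2: "\<And>t. a < t \<Longrightarrow> t < b \<Longrightarrow> (f' has_real_derivative f'' t) (at t)"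
    and pos: "\<And>t. a < t \<Longrightarrow> t < b \<Longrightarrow> 0 < f t \<Longrightarrow> 0 < f'' t"
    and t: "a \<le> t" "t \<le> b"
  shows "f t \<le> max 0 (max (f a) (f b))"
proof (rule ccontr)
  assume c: "\<not> ?thesis"
  obtain m where m: "m \<in> {a..b}" "\<And>s. s \<in> {a..b} \<Longrightarrow> f s \<le> f m"
    using continuous_attains_sup[OF compact_Icc _ cont] t by (metis atLeastAtMost_iff empty_iff)
  have "f t \<le> f m" using m t by auto
  with c have fm: "0 < f m" "m \<noteq> a" "m \<noteq> b" by auto
  with m(1) have am: "a < m" "m < b" by auto
  define \<delta> where "\<delta> = min (m - a) (b - m)"
  have \<delta>: "0 < \<delta>" using am by (simp add: \<delta>_def)
  have "f' m = 0"
  proof (rule DERIV_local_max[OF d1[OF am] \<delta>])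
    show "\<forall>y. \<bar>m - y\<bar> < \<delta> \<longrightarrow> f y \<le> f m"
      by (intro allI impI m(2)) (auto simp: \<delta>_def)
  qed
  obtain d where d: "0 < d" "\<And>h. 0 < h \<Longrightarrow> h < d \<Longrightarrow> f' m < f' (m + h)"
    using DERIV_pos_inc_right[OF d2[OF am] pos[OF am fm(1)]] by blast
  define y where "y = m + min d (b - m) / 2"
  have y: "m < y" "y < b" "y < m + d" using d am by (auto simp: y_def min_def field_simps)
  have "\<exists>z. m < z \<and> z < y \<and> f y - f m = (y - m) * f' z"
    by (rule MVT2[OF y(1)]) (use y am d1 in auto)
  then obtain z where z: "m < z" "z < y" "f y - f m = (y - m) * f' z" by blast
  have "0 < f' z" using d(2)[of "z - m"] z y \<open>f' m = 0\<close> by auto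
  then have "f m < f y" using z y by (metis diff_gt_0_iff_gt mult_pos_pos)
  with m(2)[of y] y am show False by auto
qed

text \<open>Barrier: \<open>K (b - t) / (b - a)\<close> plus a small multiple of \<open>1 / c + ln ((b - a) / (b - t))\<close>
  is a supersolution that exceeds the bounded function \<open>f\<close> near \<open>b\<close>.\<close>

lemma singular_convex_decay:
  fixes f :: "real \<Rightarrow> real"
  assumes "0 < c"
    and d1: "\<And>t. a \<le> t \<Longrightarrow> t < b \<Longrightarrow> (f has_real_derivative f' t) (at t)"
    and d2: "\<And>t. a \<le> t \<Longrightarrow> t < b \<Longrightarrow> (f' has_real_derivative f'' t) (at t)"
    and conv: "\<And>t. a \<le> t \<Longrightarrow> t < b \<Longrightarrow> c * f t / (b - t)\<^sup>2 \<le> f'' t"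
    and bd: "\<And>t. a \<le> t \<Longrightarrow> t < b \<Longrightarrow> f t \<le> K" "0 \<le> K"
    and t: "a \<le> t" "t < b"
  shows "f t \<le> K * (b - t) / (b - a)"
proof -
  have ab: "a < b" using t by simp
  \<comment> \<open>\<open>h\<close> has second derivative \<open>1 / (b - s)^2\<close> and stays
    above \<open>1 / c\<close>; both facts meet below where \<open>f\<close> exceeds the
    barrier.\<close>
  define h where "h s = 1 / c + ln (b - a) - ln (b - s)" for s
  have h_pos: "1 / c \<le> h s" if "a \<le> s" "s < b" for s
    using that by (simp add: h_def)
  have *: "f t - K * (b - t) / (b - a) \<le> \<epsilon> * h t" if \<epsilon>: "0 < \<epsilon>" for \<epsilon>
  proof -
    \<comment> \<open>At \<open>b0\<close> the logarithm equals \<open>K / \<epsilon>\<close>, so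
      from there on \<open>\<epsilon> * h\<close> alone is at least the bound \<open>K\<close> of
      \<open>f\<close>.\<close>
    define b0 where "b0 = b - (b - a) * exp (- (K / \<epsilon>))"
    have b0: "b0 < b" "a \<le> b0"
      using ab \<epsilon> bd(2) mult_left_le[of "exp (- (K / \<epsilon>))" "b - a"]
      by (auto simp: b0_def algebra_simps)
    have late: "f s - K * (b - s) / (b - a) \<le> \<epsilon> * h s" if "b0 \<le> s" "s < b" for s
    proof -
      have "ln (b - s) \<le> ln ((b - a) * exp (- (K / \<epsilon>)))"
        using that ab by (subst ln_le_cancel_iff) (auto simp: b0_def)
      also have "\<dots> = ln (b - a) - K / \<epsilon>"
        using ab by (simp add: ln_mult)
      finally have "K / \<epsilon> \<le> ln (b - a) - ln (b - s)" by simp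
      moreover have "0 < 1 / c" using \<open>0 < c\<close> by simp
      ultimately have "K / \<epsilon> \<le> h s" unfolding h_def by linarith
      then have "K \<le> \<epsilon> * h s"
        using \<epsilon> by (simp add: pos_divide_le_eq mult.commute)
      moreover have "0 \<le> K * (b - s) / (b - a)"
        using that ab bd by simp
      moreover have "f s \<le> K" using bd that b0 by simp
      ultimately show ?thesis by linarith
    qed
    show ?thesis
    proof (cases "b0 \<le> t")
      case True
      then show ?thesis using late t by simp
    next
      case False
      define d where "d s = f s - K * (b - s) / (b - a) - \<epsilon> * h s" for s
      define d' where "d' s = f' s + K / (b - a) - \<epsilon> / (b - s)" for s
      define d'' where "d'' s = f'' s - \<epsilon> / (b - s)\<^sup>2" for s
      have D: "(d has_real_derivative d' s) (at s)" if "a \<le> s" "s < b" for s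
        unfolding d_def d'_def h_def
        using d1[OF that] that ab
        by (auto intro!: derivative_eq_intros simp: divide_simps) (simp add: algebra_simps)?
      have D': "(d' has_real_derivative d'' s) (at s)" if "a \<le> s" "s < b" for s
        unfolding d'_def d''_def
        using d2[OF that] that ab
        by (auto intro!: derivative_eq_intros simp: power2_eq_square)
      have "d t \<le> max 0 (max (d a) (d b0))"
      proof (rule max_principle[of a b0 d d' d'' t])
        show "continuous_on {a..b0} d"
          by (intro continuous_at_imp_continuous_on ballI DERIV_isCont[OF D]) (use b0 in auto)
        show "0 < d'' s" if s: "a < s" "s < b0" "0 < d s" for s
        proof -
          have sb: "s < b" using s b0 by simp
          have "0 \<le> K * (b - s) / (b - a)"
            using sb ab bd by simp
          then have "\<epsilon> * h s < f s" using s by (simp add: d_def)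
          moreover have "\<epsilon> * (1 / c) \<le> \<epsilon> * h s"
            using h_pos[of s] s sb \<epsilon> by (intro mult_left_mono) auto
          \<comment> \<open>Here the summand \<open>1 / c\<close> of \<open>h\<close> pays: it gives
            \<open>c * f s > \<epsilon>\<close>, so the singular convexity of \<open>f\<close> beats
            the second derivative of \<open>\<epsilon> * h\<close>.\<close>
          ultimately have "\<epsilon> * (1 / c) < f s" by linarith
          then have "\<epsilon> < c * f s" using \<open>0 < c\<close> by (simp add: field_simps)
          then have "\<epsilon> / (b - s)\<^sup>2 < c * f s / (b - s)\<^sup>2"
            using sb by (intro divide_strict_right_mono) auto
          also have "\<dots> \<le> f'' s" using conv s sb by simp
          finally show ?thesis by (simp add: d''_def)
        qed
      qed (use D D' b0 t False in auto)
      moreover have "d a \<le> 0"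
      proof -
        have "0 \<le> \<epsilon> * h a" using h_pos[of a] ab \<epsilon> \<open>0 < c\<close>
          by (smt (verit) divide_pos_pos mult_nonneg_nonneg)
        moreover have "K * (b - a) / (b - a) = K" using ab by simp
        ultimately show ?thesis using bd(1)[of a] ab by (simp add: d_def)
      qed
      moreover have "d b0 \<le> 0" using late[of b0] b0 by (simp add: d_def)
      ultimately show ?thesis by (simp add: d_def)
    qed
  qed
  have h0: "0 < h t" using h_pos[OF t] \<open>0 < c\<close> by (smt (verit) divide_pos_pos)
  \<comment> \<open>At the fixed time \<open>t\<close> the value \<open>h t\<close> is finite, so
    \<epsilon> may tend to 0.\<close>
  have "f t - K * (b - t) / (b - a) \<le> 0"
  proof (rule field_le_epsilon)
    fix r :: real assume "0 < r"
    then show "f t - K * (b - t) / (b - a) \<le> 0 + r"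
      using *[of "r / h t"] h0 by simp
  qed
  then show ?thesis by simp
qed

text \<open>Bolzano-Weierstrass in finite dimension, one coordinate at a time. It serves the initial
  data as \<open>e\<close> tends to 1 and the minimizing sequence of the Rayleigh quotient.\<close>

lemma common_convergent_subseq:
  fixes x :: "nat \<Rightarrow> nat \<Rightarrow> real"
  assumes "\<And>n i. i < k \<Longrightarrow> \<bar>x n i\<bar> \<le> C"
  shows "\<exists>r. strict_mono r \<and> (\<forall>i<k. convergent (\<lambda>n. x (r n) i))"
  using assms
proof (induction k)
  case 0
  then show ?case by (auto intro: strict_mono_id[unfolded id_def])
next
  case (Suc k)
  then obtain r where r: "strict_mono r" "\<forall>i<k. convergent (\<lambda>n. x (r n) i)" by auto
  have "bounded (range (\<lambda>n. x (r n) k))"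
    using Suc.prems[of k] by (auto simp: bounded_iff)
  then obtain l s where s: "strict_mono s" "((\<lambda>n. x (r n) k) \<circ> s) \<longlonglongrightarrow> l"
    using bounded_imp_convergent_subsequence by blast
  have "convergent (\<lambda>n. x (r (s n)) i)" if "i < Suc k" for i
  proof (cases "i = k")
    case True
    then show ?thesis using s by (auto simp: o_def convergent_def)
  next
    case False
    then have "convergent (\<lambda>n. x (r n) i)" using r that by auto
    then show ?thesis using convergent_subseq_convergent[OF _ s(1)] by (auto simp: o_def)
  qed
  moreover have "strict_mono (r \<circ> s)" using r s by (simp add: strict_mono_o)
  ultimately show ?case by (intro exI[of _ "r \<circ> s"]) (auto simp: o_def)
qed

section \<open>The reduced system\<close>

text \<open>The system of \<open>B(t)\<close> in the Meyer--Schmidt reduction with the momentum \<open>Y + J X\<close> replaced by the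
  velocity \<open>Y\<close>.\<close>

definition lin_kepler ::
  "nat \<Rightarrow> (nat \<Rightarrow> nat \<Rightarrow> real) \<Rightarrow> real \<Rightarrow> real set \<Rightarrow> (real \<Rightarrow> nat \<Rightarrow> real) \<Rightarrow> (real \<Rightarrow> nat \<Rightarrow> real) \<Rightarrow> bool"
  where "lin_kepler k R e S X Y \<longleftrightarrow>
    (\<forall>t\<in>S. \<forall>i<k. ((\<lambda>s. X s i) has_real_derivative Y t i) (at t) \<and>
       ((\<lambda>s. Y s i) has_real_derivative
          (- 2 * jj (Y t) i + app k R (X t) i / (1 + e * cos t))) (at t))"

lemma lin_kepler_subset: "lin_kepler k R e S X Y \<Longrightarrow> T \<subseteq> S \<Longrightarrow> lin_kepler k R e T X Y"
  by (auto simp: lin_kepler_def)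

text \<open>Gronwall for \<open>|D|^2 + |E|^2 + G\<close>: the Coriolis term is orthogonal to
  \<open>E\<close>, and adding the bound \<open>G\<close> of the forcing to the energy makes the
  estimate homogeneous. With \<open>g = 0\<close> it controls one solution, with a defect
  \<open>g\<close> the difference of two.\<close>

lemma energy_bound:
  assumes k: "even k"
    and dD: "\<And>s i. \<bar>s\<bar> \<le> b \<Longrightarrow> i < k \<Longrightarrow> ((\<lambda>s. D s i) has_real_derivative E s i) (at s)"
    and dE: "\<And>s i. \<bar>s\<bar> \<le> b \<Longrightarrow> i < k \<Longrightarrow> ((\<lambda>s. E s i) has_real_derivative
               (- 2 * jj (E s) i + w s * app k R (D s) i + g s i)) (at s)"
    and w: "\<And>s. \<bar>s\<bar> \<le> b \<Longrightarrow> \<bar>w s\<bar> \<le> \<kappa>"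
    and g: "\<And>s. \<bar>s\<bar> \<le> b \<Longrightarrow> ip k (g s) (g s) \<le> G"
    and t: "\<bar>t\<bar> \<le> b"
  shows "ip k (D t) (D t) + ip k (E t) (E t) + G \<le>
    (ip k (D 0) (D 0) + ip k (E 0) (E 0) + G) * exp ((2 + \<kappa> + \<kappa> * sqnorm k R) * \<bar>t\<bar>)"
proof -
  define F where "F s = (\<lambda>i. - 2 * jj (E s) i + w s * app k R (D s) i + g s i)" for s
  define N' where "N' s = 2 * ip k (D s) (E s) + 2 * ip k (E s) (F s)" for s
  show ?thesis
  proof (rule gronwall[where N' = N', OF _ _ t])
    fix s assume s: "\<bar>s\<bar> \<le> b"
    have "((\<lambda>s. ip k (D s) (D s)) has_real_derivative 2 * ip k (D s) (E s)) (at s)"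
      by (rule DERIV_ip_self) (rule dD[OF s])
    moreover have "((\<lambda>s. ip k (E s) (E s)) has_real_derivative 2 * ip k (E s) (F s)) (at s)"
      unfolding F_def by (rule DERIV_ip_self) (rule dE[OF s])
    ultimately show "((\<lambda>t. ip k (D t) (D t) + ip k (E t) (E t) + G) has_real_derivative N' s) (at s)"
      unfolding N'_def by (auto intro!: derivative_eq_intros)
    let ?D = "ip k (D s) (D s)" and ?E = "ip k (E s) (E s)" and ?A = "app k R (D s)"
    have 1: "\<bar>2 * ip k (D s) (E s)\<bar> \<le> ?D + ?E"
      using two_ip_le[of k "D s" "E s"] by simp
    have "\<bar>2 * ip k (E s) ?A\<bar> \<le> ?E + sqnorm k R * ?D"
      using two_ip_le[of k "E s" ?A] app_bound[of k R "D s"] by simp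
    then have 2: "\<bar>w s * (2 * ip k (E s) ?A)\<bar> \<le> \<kappa> * (?E + sqnorm k R * ?D)"
      unfolding abs_mult using w[OF s] by (intro mult_mono) auto
    have 3: "\<bar>2 * ip k (E s) (g s)\<bar> \<le> ?E + G"
      using two_ip_le[of k "E s" "g s"] g[OF s] by simp
    have "2 * ip k (E s) (F s) = w s * (2 * ip k (E s) ?A) + 2 * ip k (E s) (g s)"
      by (simp add: F_def ip_linear ip_jj_self[OF k])
    then have "\<bar>N' s\<bar> \<le> (?D + ?E) + \<kappa> * (?E + sqnorm k R * ?D) + (?E + G)"
      unfolding N'_def using 1 2 3 by linarith
    also have "\<dots> \<le> (2 + \<kappa> + \<kappa> * sqnorm k R) * (?D + ?E + G)"
    proof -
      have nn: "0 \<le> \<kappa>" "0 \<le> G" "0 \<le> sqnorm k R"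
        using w[OF s] g[OF s] ip_nonneg[of k "g s"] sqnorm_nonneg[of k R] by linarith+
      then have "0 \<le> ?D * \<kappa>" "0 \<le> G * \<kappa>" "0 \<le> \<kappa> * sqnorm k R * ?E" "0 \<le> \<kappa> * sqnorm k R * G"
        using ip_nonneg by auto
      then show ?thesis using nn ip_nonneg[of k "D s"] by (simp add: algebra_simps)
    qed
    finally show "\<bar>N' s\<bar> \<le> (2 + \<kappa> + \<kappa> * sqnorm k R) * (?D + ?E + G)" .
  qed
qed

text \<open>The worst case over \<open>e\<close> is \<open>e = 1\<close> where the cosine is
  negative and \<open>e = 0\<close> otherwise; hence \<open>min 0\<close>. The bound is uniform in
  \<open>e\<close> but degenerates as \<open>b\<close> tends to \<pi>.\<close>

lemma one_plus_cos_bound: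
  assumes "0 \<le> e" "e \<le> 1" "\<bar>t\<bar> \<le> b" "b < pi"
  shows "1 + min 0 (cos b) \<le> 1 + e * cos t" "0 < 1 + min 0 (cos b)"
proof -
  have "cos b \<le> cos \<bar>t\<bar>"
    using assms by (intro cos_monotone_0_pi_le) auto
  then have c: "cos b \<le> cos t" by simp
  have "e * min 0 (cos b) \<le> e * cos t"
    using c assms by (intro mult_left_mono) auto
  moreover have "1 * min 0 (cos b) \<le> e * min 0 (cos b)"
    using assms by (intro mult_right_mono_neg) auto
  ultimately show "1 + min 0 (cos b) \<le> 1 + e * cos t" by simp
  have "cos pi < cos b"
    using assms by (intro cos_monotone_0_pi) auto
  then show "0 < 1 + min 0 (cos b)" by (simp add: min_def)
qed

lemma lin_kepler_energy:
  assumes k: "even k" and sol: "lin_kepler k R e {-b..b} X Y"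
    and "0 \<le> e" "e \<le> 1" "\<bar>t\<bar> \<le> b" "b < pi"
  shows "ip k (X t) (X t) + ip k (Y t) (Y t) \<le> (ip k (X 0) (X 0) + ip k (Y 0) (Y 0)) *
    exp ((2 + 1 / (1 + min 0 (cos b)) + 1 / (1 + min 0 (cos b)) * sqnorm k R) * \<bar>t\<bar>)"
proof -
  have "\<bar>1 / (1 + e * cos s)\<bar> \<le> 1 / (1 + min 0 (cos b))" if "\<bar>s\<bar> \<le> b" for s
    using one_plus_cos_bound[OF assms(3,4) that assms(6)] by (auto simp: frac_le)
  then have "ip k (X t) (X t) + ip k (Y t) (Y t) + 0 \<le> (ip k (X 0) (X 0) + ip k (Y 0) (Y 0) + 0) *
    exp ((2 + 1 / (1 + min 0 (cos b)) + 1 / (1 + min 0 (cos b)) * sqnorm k R) * \<bar>t\<bar>)"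
    by (intro energy_bound[OF k, where D = X and E = Y and w = "\<lambda>s. 1 / (1 + e * cos s)" and b = b
        and g = "\<lambda>_ _. 0"]) (use sol assms(5) in \<open>auto simp: lin_kepler_def ip_def abs_le_iff\<close>)
  then show ?thesis by simp
qed

lemma lin_kepler_shift:
  assumes "lin_kepler k R e UNIV X Y"
  shows "lin_kepler k R e UNIV (\<lambda>t. X (t + 2 * pi * of_int j)) (\<lambda>t. Y (t + 2 * pi * of_int j))"
  unfolding lin_kepler_def
proof (intro ballI allI impI conjI)
  fix t i assume i: "i < k"
  let ?t = "t + 2 * pi * of_int j"
  have c: "cos ?t = cos t" by (simp add: cos_add)
  have *: "((\<lambda>s. f (s + 2 * pi * of_int j)) has_real_derivative d) (at t)"
    if "(f has_real_derivative d) (at ?t)" for f :: "real \<Rightarrow> real" and d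
    using that by (simp add: DERIV_shift)
  have d: "((\<lambda>s. X s i) has_real_derivative Y ?t i) (at ?t)"
     "((\<lambda>s. Y s i) has_real_derivative
          (- 2 * jj (Y ?t) i + app k R (X ?t) i / (1 + e * cos t))) (at ?t)"
    using assms i unfolding lin_kepler_def c[symmetric] by auto
  show "((\<lambda>s. X (s + 2 * pi * of_int j) i) has_real_derivative Y ?t i) (at t)"
    by (rule *[OF d(1)])
  show "((\<lambda>s. Y (s + 2 * pi * of_int j) i) has_real_derivative
       - 2 * jj (Y ?t) i + app k R (X ?t) i / (1 + e * cos t)) (at t)"
    by (rule *[OF d(2)])
qed

lemma lin_kepler_scale:
  assumes "lin_kepler k R e S X Y"
  shows "lin_kepler k R e S (\<lambda>t i. c * X t i) (\<lambda>t i. c * Y t i)"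
  unfolding lin_kepler_def
proof (intro ballI allI impI conjI)
  fix t i assume "t \<in> S" "i < k"
  then have d: "((\<lambda>s. X s i) has_real_derivative Y t i) (at t)"
     "((\<lambda>s. Y s i) has_real_derivative
          (- 2 * jj (Y t) i + app k R (X t) i / (1 + e * cos t))) (at t)"
    using assms by (auto simp: lin_kepler_def)
  show "((\<lambda>s. c * X s i) has_real_derivative c * Y t i) (at t)"
    by (rule DERIV_cmult[OF d(1)])
  show "((\<lambda>s. c * Y s i) has_real_derivative
       - 2 * jj (\<lambda>i. c * Y t i) i + app k R (\<lambda>i. c * X t i) i / (1 + e * cos t)) (at t)"
    using DERIV_cmult[OF d(2), of c] by (simp add: jj_scale app_scale algebra_simps)
qed

section \<open>Convexity of the square norm for positive definite R\<close>

locale coercive =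
  fixes k :: nat and R :: "nat \<Rightarrow> nat \<Rightarrow> real" and \<rho> :: real
  assumes even_k: "even k" and rho_pos: "0 < \<rho>"
    and coercive: "\<And>x. \<rho> * ip k x x \<le> ip k x (app k R x)"
begin

text \<open>The bound \<rho> / 4 leaves a margin: once \<open>1 - e < \<delta>\<close>, the value
  \<open>1 + e cos t\<close> stays below \<open>2 \<delta> \<le> \<rho> / 2\<close> on the arc about
  \<pi>, and on the parabolic orbit three quarters of \<open>\<rho> / (1 + cos t)\<close> survive
  the subtraction of 1. The bound 1 / 4 makes \<open>\<delta> - 1\<close> a negative cosine.\<close>

definition \<delta> where "\<delta> = min 1 \<rho> / 4"

definition \<theta>\<^sub>0 where "\<theta>\<^sub>0 = arccos (\<delta> - 1)"

lemma \<delta>: "0 < \<delta>" "\<delta> \<le> 1 / 4" "\<delta> \<le> \<rho> / 4"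
  using rho_pos by (auto simp: \<delta>_def)

lemma \<theta>\<^sub>0: "0 < \<theta>\<^sub>0" "\<theta>\<^sub>0 < pi" "cos \<theta>\<^sub>0 = \<delta> - 1"
  using arccos_lt_bounded[of "\<delta> - 1"] cos_arccos[of "\<delta> - 1"] \<delta> by (auto simp: \<theta>\<^sub>0_def)

text \<open>What the equation of motion gives for the second derivative of the square norm of
  \<open>X\<close>.\<close>

definition sq'' where
  "sq'' e X Y t = 2 * ip k (Y t) (Y t) +
     2 * ip k (X t) (\<lambda>i. - 2 * jj (Y t) i + app k R (X t) i / (1 + e * cos t))"

lemma sq_deriv:
  assumes "lin_kepler k R e S X Y" "t \<in> S"
  shows "((\<lambda>t. ip k (X t) (X t)) has_real_derivative 2 * ip k (X t) (Y t)) (at t)"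
    and "((\<lambda>t. 2 * ip k (X t) (Y t)) has_real_derivative sq'' e X Y t) (at t)"
proof -
  have dX: "\<And>i. i < k \<Longrightarrow> ((\<lambda>s. X s i) has_real_derivative Y t i) (at t)"
    and dY: "\<And>i. i < k \<Longrightarrow> ((\<lambda>s. Y s i) has_real_derivative
          (- 2 * jj (Y t) i + app k R (X t) i / (1 + e * cos t))) (at t)"
    using assms by (auto simp: lin_kepler_def)
  show "((\<lambda>t. ip k (X t) (X t)) has_real_derivative 2 * ip k (X t) (Y t)) (at t)"
    by (rule DERIV_ip_self[OF dX])
  show "((\<lambda>t. 2 * ip k (X t) (Y t)) has_real_derivative sq'' e X Y t) (at t)"
    unfolding sq''_def distrib_left[symmetric]
    by (rule DERIV_cmult, rule DERIV_ip[of k X "Y t" t Y, OF dX dY])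
qed

text \<open>Since \<open>jj\<close> is an isometry, \<open>4 <X, J Y>\<close> is at most
  \<open>2 |X|^2 + 2 |Y|^2\<close>, and the kinetic term cancels.\<close>

lemma sq''_ge:
  assumes "0 < 1 + e * cos t"
  shows "2 * (\<rho> / (1 + e * cos t) - 1) * ip k (X t) (X t) \<le> sq'' e X Y t"
proof -
  have "sq'' e X Y t = 2 * ip k (Y t) (Y t) - 4 * ip k (X t) (jj (Y t))
      + 2 * ip k (X t) (app k R (X t)) / (1 + e * cos t)"
    unfolding sq''_def ip_add_right ip_scale_right ip_div_right by simp
  moreover have "2 * \<bar>ip k (X t) (jj (Y t))\<bar> \<le> ip k (X t) (X t) + ip k (Y t) (Y t)"
    using two_ip_le[of k "X t" "jj (Y t)"] by (simp add: ip_jj_jj[OF even_k])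
  moreover have "2 * (\<rho> * ip k (X t) (X t)) / (1 + e * cos t)
      \<le> 2 * ip k (X t) (app k R (X t)) / (1 + e * cos t)"
    using coercive[of "X t"] assms by (intro divide_right_mono) auto
  ultimately show ?thesis by (simp add: algebra_simps)
qed

text \<open>The arc contains the near-collision at \<pi>. For every \<open>e\<close> close to 1 the
  second derivative of \<open>f\<close> is positive there wherever \<open>f\<close> is, so no mass
  concentrates in its interior.\<close>

lemma far_bound:
  assumes sol: "lin_kepler k R e UNIV X Y" and e: "0 \<le> e" "e < 1" "1 - e < \<delta>"
    and t: "\<theta>\<^sub>0 \<le> t" "t \<le> 2 * pi - \<theta>\<^sub>0"
  shows "ip k (X t) (X t) \<le>
    max (ip k (X \<theta>\<^sub>0) (X \<theta>\<^sub>0)) (ip k (X (2 * pi - \<theta>\<^sub>0)) (X (2 * pi - \<theta>\<^sub>0)))"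
proof -
  let ?f = "\<lambda>t. ip k (X t) (X t)"
  have "?f t \<le> max 0 (max (?f \<theta>\<^sub>0) (?f (2 * pi - \<theta>\<^sub>0)))"
  proof (rule max_principle[of \<theta>\<^sub>0 "2 * pi - \<theta>\<^sub>0" ?f "\<lambda>t. 2 * ip k (X t) (Y t)" "sq'' e X Y" t])
    show "continuous_on {\<theta>\<^sub>0..2 * pi - \<theta>\<^sub>0} ?f"
      by (intro continuous_at_imp_continuous_on ballI DERIV_isCont[OF sq_deriv(1)[OF sol]]) auto
    show "0 < sq'' e X Y s" if s: "\<theta>\<^sub>0 < s" "s < 2 * pi - \<theta>\<^sub>0" "0 < ?f s" for s
    proof -
      have "cos s \<le> cos \<theta>\<^sub>0"
      proof (cases "s \<le> pi")
        case True
        then show ?thesis using s \<theta>\<^sub>0 by (intro cos_monotone_0_pi_le) auto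
      next
        case False
        then have "cos (2 * pi - s) \<le> cos \<theta>\<^sub>0"
          using s \<theta>\<^sub>0 by (intro cos_monotone_0_pi_le) auto
        then show ?thesis by (simp add: cos_diff)
      qed
      then have "e * cos s \<le> e * (\<delta> - 1)"
        using e \<theta>\<^sub>0(3) by (intro mult_left_mono) auto
      moreover have "e * \<delta> \<le> \<delta>" using e \<delta> by (simp add: mult_left_le_one_le)
      \<comment> \<open>The chain is \<open>1 + e cos s \<le> (1 - e) + e \<delta> < 2 \<delta>
        \<le> \<rho> / 2\<close>.\<close>
      ultimately have up: "1 + e * cos s < \<rho>"
        using e \<delta> rho_pos unfolding right_diff_distrib by linarith
      have "e * (-1) \<le> e * cos s" using e by (intro mult_left_mono) auto
      then have lo: "0 < 1 + e * cos s" using e by simp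
      have "0 < 2 * (\<rho> / (1 + e * cos s) - 1) * ?f s"
        using up lo s(3) by (intro mult_pos_pos) (auto simp: field_simps)
      also have "\<dots> \<le> sq'' e X Y s" by (rule sq''_ge[OF lo])
      finally show ?thesis .
    qed
  qed (use sq_deriv[OF sol] t in auto)
  then show ?thesis using ip_nonneg[of k "X \<theta>\<^sub>0"] by linarith
qed

text \<open>Growth factor of the energy on the arc
  \<open>\<bar>t\<bar> \<le> \<theta>\<^sub>0\<close>, where the coefficient is at most
  \<open>1 / \<delta>\<close>. It is independent of \<open>e\<close>, which gives the later limit a
  uniform bound.\<close>

definition growth where
  "growth = exp ((2 + 1 / \<delta> + 1 / \<delta> * sqnorm k R) * \<theta>\<^sub>0)"

lemma growth_pos: "0 < growth"
  by (simp add: growth_def)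

lemma core_energy:
  assumes "lin_kepler k R e UNIV X Y" and e: "0 \<le> e" "e < 1" and t: "\<bar>t\<bar> \<le> \<theta>\<^sub>0"
  shows "ip k (X t) (X t) \<le> (ip k (X 0) (X 0) + ip k (Y 0) (Y 0)) * growth"
proof -
  have m: "1 + min 0 (cos \<theta>\<^sub>0) = \<delta>" using \<delta> by (simp add: \<theta>\<^sub>0)
  have "ip k (X t) (X t) + ip k (Y t) (Y t) \<le> (ip k (X 0) (X 0) + ip k (Y 0) (Y 0)) *
    exp ((2 + 1 / \<delta> + 1 / \<delta> * sqnorm k R) * \<bar>t\<bar>)"
    using lin_kepler_energy[OF even_k lin_kepler_subset[OF assms(1)], of \<theta>\<^sub>0 t] e t \<theta>\<^sub>0
    unfolding m by simp
  also have "\<dots> \<le> (ip k (X 0) (X 0) + ip k (Y 0) (Y 0)) * growth"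
    unfolding growth_def using t \<delta> sqnorm_nonneg[of k R]
    by (intro mult_left_mono add_nonneg_nonneg ip_nonneg iffD2[OF exp_le_cancel_iff]) auto
  finally show ?thesis using ip_nonneg[of k "Y t"] by linarith
qed

text \<open>By \<open>far_bound\<close> the supremum of the square norm is almost attained over one of the arcs
  \<open>\<bar>t - 2 \<pi> j\<bar> \<le> \<theta>\<^sub>0\<close>, where it is controlled by the data at \<open>2 \<pi> j\<close>.\<close>

lemma normalize_bounded_solution:
  assumes sol: "lin_kepler k R e UNIV X Y" and e: "0 \<le> e" "e < 1" "1 - e < \<delta>"
    and bd: "\<And>t. ip k (X t) (X t) \<le> C"
    and nz: "\<exists>t. 0 < ip k (X t) (X t) + ip k (Y t) (Y t)"
  shows "\<exists>X Y. lin_kepler k R e UNIV X Y \<and> ip k (X 0) (X 0) + ip k (Y 0) (Y 0) = 1 \<and>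
    (\<forall>t. ip k (X t) (X t) \<le> 2 * growth)"
proof -
  let ?f = "\<lambda>t. ip k (X t) (X t)"
  define S where "S = Sup (range ?f)"
  have bdd: "bdd_above (range ?f)" using bd by (auto simp: bdd_above_def)
  have le_S: "?f t \<le> S" for t unfolding S_def by (rule cSup_upper[OF _ bdd]) auto
  \<comment> \<open>\<open>X\<close> cannot vanish identically, since then its derivative
    \<open>Y\<close> would vanish too.\<close>
  have "\<exists>t. 0 < ?f t"
  proof (rule ccontr)
    assume "\<not> ?thesis"
    then have X0: "X t i = 0" if "i < k" for t i
      using that unfolding ip_pos_iff by blast
    have "Y t i = 0" if "i < k" for t i
    proof -
      have "((\<lambda>s. X s i) has_real_derivative Y t i) (at t)"
        using sol that by (auto simp: lin_kepler_def)
      moreover have "(\<lambda>s. X s i) = (\<lambda>_. 0)" using X0[OF that] by blast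
      ultimately have "((\<lambda>_. 0) has_real_derivative Y t i) (at t)" by simp
      then show ?thesis by (rule DERIV_unique) (rule DERIV_const)
    qed
    then show False using nz X0 by (simp add: ip_def)
  qed
  then have S_pos: "0 < S" using le_S by (meson less_le_trans)
  \<comment> \<open>The supremum need not be attained; settling for more than half of it is the
    origin of the factor 2 in the conclusion.\<close>
  then obtain t where t: "S / 2 < ?f t"
    using less_cSup_iff[OF _ bdd, of "S / 2"] unfolding S_def by auto
  define j where "j = \<lfloor>(t + \<theta>\<^sub>0) / (2 * pi)\<rfloor>"
  define X' where "X' s = X (s + 2 * pi * of_int j)" for s
  define Y' where "Y' s = Y (s + 2 * pi * of_int j)" for s
  have sol': "lin_kepler k R e UNIV X' Y'"
    unfolding X'_def Y'_def by (rule lin_kepler_shift[OF sol])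
  define u where "u = t - 2 * pi * of_int j"
  have "of_int j \<le> (t + \<theta>\<^sub>0) / (2 * pi)" "(t + \<theta>\<^sub>0) / (2 * pi) < of_int j + 1"
    unfolding j_def by linarith+
  then have u: "- \<theta>\<^sub>0 \<le> u" "u < 2 * pi - \<theta>\<^sub>0"
    by (simp_all add: u_def pos_le_divide_eq pos_divide_less_eq algebra_simps)
  let ?f' = "\<lambda>t. ip k (X' t) (X' t)"
  have fu: "S / 2 < ?f' u" using t by (simp add: X'_def u_def)
  \<comment> \<open>Either \<open>u\<close> lies on the arc about 0, or \<open>far_bound\<close>
    passes the large value to an end of the far arc; these ends belong to the arcs about 0 and about
    2 \<pi>.\<close>
  consider "u \<le> \<theta>\<^sub>0" | "S / 2 < ?f' \<theta>\<^sub>0" | "S / 2 < ?f' (2 * pi - \<theta>\<^sub>0)"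
    using far_bound[OF sol' e, of u] u fu by linarith
  then obtain i v where v: "\<bar>v - 2 * pi * of_int (i::int)\<bar> \<le> \<theta>\<^sub>0" "S / 2 < ?f' v"
  proof cases
    case 1
    then show ?thesis using that[of u 0] u fu by simp
  next
    case 2
    then show ?thesis using that[of "\<theta>\<^sub>0" 0] \<theta>\<^sub>0 by simp
  next
    case 3
    then show ?thesis using that[of "2 * pi - \<theta>\<^sub>0" 1] \<theta>\<^sub>0 by simp
  qed
  define A where "A s = X' (s + 2 * pi * of_int i)" for s
  define B where "B s = Y' (s + 2 * pi * of_int i)" for s
  have solA: "lin_kepler k R e UNIV A B"
    unfolding A_def B_def by (rule lin_kepler_shift[OF sol'])
  define N where "N = ip k (A 0) (A 0) + ip k (B 0) (B 0)"
  have "S / 2 < ip k (A (v - 2 * pi * of_int i)) (A (v - 2 * pi * of_int i))"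
    using v(2) by (simp add: A_def)
  also have "\<dots> \<le> N * growth"
    unfolding N_def by (rule core_energy[OF solA e(1,2) v(1)])
  finally have SN: "S / 2 < N * growth" .
  then have "0 < N * growth" using S_pos by linarith
  then have N: "0 < N" by (rule zero_less_mult_pos2[OF _ growth_pos])
  define c where "c = 1 / sqrt N"
  have c2: "c * c = 1 / N" using N by (simp add: c_def)
  have ip_c: "ip k (\<lambda>i. c * x i) (\<lambda>i. c * x i) = ip k x x / N" for x
    using c2 by (simp add: ip_linear mult.assoc[symmetric])
  have "ip k (\<lambda>i. c * A 0 i) (\<lambda>i. c * A 0 i) + ip k (\<lambda>i. c * B 0 i) (\<lambda>i. c * B 0 i) = 1"
    unfolding ip_c add_divide_distrib[symmetric] using N by (simp flip: N_def)
  moreover have "ip k (\<lambda>i. c * A t i) (\<lambda>i. c * A t i) \<le> 2 * growth" for t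
  proof -
    have "ip k (A t) (A t) \<le> 2 * growth * N"
      using le_S[of "t + 2 * pi * of_int i + 2 * pi * of_int j"] SN
      by (simp add: A_def X'_def mult.commute mult.left_commute)
    then show ?thesis using N by (simp add: ip_c pos_divide_le_eq)
  qed
  ultimately show ?thesis using lin_kepler_scale[OF solA, of c] by blast
qed

end

section \<open>Passage to the limit as e tends to 1\<close>

lemma DERIV_uniform_limit:
  fixes f :: "nat \<Rightarrow> real \<Rightarrow> real"
  assumes der: "\<And>n t. a < t \<Longrightarrow> t < b \<Longrightarrow> (f n has_real_derivative f' n t) (at t)"
    and lim': "uniform_limit {a<..<b} f' g' sequentially"
    and lim: "\<And>t. a < t \<Longrightarrow> t < b \<Longrightarrow> (\<lambda>n. f n t) \<longlonglongrightarrow> g t"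
    and t: "a < t" "t < b"
  shows "(g has_real_derivative g' t) (at t)"
proof -
  have "\<exists>h. \<forall>x\<in>{a<..<b}. (\<lambda>n. f n x) \<longlonglongrightarrow> h x \<and> (h has_derivative (*) (g' x)) (at x within {a<..<b})"
  proof (rule has_derivative_sequence[where f = f and f' = "\<lambda>n x. (*) (f' n x)" and ?x0.0 = t and l
      = "g t"])
    fix n x assume "x \<in> {a<..<b}"
    then show "(f n has_derivative (*) (f' n x)) (at x within {a<..<b})"
      using der[of x n] by (auto simp: has_field_derivative_def intro: has_derivative_at_withinI)
  next
    fix \<epsilon> :: real assume "0 < \<epsilon>"
    from uniform_limitD[OF lim' this]
    show "\<forall>\<^sub>F n in sequentially. \<forall>x\<in>{a<..<b}. \<forall>h. norm (f' n x * h - g' x * h) \<le> \<epsilon> * norm h"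
    proof eventually_elim
      case (elim n)
      show ?case
      proof (intro ballI allI)
        fix x h assume "x \<in> {a<..<b}"
        then have "\<bar>f' n x - g' x\<bar> \<le> \<epsilon>" using elim by (auto simp: dist_real_def intro: less_imp_le)
        then have "\<bar>f' n x - g' x\<bar> * \<bar>h\<bar> \<le> \<epsilon> * \<bar>h\<bar>" by (intro mult_right_mono) auto
        then show "norm (f' n x * h - g' x * h) \<le> \<epsilon> * norm h"
          by (simp add: abs_mult flip: left_diff_distrib)
      qed
    qed
  qed (use t lim in auto)
  then obtain h where h: "\<And>x. x \<in> {a<..<b} \<Longrightarrow> (\<lambda>n. f n x) \<longlonglongrightarrow> h x"
    "\<And>x. x \<in> {a<..<b} \<Longrightarrow> (h has_derivative (*) (g' x)) (at x within {a<..<b})" by blast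
  have eq: "h x = g x" if "x \<in> {a<..<b}" for x
    using LIMSEQ_unique[OF h(1)[OF that] lim] that by auto
  have "(h has_derivative (*) (g' t)) (at t)"
    using h(2)[of t] t at_within_open[of t "{a<..<b}"] by auto
  then have "(h has_real_derivative g' t) (at t)" by (simp add: has_field_derivative_def)
  then show ?thesis
    by (rule has_field_derivative_transform_within_open[of _ _ _ "{a<..<b}"]) (use t eq in auto)
qed

lemma uniform_limit_app:
  assumes "\<And>j. j < k \<Longrightarrow> uniform_limit S (\<lambda>n t. X n t j) (\<lambda>t. Xl t j) F"
  shows "uniform_limit S (\<lambda>n t. app k R (X n t) i) (\<lambda>t. app k R (Xl t) i) F"
proof -
  have "uniform_limit S (\<lambda>n t. app m R (X n t) i) (\<lambda>t. app m R (Xl t) i) F" if "m \<le> k" for m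
    using that
  proof (induction m)
    case 0
    then show ?case by (auto simp: app_def intro: uniform_limit_const)
  next
    case (Suc m)
    have "uniform_limit S (\<lambda>n t. app m R (X n t) i + R i m * X n t m)
        (\<lambda>t. app m R (Xl t) i + R i m * Xl t m) F"
      using Suc assms[of m]
      by (intro uniform_limit_add bounded_linear.uniform_limit[OF bounded_linear_mult_right]) auto
    then show ?case by (simp add: app_def)
  qed
  then show ?thesis by simp
qed

lemma uniform_limit_jj:
  assumes k: "even k" "i < k"
    and lim: "\<And>j. j < k \<Longrightarrow> uniform_limit S (\<lambda>n t. X n t j) (\<lambda>t. Xl t j) F"
  shows "uniform_limit S (\<lambda>n t. jj (X n t) i) (\<lambda>t. jj (Xl t) i) F"
proof (cases "even i")
  case True
  with k have "i + 1 < k" by (metis Suc_eq_plus1 Suc_lessI even_Suc)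
  from lim[OF this] True show ?thesis by (auto simp: jj_def intro: uniform_limit_intros)
qed (use k lim in \<open>simp add: jj_def\<close>)

lemma ip_diff_le: "ip k (\<lambda>i. x i - y i) (\<lambda>i. x i - y i) \<le> 2 * ip k x x + 2 * ip k y y"
proof -
  have "0 \<le> ip k (\<lambda>i. x i + y i) (\<lambda>i. x i + y i)" by (rule ip_nonneg)
  then show ?thesis unfolding ip_linear using ip_commute[of k x y] by linarith
qed

lemma sq_le_ip: "i < k \<Longrightarrow> (x i)\<^sup>2 \<le> ip k x x"
  unfolding ip_def power2_eq_square by (rule member_le_sum) auto

lemma abs_le_sqrt_ip: "i < k \<Longrightarrow> \<bar>x i\<bar> \<le> sqrt (ip k x x)"
  using sq_le_ip[of i k x] by (simp add: real_le_rsqrt)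

text \<open>The difference of two members solves the equation of the first with a forcing
  proportional to \<open>w m - w n\<close>, which is of order \<open>e m - e n\<close> because
  \<open>K\<close> bounds every \<open>X n\<close>. \<open>energy_bound\<close> then compares the
  members on \<open>{-b..b}\<close>, with a constant that is finite because
  \<open>b < pi\<close>.\<close>

lemma lin_kepler_uniformly_Cauchy:
  fixes e :: "nat \<Rightarrow> real"
  assumes k: "even k"
    and sol: "\<And>n. lin_kepler k R (e n) UNIV (X n) (Y n)"
    and e: "\<And>n. 0 \<le> e n" "\<And>n. e n < 1" "e \<longlonglongrightarrow> 1"
    and K: "\<And>n t. ip k (X n t) (X n t) \<le> K"
    and lim: "\<And>i. i < k \<Longrightarrow> (\<lambda>n. X n 0 i) \<longlonglongrightarrow> x0 i" "\<And>i. i < k \<Longrightarrow> (\<lambda>n. Y n 0 i) \<longlonglongrightarrow> y0 i"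
    and b: "b < pi" and i: "i < k"
  shows "uniformly_Cauchy_on {-b..b} (\<lambda>n t. X n t i)"
    and "uniformly_Cauchy_on {-b..b} (\<lambda>n t. Y n t i)"
proof -
  define \<kappa> where "\<kappa> = 1 / (1 + min 0 (cos b))"
  define E where "E = exp ((2 + \<kappa> + \<kappa> * sqnorm k R) * b)"
  define c where "c = \<kappa> ^ 4 * (sqnorm k R * K)"
  \<comment> \<open>Chosen so that the bound for a pair splits into one null sequence at each index:
    \<open>|x - y|^2\<close> is at most \<open>2 |x|^2 + 2 |y|^2\<close>, with distances taken to
    the limit data.\<close>
  define a where "a n = 2 * ip k (\<lambda>i. X n 0 i - x0 i) (\<lambda>i. X n 0 i - x0 i)
     + 2 * ip k (\<lambda>i. Y n 0 i - y0 i) (\<lambda>i. Y n 0 i - y0 i) + 2 * c * (1 - e n)\<^sup>2" for n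
  define N where "N m n t = ip k (\<lambda>i. X m t i - X n t i) (\<lambda>i. X m t i - X n t i)
     + ip k (\<lambda>i. Y m t i - Y n t i) (\<lambda>i. Y m t i - Y n t i)" for m n t
  have K0: "0 \<le> K" using K[of 0 0] ip_nonneg[of k "X 0 0"] by linarith
  have "a \<longlonglongrightarrow> 2 * 0 + 2 * 0 + 2 * c * (1 - 1)\<^sup>2"
    unfolding a_def ip_def
    by (intro tendsto_intros tendsto_null_sum e) (auto intro!: tendsto_mult_zero LIM_zero lim)
  then have a0: "a \<longlonglongrightarrow> 0" by simp
  have bound: "N m n t \<le> (a m + a n) * E" if t: "\<bar>t\<bar> \<le> b" for m n t
  proof -
    define w where "w m s = 1 / (1 + e m * cos s)" for m s
    define G where "G = c * (e m - e n)\<^sup>2"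
    have \<kappa>: "0 < \<kappa>" using one_plus_cos_bound[of 1 t b] t b by (simp add: \<kappa>_def)
    have lo: "1 + min 0 (cos b) \<le> 1 + e m * cos s" "0 < 1 + min 0 (cos b)" if "\<bar>s\<bar> \<le> b" for m s
      using one_plus_cos_bound[of "e m" s b] e(1,2)[of m] that b by auto
    have w: "\<bar>w m s\<bar> \<le> \<kappa>" if "\<bar>s\<bar> \<le> b" for m s
      using lo(1)[OF that, of m] lo(2)[OF that] by (simp add: w_def \<kappa>_def frac_le)
    have g: "ip k (\<lambda>i. (w m s - w n s) * app k R (X n s) i) (\<lambda>i. (w m s - w n s) * app k R (X n s) i) \<le> G"
      if s: "\<bar>s\<bar> \<le> b" for s
    proof -
      \<comment> \<open>Over the common denominator the difference is at most
        \<open>\<kappa>^2\<close> times that of the eccentricities; hence the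
        \<open>\<kappa> ^ 4\<close> in \<open>c\<close>.\<close>
      have "w m s - w n s = - w m s * w n s * cos s * (e m - e n)"
      proof -
        have "1 + e m * cos s \<noteq> 0" "1 + e n * cos s \<noteq> 0"
          using lo(1)[OF s, of m] lo(1)[OF s, of n] lo(2)[OF s] by linarith+
        then show ?thesis by (simp add: w_def divide_simps) (simp add: algebra_simps)
      qed
      then have "\<bar>w m s - w n s\<bar> = \<bar>w m s\<bar> * \<bar>w n s\<bar> * \<bar>cos s\<bar> * \<bar>e m - e n\<bar>"
        by (simp add: abs_mult)
      also have "\<dots> \<le> \<kappa> * \<kappa> * 1 * \<bar>e m - e n\<bar>"
        using w[OF s] \<kappa> by (intro mult_mono) auto
      finally have "(w m s - w n s)\<^sup>2 \<le> (\<kappa> * \<kappa> * 1 * \<bar>e m - e n\<bar>)\<^sup>2"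
        by (simp add: abs_le_square_iff[symmetric] abs_mult)
      also have "\<dots> = \<kappa> ^ 4 * (e m - e n)\<^sup>2"
        by (simp add: power_mult_distrib)
      finally have w2: "(w m s - w n s)\<^sup>2 \<le> \<kappa> ^ 4 * (e m - e n)\<^sup>2" .
      have "ip k (app k R (X n s)) (app k R (X n s)) \<le> sqnorm k R * K"
        using app_bound[of k R "X n s"] mult_left_mono[OF K[of n s] sqnorm_nonneg[of k R]] by linarith
      then have "(w m s - w n s)\<^sup>2 * ip k (app k R (X n s)) (app k R (X n s))
          \<le> (\<kappa> ^ 4 * (e m - e n)\<^sup>2) * (sqnorm k R * K)"
        using w2 by (intro mult_mono ip_nonneg) auto
      then show ?thesis
        by (simp add: ip_linear G_def c_def power2_eq_square algebra_simps)
    qed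
    have "N m n t + G \<le> (N m n 0 + G) * exp ((2 + \<kappa> + \<kappa> * sqnorm k R) * \<bar>t\<bar>)"
      unfolding N_def
    proof (rule energy_bound[OF k, where b = b and D = "\<lambda>t i. X m t i - X n t i"
          and E = "\<lambda>t i. Y m t i - Y n t i" and w = "w m"
          and g = "\<lambda>s i. (w m s - w n s) * app k R (X n s) i"])
      fix s i assume "\<bar>s\<bar> \<le> b" "i < k"
      have d: "((\<lambda>s. X m s i) has_real_derivative Y m s i) (at s)"
         "((\<lambda>s. Y m s i) has_real_derivative
          (- 2 * jj (Y m s) i + app k R (X m s) i / (1 + e m * cos s))) (at s)" for m
        using sol[of m] \<open>i < k\<close> by (auto simp: lin_kepler_def)
      show "((\<lambda>s. X m s i - X n s i) has_real_derivative Y m s i - Y n s i) (at s)"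
        by (intro derivative_intros d)
      show "((\<lambda>s. Y m s i - Y n s i) has_real_derivative - 2 * jj (\<lambda>i. Y m s i - Y n s i) i
         + w m s * app k R (\<lambda>i. X m s i - X n s i) i + (w m s - w n s) * app k R (X n s) i) (at s)"
        by (rule DERIV_cong[OF DERIV_diff[OF d(2) d(2)]])
           (simp add: jj_diff app_diff w_def algebra_simps)
    qed (use w g t in auto)
    also have "\<dots> \<le> (N m n 0 + G) * E"
    proof -
      have "(2 + \<kappa> + \<kappa> * sqnorm k R) * \<bar>t\<bar> \<le> (2 + \<kappa> + \<kappa> * sqnorm k R) * b"
        using \<kappa> t sqnorm_nonneg[of k R] by (intro mult_left_mono) auto
      moreover have "0 \<le> N m n 0 + G"
        unfolding N_def G_def c_def using K0 sqnorm_nonneg[of k R] \<kappa>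
        by (intro add_nonneg_nonneg ip_nonneg mult_nonneg_nonneg) auto
      ultimately show ?thesis unfolding E_def by (intro mult_left_mono) auto
    qed
    also have "\<dots> \<le> (a m + a n) * E"
    proof (intro mult_right_mono)
      have x: "ip k (\<lambda>i. X m 0 i - X n 0 i) (\<lambda>i. X m 0 i - X n 0 i) \<le>
         2 * ip k (\<lambda>i. X m 0 i - x0 i) (\<lambda>i. X m 0 i - x0 i) +
         2 * ip k (\<lambda>i. X n 0 i - x0 i) (\<lambda>i. X n 0 i - x0 i)"
        using ip_diff_le[of k "\<lambda>i. X m 0 i - x0 i" "\<lambda>i. X n 0 i - x0 i"] by simp
      have y: "ip k (\<lambda>i. Y m 0 i - Y n 0 i) (\<lambda>i. Y m 0 i - Y n 0 i) \<le>
         2 * ip k (\<lambda>i. Y m 0 i - y0 i) (\<lambda>i. Y m 0 i - y0 i) +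
         2 * ip k (\<lambda>i. Y n 0 i - y0 i) (\<lambda>i. Y n 0 i - y0 i)"
        using ip_diff_le[of k "\<lambda>i. Y m 0 i - y0 i" "\<lambda>i. Y n 0 i - y0 i"] by simp
      have "0 \<le> ((1 - e m) + (1 - e n))\<^sup>2" by simp
      then have "(e m - e n)\<^sup>2 \<le> 2 * (1 - e m)\<^sup>2 + 2 * (1 - e n)\<^sup>2"
        by (simp add: power2_eq_square algebra_simps)
      moreover have "0 \<le> c" unfolding c_def using K0 sqnorm_nonneg[of k R] \<kappa> by simp
      ultimately have "G \<le> c * (2 * (1 - e m)\<^sup>2 + 2 * (1 - e n)\<^sup>2)"
        unfolding G_def by (intro mult_left_mono) auto
      then show "N m n 0 + G \<le> a m + a n"
        using x y by (simp add: N_def a_def algebra_simps)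
    qed (simp add: E_def)
    finally have "N m n t + G \<le> (a m + a n) * E" .
    moreover have "0 \<le> G"
      unfolding G_def c_def using K0 sqnorm_nonneg[of k R] \<kappa> by simp
    ultimately show ?thesis by linarith
  qed
  have "\<exists>M. \<forall>t\<in>{-b..b}. \<forall>m\<ge>M. \<forall>n\<ge>M. dist (X m t i) (X n t i) < \<epsilon> \<and> dist (Y m t i) (Y n t i) < \<epsilon>"
    if \<epsilon>: "0 < \<epsilon>" for \<epsilon>
  proof -
    have "0 < \<epsilon>\<^sup>2 / (2 * E)" using \<epsilon> by (simp add: E_def)
    with a0 have "\<forall>\<^sub>F n in sequentially. \<bar>a n\<bar> < \<epsilon>\<^sup>2 / (2 * E)"
      unfolding tendsto_iff dist_real_def by simp
    then obtain M where M: "\<And>n. M \<le> n \<Longrightarrow> \<bar>a n\<bar> < \<epsilon>\<^sup>2 / (2 * E)"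
      unfolding eventually_sequentially by blast
    have "dist (X m t i) (X n t i) < \<epsilon> \<and> dist (Y m t i) (Y n t i) < \<epsilon>"
      if t: "t \<in> {-b..b}" and mn: "M \<le> m" "M \<le> n" for t m n
    proof -
      have "a m + a n < \<epsilon>\<^sup>2 / E" using M[OF mn(1)] M[OF mn(2)] by (simp add: abs_less_iff)
      then have "(a m + a n) * E < \<epsilon>\<^sup>2" by (simp add: E_def field_simps)
      then have N: "N m n t < \<epsilon>\<^sup>2" using bound[of t m n] t by (simp add: abs_le_iff)
      have "(X m t i - X n t i)\<^sup>2 \<le> N m n t" "(Y m t i - Y n t i)\<^sup>2 \<le> N m n t"
        using sq_le_ip[OF i, of "\<lambda>i. X m t i - X n t i"] sq_le_ip[OF i, of "\<lambda>i. Y m t i - Y n t i"]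
          ip_nonneg[of k "\<lambda>i. X m t i - X n t i"] ip_nonneg[of k "\<lambda>i. Y m t i - Y n t i"]
        unfolding N_def by linarith+
      with N have "(X m t i - X n t i)\<^sup>2 < \<epsilon>\<^sup>2" "(Y m t i - Y n t i)\<^sup>2 < \<epsilon>\<^sup>2" by linarith+
      then show ?thesis
        using \<epsilon> by (auto simp: dist_real_def intro: power2_less_imp_less)
    qed
    then show ?thesis by blast
  qed
  then show "uniformly_Cauchy_on {-b..b} (\<lambda>n t. X n t i)"
    and "uniformly_Cauchy_on {-b..b} (\<lambda>n t. Y n t i)"
    unfolding uniformly_Cauchy_on_def by meson+
qed


text \<open>The data at time 0 lie on a compact sphere, and the normalization at 0, away from the
  collisions, survives the limit; this keeps the limit solution nonzero.\<close>

lemma lin_kepler_limit: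
  fixes e :: "nat \<Rightarrow> real"
  assumes k: "even k"
    and sol: "\<And>n. lin_kepler k R (e n) UNIV (X n) (Y n)"
    and e: "\<And>n. 0 \<le> e n" "\<And>n. e n < 1" "e \<longlonglongrightarrow> 1"
    and K: "\<And>n t. ip k (X n t) (X n t) \<le> K"
    and one: "\<And>n. ip k (X n 0) (X n 0) + ip k (Y n 0) (Y n 0) = 1"
  shows "\<exists>X Y. lin_kepler k R 1 {-pi<..<pi} X Y \<and> ip k (X 0) (X 0) + ip k (Y 0) (Y 0) = 1 \<and>
    (\<forall>t\<in>{-pi<..<pi}. ip k (X t) (X t) \<le> K)"
proof -
  \<comment> \<open>Positions and velocities are stacked so that a single subsequence serves
    both.\<close>
  define z where "z n i = (if i < k then X n 0 i else Y n 0 (i - k))" for n i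
  have "\<bar>z n i\<bar> \<le> 1" if "i < 2 * k" for n i
  proof -
    have "ip k (X n 0) (X n 0) \<le> 1" "ip k (Y n 0) (Y n 0) \<le> 1"
      using one[of n] ip_nonneg[of k "X n 0"] ip_nonneg[of k "Y n 0"] by linarith+
    then have "(z n i)\<^sup>2 \<le> 1"
      using sq_le_ip[of i k "X n 0"] sq_le_ip[of "i - k" k "Y n 0"] that
      by (cases "i < k") (auto simp: z_def less_diff_conv2)
    then show ?thesis by (simp add: abs_square_le_1)
  qed
  then obtain r where r: "strict_mono r" "\<forall>i<2 * k. convergent (\<lambda>n. z (r n) i)"
    using common_convergent_subseq by blast
  define e' where "e' n = e (r n)" for n
  define X' where "X' n = X (r n)" for n
  define Y' where "Y' n = Y (r n)" for n
  have cX: "convergent (\<lambda>n. X' n 0 i)" and cY: "convergent (\<lambda>n. Y' n 0 i)" if "i < k" for i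
    using r(2)[rule_format, of i] r(2)[rule_format, of "i + k"] that by (auto simp: z_def X'_def Y'_def)
  have e': "\<And>n. 0 \<le> e' n" "\<And>n. e' n < 1" "e' \<longlonglongrightarrow> 1"
    using e LIMSEQ_subseq_LIMSEQ[OF e(3) r(1)] unfolding e'_def o_def by auto
  have sol': "lin_kepler k R (e' n) UNIV (X' n) (Y' n)" for n
    by (simp add: e'_def X'_def Y'_def sol)
  have K': "ip k (X' n t) (X' n t) \<le> K" for n t
    by (simp add: X'_def K)
  define Xl where "Xl t i = lim (\<lambda>n. X' n t i)" for t i
  define Yl where "Yl t i = lim (\<lambda>n. Y' n t i)" for t i
  note C = lin_kepler_uniformly_Cauchy[OF k sol' e' K' convergent_LIMSEQ_iff[THEN iffD1, OF cX]
      convergent_LIMSEQ_iff[THEN iffD1, OF cY]]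
  have uX: "uniform_limit {-b..b} (\<lambda>n t. X' n t i) (\<lambda>t. Xl t i) sequentially"
    and uY: "uniform_limit {-b..b} (\<lambda>n t. Y' n t i) (\<lambda>t. Yl t i) sequentially" if "i < k" "b < pi" for i b
    using C[OF _ _ that(2,1)]
    unfolding Xl_def Yl_def uniformly_convergent_eq_Cauchy[symmetric] uniformly_convergent_uniform_limit_iff
    by blast+
  have inside: "t \<in> {-\<bar>t\<bar>..\<bar>t\<bar>}" for t :: real by auto
  have lX: "(\<lambda>n. X' n t i) \<longlonglongrightarrow> Xl t i" and lY: "(\<lambda>n. Y' n t i) \<longlonglongrightarrow> Yl t i"
    if "\<bar>t\<bar> < pi" "i < k" for t i
    using tendsto_uniform_limitI[OF uX[OF that(2,1)] inside] tendsto_uniform_limitI[OF uY[OF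
        that(2,1)] inside]
    by auto
  have f_lim: "(\<lambda>n. ip k (X' n t) (X' n t)) \<longlonglongrightarrow> ip k (Xl t) (Xl t)"
    and g_lim: "(\<lambda>n. ip k (Y' n t) (Y' n t)) \<longlonglongrightarrow> ip k (Yl t) (Yl t)" if "\<bar>t\<bar> < pi" for t
    unfolding ip_def by (intro tendsto_intros lX lY that; simp)+
  have bd: "ip k (Xl t) (Xl t) \<le> K" if "\<bar>t\<bar> < pi" for t
    by (rule LIMSEQ_le_const2[OF f_lim[OF that]]) (use K' in auto)
  have "ip k (Xl 0) (Xl 0) + ip k (Yl 0) (Yl 0) = 1"
  proof (rule LIMSEQ_unique)
    show "(\<lambda>n. ip k (X' n 0) (X' n 0) + ip k (Y' n 0) (Y' n 0)) \<longlonglongrightarrow> ip k (Xl 0) (Xl 0) + ip k (Yl 0) (Yl 0)"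
      by (intro tendsto_add f_lim g_lim) auto
    show "(\<lambda>n. ip k (X' n 0) (X' n 0) + ip k (Y' n 0) (Y' n 0)) \<longlonglongrightarrow> 1"
      by (simp add: X'_def Y'_def one)
  qed
  moreover have "lin_kepler k R 1 {-pi<..<pi} Xl Yl"
    unfolding lin_kepler_def
  proof (intro ballI allI impI conjI)
    fix t i assume t: "t \<in> {-pi<..<pi}" and i: "i < k"
    \<comment> \<open>Midway between \<open>\<bar>t\<bar>\<close> and \<open>pi\<close>: an open
      neighbourhood of \<open>t\<close> on which all limits are uniform.\<close>
    define b where "b = (\<bar>t\<bar> + pi) / 2"
    have b: "\<bar>t\<bar> < b" "b < pi" "0 < b" using t by (auto simp: b_def)
    have sub: "{-b<..<b} \<subseteq> {-b..b}" by auto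
    note uX' = uniform_limit_on_subset[OF uX[OF _ b(2)] sub]
    note uY' = uniform_limit_on_subset[OF uY[OF _ b(2)] sub]
    have d: "((\<lambda>s. X' n s i) has_real_derivative Y' n s i) (at s)"
         "((\<lambda>s. Y' n s i) has_real_derivative
          (- 2 * jj (Y' n s) i + app k R (X' n s) i * inverse (1 + e' n * cos s))) (at s)" for n s
      using sol'[of n] i by (auto simp: lin_kepler_def divide_inverse)
    show "((\<lambda>s. Xl s i) has_real_derivative Yl t i) (at t)"
      by (rule DERIV_uniform_limit[where a = "-b" and b = b and f = "\<lambda>n t. X' n t i"
          and f' = "\<lambda>n t. Y' n t i"])
         (use d uY'[OF i] lX[OF _ i] b in auto)
    have "uniform_limit {-b<..<b} (\<lambda>n s. inverse (1 + e' n * cos s)) (\<lambda>s. inverse (1 + 1 * cos s))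
        sequentially"
    proof (rule uniform_lim_inverse[unfolded o_def])
      have "uniform_limit {-b<..<b} (\<lambda>n s. e' n) (\<lambda>s. 1) sequentially"
        using e'(3) by (auto intro!: uniform_limitI dest: tendstoD elim: eventually_mono)
      then show "uniform_limit {-b<..<b} (\<lambda>n s. 1 + e' n * cos s) (\<lambda>s. 1 + 1 * cos s) sequentially"
        by (intro uniform_limit_add uniform_limit_const uniform_lim_mult)
           (auto simp: bounded_iff intro!: exI[of _ 1])
      show "0 < 1 + min 0 (cos b)" using one_plus_cos_bound(2)[of 1 t b] b by simp
      show "1 + min 0 (cos b) \<le> norm (1 + 1 * cos s)" if "s \<in> {-b<..<b}" for s
        using one_plus_cos_bound[of 1 s b] b that by (auto simp: abs_le_iff)
    qed
    moreover have "uniform_limit {-b<..<b} (\<lambda>n s. app k R (X' n s) i) (\<lambda>s. app k R (Xl s) i) sequentially"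
      by (rule uniform_limit_app) (rule uX')
    moreover have "bounded ((\<lambda>s. app k R (Xl s) i) ` {-b<..<b})"
    proof -
      have "\<bar>app k R (Xl s) i\<bar> \<le> sqrt (sqnorm k R * K)" if "s \<in> {-b<..<b}" for s
      proof -
        have "\<bar>s\<bar> < pi" using that b by auto
        then have "ip k (app k R (Xl s)) (app k R (Xl s)) \<le> sqnorm k R * K"
          using app_bound[of k R "Xl s"] mult_left_mono[OF bd sqnorm_nonneg[of k R], of s] by linarith
        then show ?thesis
          using abs_le_sqrt_ip[OF i, of "app k R (Xl s)"] real_sqrt_le_mono order_trans by blast
      qed
      then show ?thesis unfolding bounded_iff by (intro exI[of _ "sqrt (sqnorm k R * K)"]) auto
    qed
    moreover have "bounded ((\<lambda>s. inverse (1 + 1 * cos s)) ` {-b<..<b})"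
    proof -
      have "\<bar>inverse (1 + 1 * cos s)\<bar> \<le> inverse (1 + min 0 (cos b))" if "s \<in> {-b<..<b}" for s
        using one_plus_cos_bound[of 1 s b] b that by (auto simp: abs_le_iff intro!: le_imp_inverse_le)
      then show ?thesis unfolding bounded_iff by (intro exI[of _ "inverse (1 + min 0 (cos b))"]) auto
    qed
    ultimately have "uniform_limit {-b<..<b} (\<lambda>n s. app k R (X' n s) i * inverse (1 + e' n * cos s))
       (\<lambda>s. app k R (Xl s) i * inverse (1 + 1 * cos s)) sequentially"
      by (intro uniform_lim_mult)
    then have "uniform_limit {-b<..<b} (\<lambda>n s. - 2 * jj (Y' n s) i + app k R (X' n s) i * inverse (1
        + e' n * cos s))
       (\<lambda>s. - 2 * jj (Yl s) i + app k R (Xl s) i * inverse (1 + 1 * cos s)) sequentially"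
      by (intro uniform_limit_add bounded_linear.uniform_limit[OF bounded_linear_mult_right]
          uniform_limit_jj[OF k i] uY')
    from DERIV_uniform_limit[OF d(2) this, of "\<lambda>s. Yl s i" t] lY[OF _ i] b
    show "((\<lambda>s. Yl s i) has_real_derivative - 2 * jj (Yl t) i + app k R (Xl t) i / (1 + 1 * cos t)) (at t)"
      by (auto simp: divide_inverse)
  qed
  ultimately show ?thesis using bd by (intro exI[of _ Xl] exI[of _ Yl]) auto
qed

section \<open>The collision limit\<close>

lemma coll_q_pos: "0 < coll_q \<tau>"
  by (simp add: coll_q_def)

lemma coll_q_square_le: "(coll_q \<tau>)\<^sup>2 \<le> 2"
  using cosh_real_ge_1[of "sqrt 2 * \<tau> / 2"]
  by (simp add: coll_q_def power_divide divide_le_eq one_le_power)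

lemma DERIV_coll_q: "(coll_q has_real_derivative - (coll_Q \<tau> / 2) * coll_q \<tau>) (at \<tau>)"
  unfolding coll_q_def[abs_def] coll_Q_def tanh_def
  by (rule derivative_eq_intros refl | simp add: power2_eq_square)+

lemma coll_Q_minus: "coll_Q (- \<tau>) = - coll_Q \<tau>"
  by (simp add: coll_Q_def)

lemma coll_Q_mono: "\<sigma> \<le> \<tau> \<Longrightarrow> coll_Q \<sigma> \<le> coll_Q \<tau>"
  by (simp add: coll_Q_def)

lemma coll_Q_1_pos: "0 < coll_Q 1"
  by (simp add: coll_Q_def)

text \<open>The true anomaly on the parabolic orbit: \<open>\<theta>' = sqrt (1 + cos \<theta>)\<close>.\<close>

definition coll_anomaly :: "real \<Rightarrow> real" where
  "coll_anomaly \<tau> = 2 * arctan (sinh (sqrt 2 * \<tau> / 2))"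

lemma coll_anomaly_bounds: "coll_anomaly \<tau> \<in> {-pi<..<pi}"
  using arctan_lbound[of "sinh (sqrt 2 * \<tau> / 2)"] arctan_ubound[of "sinh (sqrt 2 * \<tau> / 2)"]
  by (simp add: coll_anomaly_def)

lemma coll_anomaly_0 [simp]: "coll_anomaly 0 = 0"
  by (simp add: coll_anomaly_def)

text \<open>From \<open>cos (arctan x) = 1 / sqrt (1 + x^2)\<close> with \<open>x\<close> a
  hyperbolic sine. It turns a bound by \<open>cos (t / 2)\<close> at the collisions into a bound by
  \<open>q\<close>.\<close>

lemma cos_half_coll_anomaly: "cos (coll_anomaly \<tau> / 2) = coll_q \<tau> / sqrt 2"
proof -
  have "cosh x = sqrt (1 + (sinh x)\<^sup>2)" for x :: real
    using cosh_square_eq[of x] cosh_real_nonneg[of x]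
    by (metis add.commute real_sqrt_abs abs_of_nonneg)
  then show ?thesis by (simp add: coll_anomaly_def coll_q_def cos_arctan)
qed

lemma one_plus_cos_coll_anomaly: "1 + cos (coll_anomaly \<tau>) = (coll_q \<tau>)\<^sup>2"
  using cos_double_cos[of "coll_anomaly \<tau> / 2"]
  by (simp add: cos_half_coll_anomaly power_divide)

lemma DERIV_coll_anomaly: "(coll_anomaly has_real_derivative coll_q \<tau>) (at \<tau>)"
proof -
  have "1 + (sinh (sqrt 2 * \<tau> / 2))\<^sup>2 = (cosh (sqrt 2 * \<tau> / 2))\<^sup>2"
    by (simp add: cosh_square_eq)
  then show ?thesis
    unfolding coll_anomaly_def[abs_def] coll_q_def
    by (auto intro!: derivative_eq_intros simp: power2_eq_square divide_simps)
qed

text \<open>Gronwall for \<open>N - D / a\<close>, the deviation from the equilibrium level of the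
  damped inequality.\<close>

lemma damped_bound:
  fixes N :: "real \<Rightarrow> real"
  assumes a: "0 < a" and D: "0 \<le> D"
    and d: "\<And>t. t0 \<le> t \<Longrightarrow> (N has_real_derivative N' t) (at t)"
    and le: "\<And>t. t0 \<le> t \<Longrightarrow> N' t \<le> - a * N t + D"
    and t: "t0 \<le> t"
  shows "N t \<le> max 0 (N t0) + D / a"
proof -
  have "N (t0 + (t - t0)) - D / a \<le> (N (t0 + 0) - D / a) * exp (- a * (t - t0))"
  proof (rule gronwall_right[where N = "\<lambda>s. N (t0 + s) - D / a" and N' = "\<lambda>s. N' (t0 + s)"])
    fix s :: real assume "0 \<le> s"
    then have s: "t0 \<le> t0 + s" by simp
    from d[OF s] have "((\<lambda>s. N (t0 + s)) has_real_derivative N' (t0 + s)) (at s)"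
      using DERIV_shift[of N "N' (t0 + s)" s t0] by (simp add: add.commute)
    then show "((\<lambda>s. N (t0 + s) - D / a) has_real_derivative N' (t0 + s)) (at s)"
      by (auto intro!: derivative_eq_intros)
    show "N' (t0 + s) \<le> - a * (N (t0 + s) - D / a)"
      using le[OF s] a by (simp add: algebra_simps)
  qed (use t in simp)
  also have "\<dots> \<le> max 0 (N t0) * 1"
  proof -
    have "N t0 - D / a \<le> max 0 (N t0)" using a D by (simp add: le_max_iff_disj)
    then have "(N t0 - D / a) * exp (- a * (t - t0)) \<le> max 0 (N t0) * exp (- a * (t - t0))"
      by (intro mult_right_mono) auto
    also have "\<dots> \<le> max 0 (N t0) * 1"
      using a t by (intro mult_left_mono) auto
    finally show ?thesis by simp
  qed
  finally show ?thesis by simp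
qed

text \<open>The square norm of a bounded solution along the parabolic orbit vanishes linearly at both
  collisions, because there it is a bounded solution of \<open>f'' \<ge> c f / (\<pi> - t)\<^sup>2\<close>.\<close>

lemma (in coercive) parabolic_decay:
  assumes sol: "lin_kepler k R 1 {-pi<..<pi} X Y"
    and K: "\<And>t. t \<in> {-pi<..<pi} \<Longrightarrow> ip k (X t) (X t) \<le> K"
  shows "\<exists>C. \<forall>t\<in>{-pi<..<pi}. ip k (X t) (X t) \<le> C * cos (t / 2)"
proof -
  let ?f = "\<lambda>t. ip k (X t) (X t)"
  have K0: "0 \<le> K" using K[of 0] ip_nonneg[of k "X 0"] by simp
  \<comment> \<open>The sign \<open>\<sigma>\<close> reflects time, so that one argument covers both
    collisions.\<close>
  have end_bound: "?f (\<sigma> * t) \<le> K * (pi - t) / (pi - \<theta>\<^sub>0)"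
    if \<sigma>: "\<sigma> = 1 \<or> \<sigma> = -1" and t: "\<theta>\<^sub>0 \<le> t" "t < pi" for \<sigma> t
  proof (rule singular_convex_decay[where f = "\<lambda>t. ?f (\<sigma> * t)" and c = "3 * \<rho>"
        and f' = "\<lambda>t. \<sigma> * (2 * ip k (X (\<sigma> * t)) (Y (\<sigma> * t)))" and f'' = "\<lambda>t. sq'' 1 X Y (\<sigma> * t)"])
    show "0 < 3 * \<rho>" using rho_pos by simp
    fix s assume s: "\<theta>\<^sub>0 \<le> s" "s < pi"
    have ss: "\<sigma> * s \<in> {-pi<..<pi}" "cos (\<sigma> * s) = cos s" "\<sigma> * \<sigma> = 1" using \<sigma> s \<theta>\<^sub>0 by auto
    have lin: "((\<lambda>t. \<sigma> * t) has_real_derivative \<sigma>) (at s)"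
      by (auto intro!: derivative_eq_intros)
    show "((\<lambda>t. ?f (\<sigma> * t)) has_real_derivative \<sigma> * (2 * ip k (X (\<sigma> * s)) (Y (\<sigma> * s)))) (at s)"
      using DERIV_chain'[OF lin sq_deriv(1)[OF sol ss(1)]] by (simp add: mult_ac)
    have "((\<lambda>t. 2 * ip k (X (\<sigma> * t)) (Y (\<sigma> * t))) has_real_derivative \<sigma> * sq'' 1 X Y (\<sigma> * s)) (at s)"
      using DERIV_chain'[OF lin sq_deriv(2)[OF sol ss(1)]] by (simp add: mult_ac)
    from DERIV_cmult[OF this, of \<sigma>]
    show "((\<lambda>t. \<sigma> * (2 * ip k (X (\<sigma> * t)) (Y (\<sigma> * t)))) has_real_derivative sq'' 1 X Y (\<sigma> * s)) (at s)"
      by (simp add: ss(3) flip: mult.assoc)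
    define c where "c = 1 + cos s"
    have "cos pi < cos s" using s \<theta>\<^sub>0 by (intro cos_monotone_0_pi) auto
    then have c0: "0 < c" by (simp add: c_def)
    have "cos s \<le> cos \<theta>\<^sub>0" using s \<theta>\<^sub>0 by (intro cos_monotone_0_pi_le) auto
    then have c1: "4 * c \<le> \<rho>" using \<theta>\<^sub>0 \<delta> by (simp add: c_def)
    \<comment> \<open>Compares \<open>1 + cos s = 2 cos^2 (s / 2)\<close> with the squared distance
      to \<pi>, the weight in \<open>singular_convex_decay\<close>.\<close>
    have "cos (s / 2) = sin ((pi - s) / 2)"
      by (simp add: sin_cos_eq diff_divide_distrib)
    moreover have "sin ((pi - s) / 2) \<le> (pi - s) / 2" "0 \<le> sin ((pi - s) / 2)"
      using s \<theta>\<^sub>0 by (auto intro!: sin_ge_zero simp del: le_divide_eq_numeral1 intro: sin_x_le_x)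
    ultimately have "(cos (s / 2))\<^sup>2 \<le> ((pi - s) / 2)\<^sup>2" by (intro power_mono) auto
    then have c2: "2 * c \<le> (pi - s)\<^sup>2"
      using cos_double_cos[of "s / 2"] by (simp add: c_def power_divide)
    have "3 * \<rho> * ?f (\<sigma> * s) / (pi - s)\<^sup>2 \<le> 3 * \<rho> * ?f (\<sigma> * s) / (2 * c)"
      using c0 c2 rho_pos s by (intro divide_left_mono mult_pos_pos) (auto simp: ip_nonneg)
    also have "\<dots> = (3 * \<rho> / (2 * c)) * ?f (\<sigma> * s)" by simp
    \<comment> \<open>Equivalent to \<open>4 * c \<le> \<rho>\<close>, which holds as
      \<open>c \<le> \<delta>\<close>; the constant \<open>3 * \<rho>\<close> stems from
      here.\<close>
    also have "\<dots> \<le> 2 * (\<rho> / c - 1) * ?f (\<sigma> * s)"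
      using c0 c1 by (intro mult_right_mono ip_nonneg) (simp add: field_simps)
    also have "\<dots> \<le> sq'' 1 X Y (\<sigma> * s)"
      using sq''_ge[of 1 "\<sigma> * s" X Y] c0 ss(2) by (simp add: c_def)
    finally show "3 * \<rho> * ?f (\<sigma> * s) / (pi - s)\<^sup>2 \<le> sq'' 1 X Y (\<sigma> * s)" .
    show "?f (\<sigma> * s) \<le> K" by (rule K[OF ss(1)])
  qed (use K0 t in auto)
  \<comment> \<open>Converts decay in \<open>pi - t\<close> into decay in
    \<open>cos (t / 2)\<close>: the slope of the sine on the relevant range is at least
    \<open>sin (\<theta>\<^sub>0 / 2)\<close>.\<close>
  have sin_lower: "(pi - t) / 2 * sin (\<theta>\<^sub>0 / 2) \<le> cos (t / 2)" if t: "\<theta>\<^sub>0 \<le> t" "t < pi" for t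
  proof -
    let ?u = "(pi - t) / 2"
    have "\<exists>z. 0 < z \<and> z < ?u \<and> sin ?u - sin 0 = (?u - 0) * cos z"
      by (rule MVT2) (use t in \<open>auto intro!: derivative_eq_intros\<close>)
    then obtain z where z: "0 < z" "z < ?u" "sin ?u = ?u * cos z" by auto
    have "cos ((pi - \<theta>\<^sub>0) / 2) \<le> cos z"
      using z t \<theta>\<^sub>0 by (intro cos_monotone_0_pi_le) (auto simp: field_simps)
    moreover have "cos ((pi - \<theta>\<^sub>0) / 2) = sin (\<theta>\<^sub>0 / 2)"
      by (simp add: sin_cos_eq diff_divide_distrib)
    ultimately have "?u * sin (\<theta>\<^sub>0 / 2) \<le> sin ?u"
      unfolding z(3) using t by (intro mult_left_mono) auto
    moreover have "sin ?u = cos (t / 2)"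
      by (simp add: sin_cos_eq diff_divide_distrib)
    ultimately show ?thesis by simp
  qed
  have sc: "0 < sin (\<theta>\<^sub>0 / 2)" "0 < cos (\<theta>\<^sub>0 / 2)"
    using \<theta>\<^sub>0 by (auto intro!: sin_gt_zero cos_gt_zero)
  \<comment> \<open>The first summand serves the end arcs, the second the middle, where
    \<open>cos (t / 2)\<close> is bounded below.\<close>
  define C where "C = 2 * K / ((pi - \<theta>\<^sub>0) * sin (\<theta>\<^sub>0 / 2)) + K / cos (\<theta>\<^sub>0 / 2)"
  have C1: "2 * K / ((pi - \<theta>\<^sub>0) * sin (\<theta>\<^sub>0 / 2)) \<le> C" and C2: "K / cos (\<theta>\<^sub>0 / 2) \<le> C"
    using K0 sc \<theta>\<^sub>0 by (auto simp: C_def)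
  have pos: "?f (\<sigma> * t) \<le> C * cos (t / 2)"
    if \<sigma>: "\<sigma> = 1 \<or> \<sigma> = -1" and t: "0 \<le> t" "t < pi" for \<sigma> t
  proof (cases "\<theta>\<^sub>0 \<le> t")
    case True
    have "?f (\<sigma> * t) \<le> K * (pi - t) / (pi - \<theta>\<^sub>0)" by (rule end_bound[OF \<sigma> True t(2)])
    also have "\<dots> = 2 * K / ((pi - \<theta>\<^sub>0) * sin (\<theta>\<^sub>0 / 2)) * ((pi - t) / 2 * sin (\<theta>\<^sub>0 / 2))"
      using sc \<theta>\<^sub>0 by (simp add: field_simps)
    also have "\<dots> \<le> C * cos (t / 2)"
      using sin_lower[OF True t(2)] C1 K0 sc \<theta>\<^sub>0 t
      by (intro mult_mono) (auto intro!: order_trans[OF _ C1])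
    finally show ?thesis .
  next
    case False
    have "\<sigma> * t \<in> {-pi<..<pi}" using \<sigma> t by auto
    from K[OF this] have "?f (\<sigma> * t) \<le> K / cos (\<theta>\<^sub>0 / 2) * cos (\<theta>\<^sub>0 / 2)" using sc by simp
    also have "\<dots> \<le> C * cos (t / 2)"
    proof (rule mult_mono[OF C2])
      show "cos (\<theta>\<^sub>0 / 2) \<le> cos (t / 2)"
        using False t \<theta>\<^sub>0 by (intro cos_monotone_0_pi_le) auto
    qed (use K0 sc C2 in \<open>auto intro: order_trans[OF _ C2]\<close>)
    finally show ?thesis .
  qed
  show ?thesis
  proof (intro exI ballI)
    fix t assume t: "t \<in> {-pi<..<pi}"
    show "?f t \<le> C * cos (t / 2)"
      using pos[of 1 t] pos[of "-1" "- t"] t by (cases "0 \<le> t") auto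
  qed
qed

text \<open>The system \<open>z' = J B z\<close> of collision nondegeneracy written out for
  \<open>z = (y, x)\<close>, momenta first.\<close>

definition coll_solution ::
  "nat \<Rightarrow> (nat \<Rightarrow> nat \<Rightarrow> real) \<Rightarrow> (real \<Rightarrow> nat \<Rightarrow> real) \<Rightarrow> (real \<Rightarrow> nat \<Rightarrow> real) \<Rightarrow> bool" where
  "coll_solution k R x y \<longleftrightarrow> (\<forall>\<tau>. \<forall>i<k.
     ((\<lambda>\<tau>. x \<tau> i) has_real_derivative
        y \<tau> i + coll_Q \<tau> / 4 * x \<tau> i - coll_q \<tau> * jj (x \<tau>) i) (at \<tau>) \<and>
     ((\<lambda>\<tau>. y \<tau> i) has_real_derivative
        - coll_Q \<tau> / 4 * y \<tau> i - coll_q \<tau> * jj (y \<tau>) i - (coll_q \<tau>)\<^sup>2 * x \<tau> i + app k R (x \<tau>) i) (at \<tau>))"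

text \<open>The \<open>jj y\<close> term is orthogonal to \<open>y\<close>, so the square norm
  \<open>N\<close> of \<open>y\<close> satisfies \<open>N' = - (Q / 2) N + 2 <y, g>\<close> with
  bounded \<open>g\<close>. As \<open>Q\<close> is odd and increasing, this is damping for
  \<open>\<tau> \<ge> 1\<close> and, after time reversal, for \<open>\<tau> \<le> -1\<close>; in
  between compactness suffices.\<close>

lemma coll_solution_bounded:
  assumes k: "even k" and sol: "coll_solution k R x y"
    and B: "\<And>\<tau>. ip k (x \<tau>) (x \<tau>) \<le> B"
  shows "\<exists>C. \<forall>\<tau>. ip k (y \<tau>) (y \<tau>) \<le> C"
proof -
  define g where "g \<tau> i = app k R (x \<tau>) i - (coll_q \<tau>)\<^sup>2 * x \<tau> i" for \<tau> i
  define N where "N \<tau> = ip k (y \<tau>) (y \<tau>)" for \<tau>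
  define N' where "N' \<tau> = - (coll_Q \<tau> / 2) * N \<tau> + 2 * ip k (y \<tau>) (g \<tau>)" for \<tau>
  \<comment> \<open>The factor 4 bounds the fourth power of \<open>q\<close>, because its square is
    at most 2.\<close>
  define G where "G = 2 * (sqnorm k R * B) + 2 * (4 * B)"
  define c where "c = coll_Q 1"
  have c: "0 < c" unfolding c_def by (rule coll_Q_1_pos)
  have B0: "0 \<le> B" using B[of 0] ip_nonneg[of k "x 0"] by linarith
  have G: "ip k (g \<tau>) (g \<tau>) \<le> G" for \<tau>
  proof -
    have "ip k (app k R (x \<tau>)) (app k R (x \<tau>)) \<le> sqnorm k R * B"
      using app_bound[of k R "x \<tau>"] mult_left_mono[OF B[of \<tau>] sqnorm_nonneg[of k R]] by linarith
    moreover have "(coll_q \<tau>)\<^sup>2 * (coll_q \<tau>)\<^sup>2 * ip k (x \<tau>) (x \<tau>) \<le> 2 * 2 * B"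
      using coll_q_square_le[of \<tau>] B by (intro mult_mono ip_nonneg) auto
    ultimately show ?thesis
      using ip_diff_le[of k "app k R (x \<tau>)" "\<lambda>i. (coll_q \<tau>)\<^sup>2 * x \<tau> i"]
      unfolding g_def G_def ip_scale_left ip_scale_right mult.assoc by linarith
  qed
  have dN: "(N has_real_derivative N' \<tau>) (at \<tau>)" for \<tau>
  proof -
    have "(N has_real_derivative 2 * ip k (y \<tau>) (\<lambda>i. - coll_Q \<tau> / 4 * y \<tau> i - coll_q \<tau> * jj (y \<tau>) i
        - (coll_q \<tau>)\<^sup>2 * x \<tau> i + app k R (x \<tau>) i)) (at \<tau>)"
      unfolding N_def by (rule DERIV_ip_self) (use sol in \<open>auto simp: coll_solution_def\<close>)
    also have "2 * ip k (y \<tau>) (\<lambda>i. - coll_Q \<tau> / 4 * y \<tau> i - coll_q \<tau> * jj (y \<tau>) i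
        - (coll_q \<tau>)\<^sup>2 * x \<tau> i + app k R (x \<tau>) i) = N' \<tau>"
      unfolding N'_def g_def N_def by (simp add: ip_add_right ip_diff_right ip_minus_right
          ip_div_right ip_scale_right
          ip_jj_self[OF k] algebra_simps)
    finally show ?thesis .
  qed
  \<comment> \<open>The weight in Young's inequality is chosen so that half of the damping rate
    \<open>c / 2\<close> is left.\<close>
  have young: "2 * \<bar>ip k (y \<tau>) (g \<tau>)\<bar> \<le> c / 4 * N \<tau> + 4 / c * G" for \<tau>
  proof -
    define r where "r = sqrt (c / 4)"
    have r: "0 < r" "r * r = c / 4" using c by (auto simp: r_def)
    have "ip k (\<lambda>i. r * y \<tau> i) (\<lambda>i. g \<tau> i / r) = ip k (y \<tau>) (g \<tau>)"
      using r by (simp add: ip_linear)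
    moreover have "ip k (\<lambda>i. r * y \<tau> i) (\<lambda>i. r * y \<tau> i) = c / 4 * N \<tau>"
      by (simp add: ip_linear N_def r(2) flip: mult.assoc)
    moreover have "ip k (\<lambda>i. g \<tau> i / r) (\<lambda>i. g \<tau> i / r) = 4 / c * ip k (g \<tau>) (g \<tau>)"
      by (simp add: ip_linear r(2))
    moreover have "4 / c * ip k (g \<tau>) (g \<tau>) \<le> 4 / c * G" using G c by (intro mult_left_mono) auto
    ultimately show ?thesis using two_ip_le[of k "\<lambda>i. r * y \<tau> i" "\<lambda>i. g \<tau> i / r"] by simp
  qed
  have N0: "0 \<le> N \<tau>" for \<tau> by (simp add: N_def ip_nonneg)
  have damp: "- N' (- \<tau>) \<le> - (c / 4) * N (- \<tau>) + 4 / c * G" "N' \<tau> \<le> - (c / 4) * N \<tau> + 4 / c * G"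
    if "1 \<le> \<tau>" for \<tau>
  proof -
    have "c * N s \<le> coll_Q \<tau> * N s" for s
      using coll_Q_mono[OF that] N0 by (intro mult_right_mono) (auto simp: c_def)
    from this[of "- \<tau>"] this[of \<tau>]
    have "c * N (- \<tau>) \<le> coll_Q \<tau> * N (- \<tau>)" "c * N \<tau> \<le> coll_Q \<tau> * N \<tau>" .
    moreover have "- N' (- \<tau>) = - (coll_Q \<tau> * N (- \<tau>)) / 2 - 2 * ip k (y (- \<tau>)) (g (- \<tau>))"
      "N' \<tau> = - (coll_Q \<tau> * N \<tau>) / 2 + 2 * ip k (y \<tau>) (g \<tau>)"
      by (simp_all add: N'_def coll_Q_minus)
    ultimately show "- N' (- \<tau>) \<le> - (c / 4) * N (- \<tau>) + 4 / c * G" "N' \<tau> \<le> - (c / 4) * N \<tau> + 4 / c * G"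
      using young[of \<tau>] young[of "- \<tau>"] by linarith+
  qed
  have G0: "0 \<le> 4 / c * G" using c B0 sqnorm_nonneg[of k R] by (simp add: G_def)
  have right: "N \<tau> \<le> max 0 (N 1) + 4 / c * G / (c / 4)" if "1 \<le> \<tau>" for \<tau>
    by (rule damped_bound[OF _ G0 dN damp(2) that]) (use c in auto)
  have left: "N (- \<tau>) \<le> max 0 (N (- 1)) + 4 / c * G / (c / 4)" if "1 \<le> \<tau>" for \<tau>
  proof -
    have "((\<lambda>t. N (- t)) has_real_derivative - N' (- s)) (at s)" for s
      using DERIV_chain'[OF DERIV_minus[OF DERIV_ident] dN] by simp
    from damped_bound[OF _ G0 this damp(1) that] c show ?thesis by simp
  qed
  have "continuous_on {-1..1} N"
    by (intro continuous_at_imp_continuous_on ballI DERIV_isCont[OF dN])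
  then obtain M where M: "\<And>\<tau>. \<tau> \<in> {-1..1} \<Longrightarrow> N \<tau> \<le> M"
    using continuous_attains_sup[of "{-1..1::real}" N] by force
  define C where "C = max M (max 0 (max (N 1) (N (- 1))) + 4 / c * G / (c / 4))"
  have "N \<tau> \<le> C" for \<tau>
  proof -
    consider "1 \<le> \<tau>" | "1 \<le> - \<tau>" | "\<tau> \<in> {-1..1}" by force
    then show ?thesis
    proof cases
      case 1
      have "max 0 (N 1) + 4 / c * G / (c / 4) \<le> C" by (auto simp: C_def le_max_iff_disj)
      with right[OF 1] show ?thesis by linarith
    next
      case 2
      have "max 0 (N (- 1)) + 4 / c * G / (c / 4) \<le> C" by (auto simp: C_def le_max_iff_disj)
      with left[OF 2] show ?thesis by simp
    next
      case 3
      from M[OF this] show ?thesis by (auto simp: C_def)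
    qed
  qed
  then show ?thesis by (auto simp: N_def)
qed

text \<open>On the parabolic orbit \<open>dt / d\<tau> = q\<close> and
  \<open>1 + cos t = q^2\<close>. \<open>Y + J X\<close> is the momentum conjugate to
  \<open>X\<close> in rotating coordinates, and the reciprocal factors \<open>1 / sqrt q\<close> and
  \<open>sqrt q\<close> keep the change of variables symplectic; their derivatives put
  \<open>Q / 4\<close> into the system.\<close>

lemma parabolic_to_coll_solution:
  assumes k: "even k" and sol: "lin_kepler k R 1 {-pi<..<pi} X Y"
  shows "coll_solution k R (\<lambda>\<tau> i. X (coll_anomaly \<tau>) i / sqrt (coll_q \<tau>))
    (\<lambda>\<tau> i. sqrt (coll_q \<tau>) * (Y (coll_anomaly \<tau>) i + jj (X (coll_anomaly \<tau>)) i))"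
  unfolding coll_solution_def
proof (intro allI impI conjI)
  fix \<tau> i assume i: "i < k"
  define p where "p \<tau> = sqrt (coll_q \<tau>)" for \<tau>
  define \<theta> where "\<theta> = coll_anomaly \<tau>"
  have p: "0 < p \<tau>" "coll_q \<tau> = p \<tau> * p \<tau>" using coll_q_pos[of \<tau>] by (auto simp: p_def)
  have dp: "(p has_real_derivative - (coll_Q \<tau> / 4) * p \<tau>) (at \<tau>)"
  proof -
    have "(p has_real_derivative (- (coll_Q \<tau> / 2) * coll_q \<tau>) * (inverse (sqrt (coll_q \<tau>)) / 2)) (at \<tau>)"
      unfolding p_def[abs_def]
      using DERIV_chain'[OF DERIV_coll_q[of \<tau>] DERIV_real_sqrt[OF coll_q_pos]] by (simp add: mult_ac)
    moreover have "(- (coll_Q \<tau> / 2) * coll_q \<tau>) * (inverse (sqrt (coll_q \<tau>)) / 2) = - (coll_Q \<tau> / 4) * p \<tau>"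
    proof -
      have "coll_q \<tau> * inverse (sqrt (coll_q \<tau>)) = p \<tau>"
        using real_div_sqrt[of "coll_q \<tau>"] coll_q_pos[of \<tau>] by (simp add: p_def divide_inverse)
      then show ?thesis by (simp flip: \<open>_ = p \<tau>\<close>)
    qed
    ultimately show ?thesis by (simp only:)
  qed
  have dX: "((\<lambda>\<tau>. X (coll_anomaly \<tau>) i) has_real_derivative coll_q \<tau> * Y \<theta> i) (at \<tau>)" if "i < k" for i
    using DERIV_chain'[OF DERIV_coll_anomaly[of \<tau>], of "\<lambda>s. X s i" "Y \<theta> i"]
        sol that coll_anomaly_bounds[of \<tau>]
    by (auto simp: lin_kepler_def \<theta>_def mult.commute)
  have dY: "((\<lambda>\<tau>. Y (coll_anomaly \<tau>) i) has_real_derivative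
      coll_q \<tau> * (- 2 * jj (Y \<theta>) i + app k R (X \<theta>) i / (coll_q \<tau>)\<^sup>2)) (at \<tau>)"
  proof -
    have "((\<lambda>s. Y s i) has_real_derivative - 2 * jj (Y \<theta>) i + app k R (X \<theta>) i / (coll_q \<tau>)\<^sup>2)
        (at (coll_anomaly \<tau>))"
      using sol i coll_anomaly_bounds[of \<tau>]
          unfolding lin_kepler_def \<theta>_def one_plus_cos_coll_anomaly[symmetric]
      by simp
    from DERIV_chain'[OF DERIV_coll_anomaly this] show ?thesis by (simp only: mult.commute)
  qed
  have djX: "((\<lambda>\<tau>. jj (X (coll_anomaly \<tau>)) i) has_real_derivative coll_q \<tau> * jj (Y \<theta>) i) (at \<tau>)"
    using DERIV_jj[OF k dX i] by (simp add: jj_scale)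
  show "((\<lambda>\<tau>. X (coll_anomaly \<tau>) i / sqrt (coll_q \<tau>)) has_real_derivative
      sqrt (coll_q \<tau>) * (Y (coll_anomaly \<tau>) i + jj (X (coll_anomaly \<tau>)) i)
      + coll_Q \<tau> / 4 * (X (coll_anomaly \<tau>) i / sqrt (coll_q \<tau>))
      - coll_q \<tau> * jj (\<lambda>i. X (coll_anomaly \<tau>) i / sqrt (coll_q \<tau>)) i) (at \<tau>)"
    unfolding p_def[symmetric] \<theta>_def[symmetric] jj_div
    by (rule DERIV_cong[OF DERIV_divide[OF dX[OF i] dp]])
       (use p in \<open>auto simp: p(2) \<theta>_def field_simps\<close>)
  show "((\<lambda>\<tau>. sqrt (coll_q \<tau>) * (Y (coll_anomaly \<tau>) i + jj (X (coll_anomaly \<tau>)) i)) has_real_derivative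
      - coll_Q \<tau> / 4 * (sqrt (coll_q \<tau>) * (Y (coll_anomaly \<tau>) i + jj (X (coll_anomaly \<tau>)) i))
      - coll_q \<tau> * jj (\<lambda>i. sqrt (coll_q \<tau>) * (Y (coll_anomaly \<tau>) i + jj (X (coll_anomaly \<tau>)) i)) i
      - (coll_q \<tau>)\<^sup>2 * (X (coll_anomaly \<tau>) i / sqrt (coll_q \<tau>))
      + app k R (\<lambda>i. X (coll_anomaly \<tau>) i / sqrt (coll_q \<tau>)) i) (at \<tau>)"
    unfolding p_def[symmetric] \<theta>_def[symmetric] jj_scale jj_add app_div jj_jj
    by (rule DERIV_cong[OF DERIV_mult[OF dp DERIV_add[OF dY djX]]])
       (use p in \<open>auto simp: p(2) \<theta>_def field_simps power2_eq_square\<close>)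
qed

lemma (in coercive) bounded_coll_solution_of_parabolic:
  assumes sol: "lin_kepler k R 1 {-pi<..<pi} X Y"
    and one: "ip k (X 0) (X 0) + ip k (Y 0) (Y 0) = 1"
    and K: "\<And>t. t \<in> {-pi<..<pi} \<Longrightarrow> ip k (X t) (X t) \<le> K"
  shows "\<exists>x y C. coll_solution k R x y \<and> (\<forall>\<tau>. ip k (x \<tau>) (x \<tau>) \<le> C) \<and> (\<forall>\<tau>. ip k (y \<tau>) (y \<tau>) \<le> C) \<and>
      (\<exists>i<k. x 0 i \<noteq> 0 \<or> y 0 i \<noteq> 0)"
proof -
  define x where "x \<tau> i = X (coll_anomaly \<tau>) i / sqrt (coll_q \<tau>)" for \<tau> i
  define y where "y \<tau> i = sqrt (coll_q \<tau>) * (Y (coll_anomaly \<tau>) i + jj (X (coll_anomaly \<tau>)) i)" for \<tau> i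
  have cs: "coll_solution k R x y"
    unfolding x_def[abs_def] y_def[abs_def] by (rule parabolic_to_coll_solution[OF even_k sol])
  from parabolic_decay[OF sol K] obtain C where
    C: "\<And>t. t \<in> {-pi<..<pi} \<Longrightarrow> ip k (X t) (X t) \<le> C * cos (t / 2)" by blast
  \<comment> \<open>The decay bound \<open>C cos (t / 2)\<close> is divided by
    \<open>q = sqrt 2 cos (t / 2)\<close>.\<close>
  have xb: "ip k (x \<tau>) (x \<tau>) \<le> C / sqrt 2" for \<tau>
  proof -
    have "ip k (x \<tau>) (x \<tau>) = ip k (X (coll_anomaly \<tau>)) (X (coll_anomaly \<tau>)) / coll_q \<tau>"
      using coll_q_pos[of \<tau>] by (simp add: x_def[abs_def] ip_linear)
    then show ?thesis
      using C[OF coll_anomaly_bounds[of \<tau>]] coll_q_pos[of \<tau>]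
      by (simp add: cos_half_coll_anomaly pos_divide_le_eq)
  qed
  from coll_solution_bounded[OF even_k cs xb] obtain C' where C': "\<And>\<tau>. ip k (y \<tau>) (y \<tau>) \<le> C'" by blast
  \<comment> \<open>At \<tau> = 0 the anomaly is 0, and the data there determine first
    \<open>X 0\<close> and then \<open>Y 0\<close>.\<close>
  have "\<exists>i<k. x 0 i \<noteq> 0 \<or> y 0 i \<noteq> 0"
  proof (rule ccontr)
    assume c: "\<not> ?thesis"
    have p: "0 < sqrt (coll_q 0)" using coll_q_pos[of 0] by simp
    have X0: "X 0 i = 0" if "i < k" for i using c that p by (auto simp: x_def)
    have "jj (X 0) i = jj (\<lambda>_. 0) i" if "i < k" for i by (rule jj_cong[OF even_k X0 that])
    then have "jj (X 0) i = 0" if "i < k" for i using that by (simp add: jj_def)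
    then have Y0: "Y 0 i = 0" if "i < k" for i using c that p by (auto simp: y_def)
    show False using one X0 Y0 by (simp add: ip_def)
  qed
  moreover have "ip k (x \<tau>) (x \<tau>) \<le> max (C / sqrt 2) C'" "ip k (y \<tau>) (y \<tau>) \<le> max (C / sqrt 2) C'" for \<tau>
    using xb[of \<tau>] C'[of \<tau>] by linarith+
  ultimately have "coll_solution k R x y \<and> (\<forall>\<tau>. ip k (x \<tau>) (x \<tau>) \<le> max (C / sqrt 2) C') \<and>
      (\<forall>\<tau>. ip k (y \<tau>) (y \<tau>) \<le> max (C / sqrt 2) C') \<and> (\<exists>i<k. x 0 i \<noteq> 0 \<or> y 0 i \<noteq> 0)"
    using cs by (intro conjI) simp_all
  then show ?thesis by blast
qed

text \<open>The hypothesis is what failure of hyperbolicity at eccentricities arbitrarily close to 1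
  provides, the conclusion what collision nondegeneracy forbids.\<close>

theorem (in coercive) bounded_coll_solution:
  assumes "\<And>\<epsilon>. 0 < \<epsilon> \<Longrightarrow> \<exists>e X Y C. 0 \<le> e \<and> e < 1 \<and> 1 - e < \<epsilon> \<and> lin_kepler k R e UNIV X Y \<and>
      (\<forall>t. ip k (X t) (X t) \<le> C) \<and> (\<exists>t. 0 < ip k (X t) (X t) + ip k (Y t) (Y t))"
  shows "\<exists>x y C. coll_solution k R x y \<and> (\<forall>\<tau>. ip k (x \<tau>) (x \<tau>) \<le> C) \<and> (\<forall>\<tau>. ip k (y \<tau>) (y \<tau>) \<le> C) \<and>
      (\<exists>i<k. x 0 i \<noteq> 0 \<or> y 0 i \<noteq> 0)"
proof -
  define P where "P e X Y \<longleftrightarrow> lin_kepler k R e UNIV X Y \<and> ip k (X 0) (X 0) + ip k (Y 0) (Y 0) = 1 \<and>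
    (\<forall>t. ip k (X t) (X t) \<le> 2 * growth)" for e X Y
  have "\<exists>e X Y. 0 \<le> e \<and> e < 1 \<and> 1 - e < inverse (real (Suc n)) \<and> P e X Y" for n
  proof -
    \<comment> \<open>\<open>\<delta>\<close> makes the normalization available, the other bound
      forces the eccentricities to tend to 1.\<close>
    have "0 < min \<delta> (inverse (real (Suc n)))" using \<delta> by simp
    from assms[OF this] obtain e X Y C where H: "0 \<le> e \<and> e < 1 \<and> 1 - e < min \<delta> (inverse (real (Suc n))) \<and>
      lin_kepler k R e UNIV X Y \<and> (\<forall>t. ip k (X t) (X t) \<le> C) \<and>
      (\<exists>t. 0 < ip k (X t) (X t) + ip k (Y t) (Y t))" by blast
    then have "\<exists>X Y. P e X Y"
      unfolding P_def using normalize_bounded_solution[of e X Y C] by auto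
    with H show ?thesis by (intro exI[of _ e]) auto
  qed
  then obtain e where e_ex: "\<forall>n. \<exists>X Y. 0 \<le> e n \<and> e n < 1 \<and> 1 - e n < inverse (real (Suc n)) \<and> P (e n) X Y"
    using choice[of "\<lambda>n e. \<exists>X Y. 0 \<le> e \<and> e < 1 \<and> 1 - e < inverse (real (Suc n)) \<and> P e X Y"] by blast
  then have e: "0 \<le> e n" "e n < 1" "1 - e n < inverse (real (Suc n))" for n by blast+
  have "\<forall>n. \<exists>X Y. P (e n) X Y" using e_ex by blast
  then obtain X where "\<forall>n. \<exists>Y. P (e n) (X n) Y"
    using choice[of "\<lambda>n X. \<exists>Y. P (e n) X Y"] by blast
  then obtain Y where P: "\<And>n. P (e n) (X n) (Y n)"
    using choice[of "\<lambda>n Y. P (e n) (X n) Y"] by blast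
  have "(\<lambda>n. 1 - e n) \<longlonglongrightarrow> 0"
    using e(2,3) by (intro real_tendsto_sandwich[OF _ _ tendsto_const LIMSEQ_inverse_real_of_nat])
      (auto intro!: always_eventually less_imp_le)
  then have "e \<longlonglongrightarrow> 1" using tendsto_diff[OF tendsto_const[of 1], of "\<lambda>n. 1 - e n" 0] by simp
  then have "\<exists>X Y. lin_kepler k R 1 {-pi<..<pi} X Y \<and> ip k (X 0) (X 0) + ip k (Y 0) (Y 0) = 1 \<and>
      (\<forall>t\<in>{-pi<..<pi}. ip k (X t) (X t) \<le> 2 * growth)"
    by (intro lin_kepler_limit[OF even_k, of R e X Y]) (use e P in \<open>simp_all add: P_def\<close>)
  then obtain X Y where sol: "lin_kepler k R 1 {-pi<..<pi} X Y" and one: "ip k (X 0) (X 0)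
      + ip k (Y 0) (Y 0) = 1"
    and K: "\<And>t. t \<in> {-pi<..<pi} \<Longrightarrow> ip k (X t) (X t) \<le> 2 * growth" by blast
  from bounded_coll_solution_of_parabolic[OF sol one K] show ?thesis .
qed

section \<open>Derivatives of the potential\<close>

definition cbody :: "(nat \<Rightarrow> real) \<Rightarrow> nat \<Rightarrow> complex" where
  "cbody y i = Complex (y (2 * i)) (y (2 * i + 1))"

text \<open>A complex number acting on all bodies at once. A homographic motion is
  \<open>cact (w t) a\<close>, so scaling and rotation form one commutative action, in which the
  imaginary unit acts as \<open>jj\<close>.\<close>

definition cact :: "complex \<Rightarrow> (nat \<Rightarrow> real) \<Rightarrow> nat \<Rightarrow> real" where
  "cact w y i = Re w * y i + Im w * jj y i"

lemma body_eq_cbody: "body x i = cbody (($) x) i"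
  by (simp add: body_def cbody_def)

lemma cbody_cact: "cbody (cact w y) i = w * cbody y i"
  by (simp add: cbody_def cact_def jj_def complex_eq_iff)

lemma cact_cact: "cact w (cact z y) i = cact (w * z) y i"
  by (simp add: cact_def jj_def algebra_simps)

lemma cact_1 [simp]: "cact 1 y = y"
  by (simp add: cact_def fun_eq_iff)

lemma cact_ii: "cact \<i> y = jj y"
  by (simp add: cact_def fun_eq_iff)

lemma cbody_cong: "(\<And>c. c < 2 * n \<Longrightarrow> x c = y c) \<Longrightarrow> i < n \<Longrightarrow> cbody x i = cbody y i"
  by (simp add: cbody_def)

lemma cbody_add: "cbody (\<lambda>i. x i + y i) j = cbody x j + cbody y j"
  and cbody_scale: "cbody (\<lambda>i. c * x i) j = of_real c * cbody x j"
  by (auto simp: cbody_def complex_eq_iff)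

text \<open>Together with \<open>inv_dist''\<close>: the first and second directional derivatives of
  \<open>1 / norm q\<close>.\<close>

definition inv_dist' :: "complex \<Rightarrow> complex \<Rightarrow> real" where
  "inv_dist' q d = - inner q d / norm q ^ 3"

definition inv_dist'' :: "complex \<Rightarrow> complex \<Rightarrow> complex \<Rightarrow> real" where
  "inv_dist'' q u v = - inner u v / norm q ^ 3 + 3 * inner q u * inner q v / norm q ^ 5"

lemma DERIV_inv_dist:
  assumes "q \<noteq> 0"
  shows "((\<lambda>s. 1 / norm (q + of_real s * d)) has_real_derivative inv_dist' q d) (at 0)"
proof -
  define A where "A s = (norm q)\<^sup>2 + 2 * s * inner q d + s\<^sup>2 * (norm d)\<^sup>2" for s
  have n: "norm (q + of_real s * d) = sqrt (A s)" for s
  proof -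
    have "A s = (norm (q + of_real s * d))\<^sup>2"
      unfolding A_def cmod_power2 inner_complex_def by (simp add: power2_eq_square algebra_simps)
    then show ?thesis by (simp only: real_sqrt_abs abs_norm_cancel)
  qed
  have q: "0 < norm q" using assms by simp
  have A0: "A 0 = (norm q)\<^sup>2" "sqrt (A 0) = norm q" by (simp_all add: A_def)
  have A: "(A has_real_derivative 2 * inner q d) (at 0)"
    unfolding A_def[abs_def] by (auto intro!: derivative_eq_intros)
  have "(sqrt has_real_derivative inverse (norm q) / 2) (at (A 0))"
    using DERIV_real_sqrt[of "A 0"] q A0 by simp
  from DERIV_chain'[OF A this]
  have S: "((\<lambda>s. sqrt (A s)) has_real_derivative inverse (norm q) / 2 * (2 * inner q d)) (at 0)"
    by (simp only: mult.commute)
  have "((\<lambda>s. inverse (sqrt (A s))) has_real_derivative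
      - (inverse (sqrt (A 0)) * (inverse (norm q) / 2 * (2 * inner q d)) * inverse (sqrt (A 0)))) (at 0)"
    using S by (rule DERIV_inverse') (use q A0 in simp)
  moreover have "- (inverse (sqrt (A 0)) * (inverse (norm q) / 2 * (2 * inner q d)) * inverse (sqrt (A 0)))
      = inv_dist' q d"
    using q by (simp add: A0 inv_dist'_def field_simps power3_eq_cube)
  moreover have "1 / norm (q + of_real s * d) = inverse (sqrt (A s))" for s
    unfolding n by (rule inverse_eq_divide[symmetric])
  ultimately show ?thesis by simp
qed

lemma DERIV_inv_dist':
  assumes "q \<noteq> 0"
  shows "((\<lambda>s. inv_dist' (q + of_real s * d) v) has_real_derivative inv_dist'' q d v) (at 0)"
proof -
  define g where "g s = 1 / norm (q + of_real s * d)" for s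
  have e: "inv_dist' (q + of_real s * d) v = - (inner q v + s * inner d v) * g s ^ 3" for s
    by (simp add: g_def inv_dist'_def inner_add_left power_one_over)
       (simp add: inner_complex_def algebra_simps)
  have g: "(g has_real_derivative inv_dist' q d) (at 0)"
    unfolding g_def[abs_def] by (rule DERIV_inv_dist[OF assms])
  have g0: "g 0 = 1 / norm q" by (simp add: g_def)
  have "((\<lambda>s. - (inner q v + s * inner d v) * g s ^ 3) has_real_derivative
      - inner d v * g 0 ^ 3 - inner q v * (3 * g 0 ^ 2 * inv_dist' q d)) (at 0)"
    by (auto intro!: derivative_eq_intros g)
  moreover have "- inner d v * g 0 ^ 3 - inner q v * (3 * g 0 ^ 2 * inv_dist' q d) = inv_dist'' q d v"
  proof -
    have "inv_dist' q d = - inner q d * g 0 ^ 3" "inv_dist'' q d v = - inner d v * g 0 ^ 3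
        + 3 * inner q d * inner q v * g 0 ^ 5"
      unfolding inv_dist'_def inv_dist''_def g0 power_one_over by simp_all
    moreover have "a * g 0 ^ 3 - c * (3 * g 0 ^ 2 * (- b * g 0 ^ 3))
        = a * g 0 ^ 3 + 3 * b * c * g 0 ^ 5" for a b c
      by (simp add: eval_nat_numeral)
    ultimately show ?thesis by (simp only:)
  qed
  ultimately show ?thesis unfolding e by simp
qed

text \<open>\<open>dpot\<close> and \<open>hpot\<close> are the first and second differentials of
  the potential as forms on functions. Linearity and symmetries can be read off summand by summand;
  the matrix entries are recovered through \<open>unitf\<close>.\<close>

definition dpot :: "nat \<Rightarrow> (nat \<Rightarrow> real) \<Rightarrow> (nat \<Rightarrow> real) \<Rightarrow> (nat \<Rightarrow> real) \<Rightarrow> real" where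
  "dpot n m x v = (\<Sum>j<n. \<Sum>i<j. m i * m j * inv_dist' (cbody x i - cbody x j) (cbody v i - cbody v j))"

definition hpot ::
  "nat \<Rightarrow> (nat \<Rightarrow> real) \<Rightarrow> (nat \<Rightarrow> real) \<Rightarrow> (nat \<Rightarrow> real) \<Rightarrow> (nat \<Rightarrow> real) \<Rightarrow> real" where
  "hpot n m x u v = (\<Sum>j<n. \<Sum>i<j. m i * m j *
     inv_dist'' (cbody x i - cbody x j) (cbody u i - cbody u j) (cbody v i - cbody v j))"

abbreviation unitf :: "nat \<Rightarrow> nat \<Rightarrow> real" where
  "unitf c \<equiv> (\<lambda>i. of_bool (i = c))"

lemma cbody_line:
  assumes "x \<in> carrier_vec (2 * n)" "i < n"
  shows "cbody (($) (x + s \<cdot>\<^sub>v unit_vec (2 * n) c)) i = cbody (($) x) i + of_real s * cbody (unitf c) i"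
  using assms by (auto simp: cbody_def complex_eq_iff unit_vec_def)

lemma cbody_diff_line:
  assumes "x \<in> carrier_vec (2 * n)" "i < n" "j < n"
  shows "cbody (($) (x + s \<cdot>\<^sub>v unit_vec (2 * n) c)) i - cbody (($) (x + s \<cdot>\<^sub>v unit_vec (2 * n) c)) j =
    (cbody (($) x) i - cbody (($) x) j) + of_real s * (cbody (unitf c) i - cbody (unitf c) j)"
  unfolding cbody_line[OF assms(1,2)] cbody_line[OF assms(1,3)] by (simp add: algebra_simps)

lemma partial_deriv_potential:
  assumes x: "x \<in> carrier_vec (2 * n)" and free: "collision_free n x"
  shows "partial_deriv (potential n m) c x = dpot n m (($) x) (unitf c)"
proof -
  let ?q = "cbody (($) x)" and ?d = "cbody (unitf c)"
  have "((\<lambda>s. potential n m (x + s \<cdot>\<^sub>v unit_vec (2 * n) c)) has_real_derivative dpot n m (($) x)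
      (unitf c)) (at 0)"
  proof -
    have eq: "potential n m (x + s \<cdot>\<^sub>v unit_vec (2 * n) c) = (\<Sum>j<n. \<Sum>i<j. m i * m j *
        (1 / norm ((?q i - ?q j) + of_real s * (?d i - ?d j))))" for s
      unfolding potential_def body_eq_cbody
      by (intro sum.cong refl) (simp add: cbody_diff_line[OF x])
    have ne: "?q i - ?q j \<noteq> 0" if "j < n" "i < j" for i j
      using free that by (auto simp: collision_free_def body_eq_cbody)
    show ?thesis
      unfolding eq dpot_def by (intro DERIV_sum DERIV_cmult DERIV_inv_dist ne) auto
  qed
  then show ?thesis
    using x unfolding partial_deriv_def by (auto intro!: DERIV_imp_deriv)
qed

lemma hessian_potential:
  assumes x: "x \<in> carrier_vec (2 * n)" and free: "collision_free n x" and "c < 2 * n" "d < 2 * n"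
  shows "hessian (potential n m) x $$ (c, d) = hpot n m (($) x) (unitf c) (unitf d)"
proof -
  let ?q = "cbody (($) x)" and ?c = "cbody (unitf c)" and ?d = "cbody (unitf d)"
  let ?x = "\<lambda>s. x + s \<cdot>\<^sub>v unit_vec (2 * n) c"
  have ne: "?q i - ?q j \<noteq> 0" if "i < n" "j < n" "i \<noteq> j" for i j
    using free that by (auto simp: collision_free_def body_eq_cbody)
  \<comment> \<open>The outer derivative needs the formula for the inner one on a neighbourhood of
    0, so collisions must stay away for small \<open>s\<close>.\<close>
  have "\<forall>\<^sub>F s in nhds 0. collision_free n (?x s)"
  proof -
    have "\<forall>\<^sub>F s in nhds 0. \<forall>p\<in>{(i, j). i < n \<and> j < n \<and> i \<noteq> j}.
        ?q (fst p) - ?q (snd p) + of_real s * (?c (fst p) - ?c (snd p)) \<noteq> 0"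
    proof (rule eventually_ball_finite)
      show "finite {(i, j). i < n \<and> j < n \<and> i \<noteq> j}"
        by (rule finite_subset[of _ "{..<n} \<times> {..<n}"]) auto
      show "\<forall>p\<in>{(i, j). i < n \<and> j < n \<and> i \<noteq> j}. \<forall>\<^sub>F s in nhds 0.
        ?q (fst p) - ?q (snd p) + of_real s * (?c (fst p) - ?c (snd p)) \<noteq> 0"
      proof
        fix p assume p: "p \<in> {(i, j). i < n \<and> j < n \<and> i \<noteq> j}"
        have "((\<lambda>s. ?q (fst p) - ?q (snd p) + of_real s * (?c (fst p) - ?c (snd p))) \<longlongrightarrow>
            ?q (fst p) - ?q (snd p) + of_real 0 * (?c (fst p) - ?c (snd p))) (nhds 0)"
          by (intro tendsto_intros filterlim_ident)
        then show "\<forall>\<^sub>F s in nhds 0. ?q (fst p) - ?q (snd p) + of_real s * (?c (fst p) - ?c (snd p)) \<noteq> 0"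
          by (rule tendsto_imp_eventually_ne) (use ne p in auto)
      qed
    qed
    then show ?thesis
    proof eventually_elim
      case (elim s)
      show ?case
        unfolding collision_free_def
      proof (intro allI impI)
        fix i j assume ij: "i < n" "j < n" "i \<noteq> j"
        then have "?q i - ?q j + of_real s * (?c i - ?c j) \<noteq> 0" using elim by auto
        then show "body (?x s) i \<noteq> body (?x s) j"
          unfolding cbody_diff_line[OF x ij(1,2), symmetric] body_eq_cbody by simp
      qed
    qed
  qed
  then have "\<forall>\<^sub>F s in nhds 0. partial_deriv (potential n m) d (?x s) =
      (\<Sum>j<n. \<Sum>i<j. m i * m j * inv_dist' ((?q i - ?q j) + of_real s * (?c i - ?c j)) (?d i - ?d j))"
  proof eventually_elim
    case (elim s)
    have "?x s \<in> carrier_vec (2 * n)" using x by simp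
    from partial_deriv_potential[OF this elim] show ?case
      unfolding dpot_def
      by (simp add: cbody_diff_line[OF x])
  qed
  moreover have "((\<lambda>s. \<Sum>j<n. \<Sum>i<j. m i * m j * inv_dist' ((?q i - ?q j) + of_real s * (?c i
      - ?c j)) (?d i - ?d j))
      has_real_derivative hpot n m (($) x) (unitf c) (unitf d)) (at 0)"
    unfolding hpot_def by (intro DERIV_sum DERIV_cmult DERIV_inv_dist' ne) auto
  ultimately have "deriv (\<lambda>s. partial_deriv (potential n m) d (?x s)) 0 = hpot n m (($) x) (unitf c)
      (unitf d)"
    by (subst deriv_cong_ev[OF _ refl]) (auto intro: DERIV_imp_deriv)
  then show ?thesis
    using assms x by (simp add: hessian_def partial_deriv_def[of "partial_deriv (potential n m) d"])
qed

lemma gradient_potential: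
  assumes "x \<in> carrier_vec (2 * n)" "collision_free n x" "c < 2 * n"
  shows "gradient (potential n m) x $ c = dpot n m (($) x) (unitf c)"
  using assms by (simp add: gradient_def partial_deriv_potential)

lemma dpot_cong:
  assumes "\<And>c. c < 2 * n \<Longrightarrow> x c = x' c" "\<And>c. c < 2 * n \<Longrightarrow> v c = v' c"
  shows "dpot n m x v = dpot n m x' v'"
proof -
  have "cbody x i = cbody x' i" "cbody v i = cbody v' i" if "i < n" for i
    using cbody_cong[OF _ that] assms by blast+
  then show ?thesis unfolding dpot_def by (intro sum.cong) auto
qed

lemma hpot_cong:
  assumes "\<And>c. c < 2 * n \<Longrightarrow> x c = x' c" "\<And>c. c < 2 * n \<Longrightarrow> u c = u' c" "\<And>c. c < 2 * n \<Longrightarrow> v c = v' c"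
  shows "hpot n m x u v = hpot n m x' u' v'"
proof -
  have "cbody x i = cbody x' i" "cbody u i = cbody u' i" "cbody v i = cbody v' i" if "i < n" for i
    using cbody_cong[OF _ that] assms by blast+
  then show ?thesis unfolding hpot_def by (intro sum.cong) auto
qed

lemma inv_dist''_commute: "inv_dist'' q u v = inv_dist'' q v u"
  by (simp add: inv_dist''_def inner_commute)

lemma hpot_commute: "hpot n m x u v = hpot n m x v u"
  unfolding hpot_def by (subst inv_dist''_commute) (rule refl)

lemma dpot_add: "dpot n m x (\<lambda>i. u i + v i) = dpot n m x u + dpot n m x v"
  and dpot_scale: "dpot n m x (\<lambda>i. c * u i) = c * dpot n m x u"
proof -
  have "inv_dist' q (u + v) = inv_dist' q u + inv_dist' q v" for q u v
    by (simp add: inv_dist'_def inner_add_right add_divide_distrib diff_divide_distrib)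
  then show "dpot n m x (\<lambda>i. u i + v i) = dpot n m x u + dpot n m x v"
    by (simp add: dpot_def cbody_add add_diff_add distrib_left sum.distrib)
  have "inv_dist' q (of_real c * u) = c * inv_dist' q u" for q u
    by (simp add: inv_dist'_def inner_complex_def algebra_simps flip: add_divide_distrib)
  then show "dpot n m x (\<lambda>i. c * u i) = c * dpot n m x u"
    by (simp add: dpot_def cbody_scale sum_distrib_left mult.left_commute flip: right_diff_distrib)
qed

lemma hpot_add_left: "hpot n m x (\<lambda>i. u i + v i) w = hpot n m x u w + hpot n m x v w"
  and hpot_scale_left: "hpot n m x (\<lambda>i. c * u i) w = c * hpot n m x u w"
proof -
  have "inv_dist'' q (u + v) w = inv_dist'' q u w + inv_dist'' q v w" for q u v w
    by (simp add: inv_dist''_def inner_add_right inner_add_left add_divide_distrib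
        diff_divide_distrib algebra_simps)
  then show "hpot n m x (\<lambda>i. u i + v i) w = hpot n m x u w + hpot n m x v w"
    by (simp add: hpot_def cbody_add add_diff_add distrib_left sum.distrib)
  have "inv_dist'' q (of_real c * u) w = c * inv_dist'' q u w" for q u w
    by (simp add: inv_dist''_def inner_complex_def algebra_simps flip: add_divide_distrib)
  then show "hpot n m x (\<lambda>i. c * u i) w = c * hpot n m x u w"
    by (simp add: hpot_def cbody_scale sum_distrib_left mult.left_commute flip: right_diff_distrib)
qed

lemma hpot_add_right: "hpot n m x w (\<lambda>i. u i + v i) = hpot n m x w u + hpot n m x w v"
  and hpot_scale_right: "hpot n m x w (\<lambda>i. c * u i) = c * hpot n m x w u"
  by (simp_all add: hpot_commute[of n m x w] hpot_add_left hpot_scale_left)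

lemma hpot_zero_left: "hpot n m x (\<lambda>_. 0) v = 0"
  using hpot_scale_left[of n m x 0 "\<lambda>_. 0" v] by simp

lemma dpot_zero: "dpot n m x (\<lambda>_. 0) = 0"
  using dpot_scale[of n m x 0 "\<lambda>_. 0"] by simp

lemma hpot_sum_left:
  "finite S \<Longrightarrow> hpot n m x (\<lambda>i. \<Sum>c\<in>S. a c * u c i) v = (\<Sum>c\<in>S. a c * hpot n m x (u c) v)"
  by (induction S rule: finite_induct) (simp_all add: hpot_zero_left hpot_add_left hpot_scale_left)

lemma hpot_sum_right:
  "finite S \<Longrightarrow> hpot n m x v (\<lambda>i. \<Sum>c\<in>S. a c * u c i) = (\<Sum>c\<in>S. a c * hpot n m x v (u c))"
  by (simp add: hpot_commute[of n m x v] hpot_sum_left)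

lemma dpot_sum:
  "finite S \<Longrightarrow> dpot n m x (\<lambda>i. \<Sum>c\<in>S. a c * u c i) = (\<Sum>c\<in>S. a c * dpot n m x (u c))"
  by (induction S rule: finite_induct) (simp_all add: dpot_zero dpot_add dpot_scale)

lemma unitf_expansion: "i < N \<Longrightarrow> (\<Sum>c<N. v c * unitf c i) = v i"
  by (simp add: of_bool_def if_distrib[of "\<lambda>x. _ * x"] cong: if_cong)

lemma dpot_expand: "dpot n m x v = (\<Sum>c<2 * n. v c * dpot n m x (unitf c))"
  unfolding dpot_sum[OF finite_lessThan, symmetric] by (rule dpot_cong) (simp_all only: unitf_expansion)

lemma hpot_expand_right: "hpot n m x u v = (\<Sum>c<2 * n. v c * hpot n m x u (unitf c))"
  unfolding hpot_sum_right[OF finite_lessThan, symmetric]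
      by (rule hpot_cong) (simp_all only: unitf_expansion)

lemma hpot_expand_left: "hpot n m x u v = (\<Sum>c<2 * n. u c * hpot n m x (unitf c) v)"
  unfolding hpot_sum_left[OF finite_lessThan, symmetric]
      by (rule hpot_cong) (simp_all only: unitf_expansion)

section \<open>Symmetries of the potential\<close>

lemma inner_mult_complex: "inner (w * u) (w * v) = (norm w)\<^sup>2 * inner u v" for u v w :: complex
  by (simp add: inner_complex_def cmod_power2) (simp add: power2_eq_square algebra_simps)

text \<open>\<open>U (w x) = U x / |w|\<close> for complex \<open>w\<close>, by homogeneity and
  rotation invariance; differentiating along \<open>w v\<close> gives the same factor for each
  differential.\<close>

lemma dpot_cact:
  assumes "w \<noteq> 0"
  shows "dpot n m (cact w x) (cact w v) = dpot n m x v / norm w"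
proof -
  have "inv_dist' (w * q) (w * v) = inv_dist' q v / norm w" for q v
    using assms by (simp add: inv_dist'_def inner_mult_complex norm_mult power_mult_distrib power2_eq_square
        power3_eq_cube)
  then show ?thesis
    by (simp add: dpot_def cbody_cact sum_divide_distrib flip: right_diff_distrib)
qed

lemma hpot_cact:
  assumes "w \<noteq> 0"
  shows "hpot n m (cact w x) (cact w u) (cact w v) = hpot n m x u v / norm w"
proof -
  have "inv_dist'' (w * q) (w * u) (w * v) = inv_dist'' q u v / norm w" for q u v
    using assms
    by (simp add: inv_dist''_def inner_mult_complex norm_mult power_mult_distrib)
       (simp add: divide_simps eval_nat_numeral)
  then show ?thesis
    by (simp add: hpot_def cbody_cact sum_divide_distrib flip: right_diff_distrib)
qed

lemma dpot_self: "dpot n m (($) x) (($) x) = - potential n m x"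
proof -
  have "inv_dist' q q = - (1 / norm q)" for q
    by (cases "q = 0") (simp_all add: inv_dist'_def power2_norm_eq_inner[symmetric] power2_eq_square
        power3_eq_cube)
  then show ?thesis by (simp add: dpot_def potential_def body_eq_cbody sum_negf)
qed

lemma dpot_jj: "dpot n m x (jj x) = 0"
proof -
  have "inv_dist' q (\<i> * q) = 0" for q by (simp add: inv_dist'_def inner_complex_def)
  then show ?thesis
    by (simp add: dpot_def cbody_cact flip: cact_ii right_diff_distrib)
qed

text \<open>Euler's identity for the first differential, which is homogeneous of degree -2.\<close>

lemma hpot_self: "hpot n m x x v = - 2 * dpot n m x v"
proof -
  have "inv_dist'' q q v = - 2 * inv_dist' q v" for q v
    by (cases "q = 0") (simp_all add: inv_dist''_def inv_dist'_def power2_norm_eq_inner[symmetric]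
        eval_nat_numeral field_simps)
  then show ?thesis by (simp add: hpot_def dpot_def sum_distrib_left mult.left_commute sum_negf)
qed

text \<open>The rotation identity \<open>dpot_jj\<close>, differentiated along
  \<open>v\<close>.\<close>

lemma hpot_jj: "hpot n m x (jj x) v = - dpot n m x (jj v)"
proof -
  have "inv_dist'' q (\<i> * q) v = - inv_dist' q (\<i> * v)" for q v
    by (simp add: inv_dist''_def inv_dist'_def inner_complex_def diff_divide_distrib)
  then show ?thesis
    by (simp add: hpot_def dpot_def cbody_cact sum_negf flip: cact_ii right_diff_distrib)
qed

lemma hpot_translation:
  assumes "\<And>i j. i < n \<Longrightarrow> j < n \<Longrightarrow> cbody u i = cbody u j"
  shows "hpot n m x u v = 0"
proof -
  have "cbody u i - cbody u j = 0" if "j < n" "i < j" for i j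
    using assms[of i j] that by simp
  then show ?thesis
    unfolding hpot_def by (intro sum.neutral ballI) (simp add: inv_dist''_def)
qed

section \<open>Matrices and Rayleigh quotients\<close>

lemma mult_mat_entry:
  assumes "A \<in> carrier_mat r s" "B \<in> carrier_mat s t" "i < r" "j < t"
  shows "(A * B) $$ (i, j) = (\<Sum>l<s. A $$ (i, l) * B $$ (l, j))"
  using assms by (simp add: scalar_prod_def atLeast0LessThan)

lemma mult_mat_vec_entry:
  assumes "A \<in> carrier_mat r s" "v \<in> carrier_vec s" "i < r"
  shows "(A *\<^sub>v v) $ i = (\<Sum>l<s. A $$ (i, l) * v $ l)"
  using assms by (simp add: scalar_prod_def atLeast0LessThan)

lemma scalar_prod_sum: "v \<in> carrier_vec s \<Longrightarrow> u \<bullet> v = (\<Sum>l<s. u $ l * v $ l)"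
  by (simp add: scalar_prod_def atLeast0LessThan)

lemma sum_lessThan_pairs: "(\<Sum>i<2 * n. f i) = (\<Sum>i<n. f (2 * i) + f (2 * i + 1))"
  for f :: "nat \<Rightarrow> real"
  by (induction n) auto

lemma mass_mat_carrier [simp]: "mass_mat n m \<in> carrier_mat (2 * n) (2 * n)"
  and inv_mass_mat_carrier [simp]: "inv_mass_mat n m \<in> carrier_mat (2 * n) (2 * n)"
  by (simp_all add: mass_mat_def inv_mass_mat_def mat_diag_def)

lemma mass_mat_vec:
  assumes "v \<in> carrier_vec (2 * n)" "i < 2 * n"
  shows "(mass_mat n m *\<^sub>v v) $ i = m (i div 2) * v $ i"
proof -
  have "(mass_mat n m *\<^sub>v v) $ i = (\<Sum>l<2 * n. mass_mat n m $$ (i, l) * v $ l)"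
    by (rule mult_mat_vec_entry) (use assms in auto)
  also have "\<dots> = (\<Sum>l<2 * n. if l = i then m (i div 2) * v $ l else 0)"
    using assms by (intro sum.cong) (auto simp: mass_mat_def mat_diag_def)
  finally show ?thesis using assms by simp
qed

lemma inv_mass_mat_vec:
  assumes "v \<in> carrier_vec (2 * n)" "i < 2 * n"
  shows "(inv_mass_mat n m *\<^sub>v v) $ i = v $ i / m (i div 2)"
proof -
  have "(inv_mass_mat n m *\<^sub>v v) $ i = (\<Sum>l<2 * n. inv_mass_mat n m $$ (i, l) * v $ l)"
    by (rule mult_mat_vec_entry) (use assms in auto)
  also have "\<dots> = (\<Sum>l<2 * n. if l = i then v $ l / m (i div 2) else 0)"
    using assms by (intro sum.cong) (auto simp: inv_mass_mat_def mat_diag_def)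
  finally show ?thesis using assms by simp
qed

lemma Jmat_carrier [simp]: "Jmat j \<in> carrier_mat (2 * j) (2 * j)"
  unfolding Jmat_def by (rule carrier_matI) auto

lemma Jmat_vec:
  assumes "v \<in> carrier_vec (2 * j)" "i < j"
  shows "(Jmat j *\<^sub>v v) $ i = - v $ (j + i)" "(Jmat j *\<^sub>v v) $ (j + i) = v $ i"
proof -
  have "(Jmat j *\<^sub>v v) $ i = (\<Sum>l<2 * j. Jmat j $$ (i, l) * v $ l)"
    by (rule mult_mat_vec_entry[OF Jmat_carrier assms(1)]) (use assms in auto)
  also have "\<dots> = (\<Sum>l<2 * j. if l = j + i then - v $ l else 0)"
    using assms by (intro sum.cong) (auto simp: Jmat_def)
  finally show "(Jmat j *\<^sub>v v) $ i = - v $ (j + i)" using assms by simp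
  have "(Jmat j *\<^sub>v v) $ (j + i) = (\<Sum>l<2 * j. Jmat j $$ (j + i, l) * v $ l)"
    by (rule mult_mat_vec_entry[OF Jmat_carrier assms(1)]) (use assms in auto)
  also have "\<dots> = (\<Sum>l<2 * j. if l = i then v $ l else 0)"
    using assms by (intro sum.cong) (auto simp: Jmat_def)
  finally show "(Jmat j *\<^sub>v v) $ (j + i) = v $ i" using assms by simp
qed

lemma JJmat_Suc:
  assumes "JJmat j \<in> carrier_mat (2 * j) (2 * j)"
  shows "JJmat (Suc j) = four_block_mat (Jmat 1) (0\<^sub>m 2 (2 * j)) (0\<^sub>m (2 * j) 2) (JJmat j)"
  using carrier_matD[OF assms] carrier_matD[OF Jmat_carrier[of 1]] by (simp add: JJmat_def Let_def)

lemma JJmat_carrier [simp]: "JJmat j \<in> carrier_mat (2 * j) (2 * j)"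
proof (induction j)
  case (Suc j)
  from four_block_carrier_mat[OF Jmat_carrier[of 1] Suc] show ?case
    unfolding JJmat_Suc[OF Suc] by simp
qed (simp add: JJmat_def)

lemma JJmat_entry:
  assumes "i < 2 * j" "l < 2 * j"
  shows "JJmat j $$ (i, l) =
    (if even i \<and> l = i + 1 then - 1 else if even l \<and> i = l + 1 then 1 else 0)"
  using assms
proof (induction j arbitrary: i l)
  case (Suc j)
  note eq = JJmat_Suc[OF JJmat_carrier]
  note dims = carrier_matD[OF JJmat_carrier[of j]] carrier_matD[OF Jmat_carrier[of 1]]
  have Jmat1: "Jmat 1 $$ (i, l) = (if i = 0 \<and> l = 1 then - 1 else if i = 1 \<and> l = 0 then 1 else 0)"
    if "i < 2" "l < 2" for i l
    using that by (auto simp: Jmat_def less_2_cases_iff)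
  consider "i < 2" "l < 2" | "i < 2" "2 \<le> l" | "2 \<le> i" "l < 2" | i' l' where "i = 2 + i'" "l = 2 + l'"
    by (cases "i < 2"; cases "l < 2") (auto simp: not_less le_iff_add)
  then show ?case
  proof cases
    case 1
    then show ?thesis using Suc.prems dims by (auto simp: eq Jmat1[unfolded One_nat_def] less_2_cases_iff)
  next
    case 2
    then show ?thesis using Suc.prems dims by (auto simp: eq less_2_cases_iff)
  next
    case 3
    then show ?thesis using Suc.prems dims by (auto simp: eq less_2_cases_iff)
  next
    case 4
    then show ?thesis using Suc.prems Suc.IH[of i' l'] dims by (simp add: eq)
  qed
qed simp

lemma JJmat_vec:
  assumes "v \<in> carrier_vec (2 * j)" "i < 2 * j"
  shows "(JJmat j *\<^sub>v v) $ i = jj (($) v) i"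
proof -
  have eq: "(JJmat j *\<^sub>v v) $ i = (\<Sum>l<2 * j. JJmat j $$ (i, l) * v $ l)"
    by (rule mult_mat_vec_entry) (use assms in auto)
  show ?thesis
  proof (cases "even i")
    case True
    then have "i + 1 < 2 * j" using assms(2) by (auto elim!: evenE)
    have "(JJmat j *\<^sub>v v) $ i = (\<Sum>l<2 * j. if l = i + 1 then - v $ l else 0)"
      unfolding eq using assms True by (intro sum.cong) (auto simp: JJmat_entry)
    then show ?thesis using \<open>i + 1 < 2 * j\<close> True by (simp add: jj_def)
  next
    case False
    have "(JJmat j *\<^sub>v v) $ i = (\<Sum>l<2 * j. if l = i - 1 then v $ l else 0)"
      unfolding eq using assms False by (intro sum.cong) (auto simp: JJmat_entry elim!: oddE)
    then show ?thesis using assms(2) False by (simp add: jj_def)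
  qed
qed

section \<open>Lowest eigenvalue of a symmetric matrix\<close>

lemma quadratic_nonneg_imp_linear_zero:
  fixes b c :: real
  assumes "\<And>t. 0 \<le> 2 * t * b + t\<^sup>2 * c"
  shows "b = 0"
proof (rule ccontr)
  assume b: "b \<noteq> 0"
  \<comment> \<open>Any positive \<open>d\<close> above \<open>c / 2\<close> makes the quadratic
    negative at \<open>t = - b / d\<close>.\<close>
  define d where "d = \<bar>c\<bar> + 1"
  have d: "0 < d" "c < d" by (auto simp: d_def)
  have "0 \<le> 2 * (- b / d) * b + (- b / d)\<^sup>2 * c" by (rule assms)
  then have "0 \<le> (2 * (- b / d) * b + (- b / d)\<^sup>2 * c) * d\<^sup>2" by simp
  also have "\<dots> = b\<^sup>2 * (c - 2 * d)"
    using d by (simp add: field_simps power2_eq_square)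
  finally have "0 \<le> b\<^sup>2 * (c - 2 * d)" .
  moreover have "b\<^sup>2 * (c - 2 * d) < 0"
    using b d by (intro mult_pos_neg) auto
  ultimately show False by simp
qed

text \<open>The Rayleigh quotient attains its infimum on the compact unit sphere, and the first
  variation there is the eigenvector equation. One number \<open>\<mu>\<close> is thus both an
  eigenvalue, to which the minimizer condition speaks, and the lower bound of the form, as
  \<open>coercive\<close> asks.\<close>

lemma rayleigh_minimizer:
  assumes k: "0 < k" and sym: "\<And>i j. i < k \<Longrightarrow> j < k \<Longrightarrow> A i j = A j i"
  shows "\<exists>\<mu> y. ip k y y = 1 \<and> (\<forall>i<k. app k A y i = \<mu> * y i) \<and> (\<forall>x. \<mu> * ip k x x \<le> ip k x (app k A x))"
proof -
  define S where "S = {ip k x (app k A x) | x. ip k x x = 1}"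
  define \<mu> where "\<mu> = Inf S"
  have "ip k (unitf 0) (unitf 0) = 1"
    using k by (simp add: ip_def of_bool_def if_distrib[of "\<lambda>x. _ * x"] cong: if_cong)
  then have S_ne: "S \<noteq> {}" by (auto simp: S_def)
  have "- (1 + sqnorm k A) / 2 \<le> s" if s: "s \<in> S" for s
  proof -
    obtain x where x: "ip k x x = 1" "s = ip k x (app k A x)" using s by (auto simp: S_def)
    show ?thesis using two_ip_le[of k x "app k A x"] app_bound[of k A x] x by simp
  qed
  then have S_bdd: "bdd_below S" by (meson bdd_belowI)
  have min: "\<mu> * ip k x x \<le> ip k x (app k A x)" for x
  proof (cases "ip k x x = 0")
    case True
    then have "\<forall>i<k. x i = 0" by (simp add: ip_eq_0_iff)
    then show ?thesis using True by (simp add: ip_def)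
  next
    case False
    then have pos: "0 < ip k x x" using ip_nonneg[of k x] by linarith
    define c where "c = sqrt (ip k x x)"
    have c: "c * c = ip k x x" "c \<noteq> 0" using pos by (auto simp: c_def)
    have one: "ip k (\<lambda>i. x i / c) (\<lambda>i. x i / c) = 1"
      using c pos by (simp add: ip_linear)
    have "ip k (\<lambda>i. x i / c) (app k A (\<lambda>i. x i / c)) = ip k x (app k A x) / ip k x x"
      using c by (simp add: ip_linear app_div)
    then have "ip k x (app k A x) / ip k x x \<in> S" using one unfolding S_def by force
    then have "\<mu> \<le> ip k x (app k A x) / ip k x x"
      unfolding \<mu>_def using S_bdd by (rule cInf_lower)
    then show ?thesis using pos by (simp add: le_divide_eq)
  qed
  have ex: "\<exists>x. ip k x x = 1 \<and> ip k x (app k A x) < \<mu> + inverse (real (Suc j))" for j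
  proof -
    have "Inf S < \<mu> + inverse (real (Suc j))" by (simp add: \<mu>_def)
    then show ?thesis unfolding cInf_less_iff[OF S_ne S_bdd] by (auto simp: S_def)
  qed
  define x where "x j = (SOME x. ip k x x = 1 \<and> ip k x (app k A x) < \<mu> + inverse (real (Suc j)))" for j
  have "ip k (x j) (x j) = 1 \<and> ip k (x j) (app k A (x j)) < \<mu> + inverse (real (Suc j))" for j
    using someI_ex[OF ex[of j]] unfolding x_def .
  then have x: "\<And>j. ip k (x j) (x j) = 1"
    "\<And>j. ip k (x j) (app k A (x j)) < \<mu> + inverse (real (Suc j))" by auto
  have "\<bar>x j i\<bar> \<le> 1" if "i < k" for i j
    using abs_le_sqrt_ip[OF that, of "x j"] x(1) by simp
  then obtain r where r: "strict_mono r" "\<forall>i<k. convergent (\<lambda>j. x (r j) i)"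
    using common_convergent_subseq by blast
  define y where "y i = lim (\<lambda>j. x (r j) i)" for i
  have lim: "(\<lambda>j. x (r j) i) \<longlonglongrightarrow> y i" if "i < k" for i
    using r(2) that by (auto simp: y_def convergent_LIMSEQ_iff)
  have "(\<lambda>j. ip k (x (r j)) (x (r j))) \<longlonglongrightarrow> ip k y y"
    unfolding ip_def by (intro tendsto_intros lim) auto
  then have "(\<lambda>_. 1) \<longlonglongrightarrow> ip k y y" by (simp add: x(1))
  then have one: "ip k y y = 1" by (rule LIMSEQ_unique[OF _ tendsto_const])
  have "(\<lambda>j. ip k (x (r j)) (app k A (x (r j)))) \<longlonglongrightarrow> ip k y (app k A y)"
    unfolding ip_def app_def by (intro tendsto_intros lim) auto
  moreover have "(\<lambda>j. \<mu> + inverse (real (Suc (r j)))) \<longlonglongrightarrow> \<mu> + 0"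
    using LIMSEQ_subseq_LIMSEQ[OF LIMSEQ_inverse_real_of_nat r(1)]
    by (intro tendsto_add tendsto_const) (simp add: o_def)
  ultimately have "ip k y (app k A y) \<le> \<mu> + 0"
    by (rule LIMSEQ_le) (use x(2) in \<open>auto intro: less_imp_le\<close>)
  then have eq: "ip k y (app k A y) = \<mu>" using min[of y] one by simp
  \<comment> \<open>The residual of the eigenvector equation. Moving from \<open>y\<close> in the
    direction of the residual itself makes the first variation equal to
    \<open>2 * ip k w w\<close>.\<close>
  define w where "w i = app k A y i - \<mu> * y i" for i
  have adj: "ip k u (app k A v) = ip k v (app k A u)" for u v
  proof -
    have "ip k u (app k A v) = (\<Sum>i<k. \<Sum>j<k. u i * (A i j * v j))"
      by (simp add: ip_def app_def sum_distrib_left)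
    also have "\<dots> = (\<Sum>j<k. \<Sum>i<k. u i * (A i j * v j))" by (rule sum.swap)
    also have "\<dots> = (\<Sum>j<k. \<Sum>i<k. v j * (A j i * u i))"
      using sym by (intro sum.cong refl) (auto simp: mult_ac)
    finally show ?thesis by (simp add: ip_def app_def sum_distrib_left)
  qed
  have "ip k w w = 0"
  proof (rule quadratic_nonneg_imp_linear_zero)
    fix t
    let ?z = "\<lambda>i. y i + t * w i"
    have "0 \<le> ip k ?z (app k A ?z) - \<mu> * ip k ?z ?z" using min[of ?z] by simp
    also have "\<dots> = 2 * t * ip k w w + t\<^sup>2 * (ip k w (app k A w) - \<mu> * ip k w w)"
    proof -
      have "ip k w w = ip k w (app k A y) - \<mu> * ip k w y"
        using ip_diff_right[of k w "app k A y" "\<lambda>i. \<mu> * y i"] by (simp add: w_def[abs_def] ip_scale_right)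
      then have "ip k w (app k A y) = ip k w w + \<mu> * ip k w y" by simp
      then show ?thesis
        using eq one adj[of y w] ip_commute[of k y w]
        by (simp add: app_add app_scale ip_linear power2_eq_square algebra_simps)
    qed
    finally show "0 \<le> 2 * t * ip k w w + t\<^sup>2 * (ip k w (app k A w) - \<mu> * ip k w w)" .
  qed
  then have "\<forall>i<k. app k A y i = \<mu> * y i" by (simp add: ip_eq_0_iff w_def)
  with one min show ?thesis by blast
qed

section \<open>Adapted frames\<close>

definition mip :: "nat \<Rightarrow> (nat \<Rightarrow> real) \<Rightarrow> (nat \<Rightarrow> real) \<Rightarrow> (nat \<Rightarrow> real) \<Rightarrow> real" where
  "mip n m u v = (\<Sum>i<2 * n. m (i div 2) * u i * v i)"

lemma mip_commute: "mip n m u v = mip n m v u"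
  by (simp add: mip_def mult_ac)

lemma mip_cong:
  "(\<And>c. c < 2 * n \<Longrightarrow> u c = u' c) \<Longrightarrow> (\<And>c. c < 2 * n \<Longrightarrow> v c = v' c) \<Longrightarrow> mip n m u v = mip n m u' v'"
  unfolding mip_def by (intro sum.cong) auto

lemma mip_add_left: "mip n m (\<lambda>i. u i + v i) w = mip n m u w + mip n m v w"
  and mip_scale_left: "mip n m (\<lambda>i. c * u i) w = c * mip n m u w"
  by (simp_all add: mip_def sum.distrib sum_distrib_left algebra_simps)

lemma mip_add_right: "mip n m w (\<lambda>i. u i + v i) = mip n m w u + mip n m w v"
  and mip_scale_right: "mip n m w (\<lambda>i. c * u i) = c * mip n m w u"
  by (simp_all add: mip_commute[of n m w] mip_add_left mip_scale_left)

lemma mip_sum_right: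
  "finite S \<Longrightarrow> mip n m v (\<lambda>i. \<Sum>c\<in>S. a c * u c i) = (\<Sum>c\<in>S. a c * mip n m v (u c))"
  by (induction S rule: finite_induct) (simp_all add: mip_add_right mip_scale_right, simp add: mip_def)

text \<open>Both coordinates of a body carry the same mass, so \<open>jj\<close> is skew for the
  mass inner product as well.\<close>

lemma mip_jj_right: "mip n m u (jj v) = - mip n m (jj u) v"
proof -
  have "(\<Sum>i<2 * n. m (i div 2) * u i * jj v i) = - (\<Sum>i<2 * n. m (i div 2) * jj u i * v i)"
    by (induction n) (auto simp: jj_def)
  then show ?thesis by (simp add: mip_def)
qed

lemma mip_mass: "v \<in> carrier_vec (2 * n) \<Longrightarrow> (mass_mat n m *\<^sub>v v) \<bullet> w = mip n m (($) v) (($) w)"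
  if "w \<in> carrier_vec (2 * n)"
  using that by (subst scalar_prod_sum[OF that]) (auto simp: mip_def mass_mat_vec intro!: sum.cong)

locale cc_frame =
  fixes n :: nat and m :: "nat \<Rightarrow> real" and a :: "real Matrix.vec" and P :: "real Matrix.mat"
  assumes n_ge_3: "3 \<le> n"
    and mass_pos: "\<And>i. i < n \<Longrightarrow> 0 < m i"
    and central: "planar_central_configuration n m a"
    and frame: "adapted_frame n m a P"
begin

abbreviation k where "k \<equiv> 2 * n - 4"
abbreviation av where "av \<equiv> (\<lambda>i. a $ i)"
abbreviation p where "p c \<equiv> (\<lambda>i. P $$ (i, c))"
abbreviation U where "U \<equiv> potential n m a"
abbreviation Rf where "Rf \<equiv> (\<lambda>i j. regularized_hessian n m a P $$ (i, j))"

lemma even_k: "even k" and k_pos: "0 < k" and k4: "k + 4 = 2 * n"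
  using n_ge_3 by auto

lemma a_carrier: "a \<in> carrier_vec (2 * n)" and a_free: "collision_free n a"
  and a_inertia: "moment_of_inertia n m a = 1"
  using central
  by (auto simp: planar_central_configuration_def normalized_configs_def config_space_def)

lemma P_carrier: "P \<in> carrier_mat (2 * n) (2 * n)"
  using frame by (simp add: adapted_frame_def)

lemma mass_div_pos: "i < 2 * n \<Longrightarrow> 0 < m (i div 2)"
  by (rule mass_pos) auto

text \<open>This product is the inverse of \<open>P\<close>, so its rows form the dual
  frame.\<close>

lemma frame_dual:
  "transpose_mat P * mass_mat n m \<in> carrier_mat (2 * n) (2 * n)"
  "c < 2 * n \<Longrightarrow> j < 2 * n \<Longrightarrow> (transpose_mat P * mass_mat n m) $$ (c, j) = P $$ (j, c) * m (j div 2)"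
proof -
  show "transpose_mat P * mass_mat n m \<in> carrier_mat (2 * n) (2 * n)"
    using P_carrier by (intro mult_carrier_mat[of _ _ "2 * n"]) auto
  assume c: "c < 2 * n" and j: "j < 2 * n"
  have "(transpose_mat P * mass_mat n m) $$ (c, j) =
      (\<Sum>l<2 * n. transpose_mat P $$ (c, l) * mass_mat n m $$ (l, j))"
    by (rule mult_mat_entry[OF _ mass_mat_carrier c j]) (use P_carrier in simp)
  also have "\<dots> = (\<Sum>l<2 * n. if l = j then P $$ (l, c) * m (l div 2) else 0)"
    using P_carrier c j by (intro sum.cong) (auto simp: mass_mat_def mat_diag_def)
  finally show "(transpose_mat P * mass_mat n m) $$ (c, j) = P $$ (j, c) * m (j div 2)"
    using j by simp
qed

lemma frame_orthonormal: "transpose_mat P * mass_mat n m * P = 1\<^sub>m (2 * n)"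
  using frame by (simp add: adapted_frame_def)

lemma mip_p:
  assumes "c < 2 * n" "d < 2 * n"
  shows "mip n m (p c) (p d) = of_bool (c = d)"
proof -
  have "of_bool (c = d) = (transpose_mat P * mass_mat n m * P) $$ (c, d)"
    using assms by (simp add: frame_orthonormal)
  also have "\<dots> = (\<Sum>j<2 * n. (transpose_mat P * mass_mat n m) $$ (c, j) * P $$ (j, d))"
    by (rule mult_mat_entry[OF frame_dual(1) P_carrier assms])
  also have "\<dots> = mip n m (p c) (p d)"
    unfolding mip_def using assms by (intro sum.cong) (auto simp: frame_dual(2))
  finally show ?thesis by simp
qed

text \<open>A left inverse of a square matrix is a right inverse: orthonormality of the columns
  gives completeness.\<close>

lemma frame_complete:
  assumes "i < 2 * n" "j < 2 * n"
  shows "(\<Sum>c<2 * n. P $$ (i, c) * (P $$ (j, c) * m (j div 2))) = of_bool (i = j)"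
proof -
  have "P * (transpose_mat P * mass_mat n m) = 1\<^sub>m (2 * n)"
    by (rule mat_mult_left_right_inverse[OF frame_dual(1) P_carrier frame_orthonormal])
  then have "of_bool (i = j) = (P * (transpose_mat P * mass_mat n m)) $$ (i, j)"
    using assms by simp
  also have "\<dots> = (\<Sum>c<2 * n. P $$ (i, c) * (transpose_mat P * mass_mat n m) $$ (c, j))"
    by (rule mult_mat_entry[OF P_carrier frame_dual(1) assms])
  also have "\<dots> = (\<Sum>c<2 * n. P $$ (i, c) * (P $$ (j, c) * m (j div 2)))"
    using assms by (intro sum.cong) (auto simp: frame_dual(2))
  finally show ?thesis by simp
qed

lemma frame_expand:
  assumes "i < 2 * n"
  shows "v i = (\<Sum>c<2 * n. mip n m (p c) v * p c i)"
proof -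
  have "(\<Sum>c<2 * n. mip n m (p c) v * p c i) = (\<Sum>c<2 * n. \<Sum>j<2 * n. P $$ (i, c) * (P $$ (j, c)
      * m (j div 2)) * v j)"
    unfolding mip_def sum_distrib_right by (intro sum.cong refl) (simp add: mult_ac)
  also have "\<dots> = (\<Sum>j<2 * n. (\<Sum>c<2 * n. P $$ (i, c) * (P $$ (j, c) * m (j div 2))) * v j)"
    by (subst sum.swap) (simp add: sum_distrib_right)
  also have "\<dots> = (\<Sum>j<2 * n. if j = i then v j else 0)"
    using frame_complete[OF assms] by (intro sum.cong) auto
  finally show ?thesis using assms by simp
qed

text \<open>Column by column, \<open>J P = P J\<close> says that the frame consists of pairs
  \<open>2 j\<close>, \<open>2 j + 1\<close> on which \<open>jj\<close> acts like the imaginary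
  unit.\<close>

lemma jj_p:
  assumes "i < 2 * n" "c < 2 * n"
  shows "jj (p c) i = (if even c then p (c + 1) i else - p (c - 1) i)"
proof -
  have eq: "(JJmat n * P) $$ (i, c) = (P * JJmat n) $$ (i, c)"
    using frame by (simp add: adapted_frame_def)
  have "(JJmat n * P) $$ (i, c) = (JJmat n *\<^sub>v col P c) $ i"
    using assms P_carrier carrier_matD[OF JJmat_carrier[of n]] by simp
  also have "\<dots> = jj (($) (col P c)) i"
    by (rule JJmat_vec) (use assms P_carrier in auto)
  also have "\<dots> = jj (p c) i"
    by (rule jj_cong[of "2 * n"]) (use assms P_carrier in auto)
  finally have "jj (p c) i = (P * JJmat n) $$ (i, c)" using eq by simp
  also have "\<dots> = (\<Sum>d<2 * n. P $$ (i, d) * JJmat n $$ (d, c))"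
    by (rule mult_mat_entry[OF P_carrier JJmat_carrier assms])
  also have "\<dots> = (if even c then p (c + 1) i else - p (c - 1) i)"
  proof (cases "even c")
    case True
    then have "c + 1 < 2 * n" using assms(2) by (auto elim!: evenE)
    have "(\<Sum>d<2 * n. P $$ (i, d) * JJmat n $$ (d, c)) = (\<Sum>d<2 * n. if d = c + 1 then P $$ (i, d) else 0)"
      using assms True by (intro sum.cong) (auto simp: JJmat_entry)
    then show ?thesis using \<open>c + 1 < 2 * n\<close> True by simp
  next
    case False
    then obtain c' where c': "c = 2 * c' + 1" by (auto elim: oddE)
    have "(\<Sum>d<2 * n. P $$ (i, d) * JJmat n $$ (d, c)) = (\<Sum>d<2 * n. if d = 2 * c' then - P $$ (i, d) else 0)"
      using assms False by (intro sum.cong) (auto simp: JJmat_entry c')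
    then show ?thesis using assms False by (simp add: c')
  qed
  finally show ?thesis .
qed

lemma span2_expand:
  assumes "u \<in> carrier_vec (2 * n)" "v \<in> carrier_vec (2 * n)" "w \<in> span2 u v"
  shows "\<exists>\<alpha> \<beta>. \<forall>i<2 * n. w $ i = \<alpha> * u $ i + \<beta> * v $ i"
proof -
  obtain c d where w: "w = c \<cdot>\<^sub>v u + d \<cdot>\<^sub>v v" using assms(3) by (auto simp: span2_def)
  show ?thesis
    by (rule exI[of _ c], rule exI[of _ d]) (use assms w in auto)
qed

lemma span2_left: "u \<in> span2 u v" if "u \<in> carrier_vec N" "v \<in> carrier_vec N"
proof -
  have "u = 1 \<cdot>\<^sub>v u + 0 \<cdot>\<^sub>v v" using that by auto
  then show ?thesis unfolding span2_def by blast
qed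

lemma span2_right: "v \<in> span2 u v" if "u \<in> carrier_vec N" "v \<in> carrier_vec N"
proof -
  have "v = 0 \<cdot>\<^sub>v u + 1 \<cdot>\<^sub>v v" using that by auto
  then show ?thesis unfolding span2_def by blast
qed

lemma col_P: "c < 2 * n \<Longrightarrow> col P c \<in> carrier_vec (2 * n)"
  using P_carrier by auto

lemma small_lt: "0 < 2 * n" "1 < 2 * n" "2 < 2 * n" "3 < 2 * n"
  using n_ge_3 by auto

lemma spans:
  "span2 (col P 0) (col P 1) = translation_directions n"
  "span2 (col P 2) (col P 3) = span2 a (JJmat n *\<^sub>v a)"
  using frame by (simp_all add: adapted_frame_def)

lemma JJ_a_carrier: "JJmat n *\<^sub>v a \<in> carrier_vec (2 * n)"
  using a_carrier by (intro mult_mat_vec_carrier[OF JJmat_carrier])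

lemma span2_orth:
  assumes "c1 < 4" "c2 < 4" "w \<in> span2 (col P c1) (col P c2)" "4 \<le> c" "c < 2 * n"
  shows "mip n m (($) w) (p c) = 0"
proof -
  have c12: "c1 < 2 * n" "c2 < 2 * n" using assms n_ge_3 by auto
  obtain \<alpha> \<beta> where w: "\<And>i. i < 2 * n \<Longrightarrow> w $ i = \<alpha> * col P c1 $ i + \<beta> * col P c2 $ i"
    using span2_expand[OF col_P[OF c12(1)] col_P[OF c12(2)] assms(3)] by blast
  have "mip n m (($) w) (p c) = mip n m (\<lambda>i. \<alpha> * p c1 i + \<beta> * p c2 i) (p c)"
    by (rule mip_cong) (use w c12 P_carrier in auto)
  also have "\<dots> = 0"
    using assms c12 by (simp add: mip_add_left mip_scale_left mip_p)
  finally show ?thesis .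
qed

lemma mip_a_p: "4 \<le> c \<Longrightarrow> c < 2 * n \<Longrightarrow> mip n m av (p c) = 0"
  using span2_orth[of 2 3 a c] span2_left[OF a_carrier JJ_a_carrier] spans by simp

lemma mip_jja_p: "4 \<le> c \<Longrightarrow> c < 2 * n \<Longrightarrow> mip n m (jj av) (p c) = 0"
proof -
  assume c: "4 \<le> c" "c < 2 * n"
  have "mip n m (jj av) (p c) = mip n m (($) (JJmat n *\<^sub>v a)) (p c)"
    by (rule mip_cong) (simp_all add: JJmat_vec[OF a_carrier])
  also have "\<dots> = 0"
    using span2_orth[of 2 3 "JJmat n *\<^sub>v a" c] span2_right[OF a_carrier JJ_a_carrier] spans c by simp
  finally show ?thesis .
qed

text \<open>The two components of the centre of mass are the pairings with the two unit
  translations.\<close>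

lemma centered_orth:
  assumes v: "v \<in> carrier_vec (2 * n)"
    and orth: "\<And>w. w \<in> translation_directions n \<Longrightarrow> mip n m (($) w) (($) v) = 0"
  shows "centered n m v"
proof -
  have *: "mip n m (\<lambda>i. if even i then \<alpha> else \<beta>) (($) v) = 0" for \<alpha> \<beta>
  proof -
    have "mip n m (\<lambda>i. if even i then \<alpha> else \<beta>) (($) v) = mip n m (($) (vec (2 * n) (\<lambda>i.
        if even i then \<alpha> else \<beta>))) (($) v)"
      by (rule mip_cong) auto
    also have "\<dots> = 0" by (rule orth) (auto simp: translation_directions_def)
    finally show ?thesis .
  qed
  have "(\<Sum>i<n. m i * v $ (2 * i)) = 0" "(\<Sum>i<n. m i * v $ (2 * i + 1)) = 0"
    using *[of 1 0] *[of 0 1] unfolding mip_def sum_lessThan_pairs by simp_all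
  then show ?thesis
    unfolding centered_def by (simp add: complex_eq_iff body_def)
qed

text \<open>Such a combination is mass-orthogonal to the first four columns, which span the
  translations, \<open>a\<close> and the rotation direction \<open>jj a\<close>.\<close>

lemma tangent_orth:
  assumes v: "v \<in> carrier_vec (2 * n)"
    and vp: "\<And>i. i < 2 * n \<Longrightarrow> v $ i = (\<Sum>d<k. y d * p (d + 4) i)"
  shows "v \<in> tangent_space n m a" "mip n m (jj av) (($) v) = 0"
proof -
  have *: "mip n m u (($) v) = (\<Sum>d<k. y d * mip n m u (p (d + 4)))" for u
  proof -
    have "mip n m u (($) v) = mip n m u (\<lambda>i. \<Sum>d<k. y d * p (d + 4) i)"
      by (rule mip_cong) (use vp in auto)
    then show ?thesis by (simp add: mip_sum_right)
  qed
  have d: "4 \<le> d + 4" "d + 4 < 2 * n" if "d < k" for d using that by auto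
  have "centered n m v"
  proof (rule centered_orth[OF v])
    fix w assume "w \<in> translation_directions n"
    then have "mip n m (($) w) (p (d + 4)) = 0" if "d < k" for d
      using span2_orth[of 0 1 w "d + 4"] spans that by simp
    then show "mip n m (($) w) (($) v) = 0" by (simp add: *)
  qed
  moreover have "mip n m av (($) v) = 0" by (simp add: * mip_a_p d)
  ultimately show "v \<in> tangent_space n m a"
    using v mip_mass[OF v a_carrier] by (simp add: tangent_space_def)
  show "mip n m (jj av) (($) v) = 0" by (simp add: * mip_jja_p d)
qed

section \<open>Criticality and the block structure of the Hessian\<close>

lemma dpot_a_p:
  assumes "4 \<le> c" "c < 2 * n"
  shows "dpot n m av (p c) = 0"
proof -
  have v: "col P c \<in> carrier_vec (2 * n)" by (rule col_P[OF assms(2)])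
  have "col P c \<in> tangent_space n m a"
  proof (rule tangent_orth(1)[OF v])
    fix i assume i: "i < 2 * n"
    have "(\<Sum>d<k. of_bool (d + 4 = c) * p (d + 4) i) = (\<Sum>d<k. if d = c - 4 then p c i else 0)"
      using assms by (intro sum.cong) auto
    also have "\<dots> = p c i" using assms by auto
    finally show "col P c $ i = (\<Sum>d<k. of_bool (d + 4 = c) * p (d + 4) i)"
      using i assms P_carrier by simp
  qed
  then have "gradient (potential n m) a \<bullet> col P c = 0"
    using central by (simp add: planar_central_configuration_def)
  also have "gradient (potential n m) a \<bullet> col P c = (\<Sum>i<2 * n. dpot n m av (unitf i) * p c i)"
    unfolding scalar_prod_sum[OF v] using assms P_carrier
    by (intro sum.cong) (auto simp: gradient_potential[OF a_carrier a_free])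
  finally show ?thesis by (subst dpot_expand) (simp add: mult.commute)
qed

text \<open>Translations lie in the kernel of the second differential. For \<open>a\<close> and
  \<open>jj a\<close> the identities \<open>hpot_self\<close> and \<open>hpot_jj\<close> reduce it
  to the first differential, which at a central configuration vanishes on the high columns and on
  their \<open>jj\<close> images.\<close>

lemma hpot_a_low_high:
  assumes "c < 4" "4 \<le> d" "d < 2 * n"
  shows "hpot n m av (p c) (p d) = 0"
proof (cases "c < 2")
  case True
  then have "c = 0 \<or> c = 1" by auto
  then have "col P c \<in> translation_directions n"
    using span2_left[OF col_P[OF small_lt(1)] col_P[OF small_lt(2)]]
      span2_right[OF col_P[OF small_lt(1)] col_P[OF small_lt(2)]] spans(1) by auto
  then obtain \<alpha> \<beta> where w: "col P c = vec (2 * n) (\<lambda>i. if even i then \<alpha> else \<beta>)"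
    by (auto simp: translation_directions_def)
  have pc: "p c i = (if even i then \<alpha> else \<beta>)" if "i < 2 * n" for i
  proof -
    have "p c i = col P c $ i" using that True P_carrier small_lt by auto
    then show ?thesis using that by (simp add: w)
  qed
  show ?thesis
    by (rule hpot_translation) (use pc in \<open>simp add: cbody_def\<close>)
next
  case False
  then have "c = 2 \<or> c = 3" using assms by auto
  then have "col P c \<in> span2 a (JJmat n *\<^sub>v a)"
    using span2_left[OF col_P[OF small_lt(3)] col_P[OF small_lt(4)]]
      span2_right[OF col_P[OF small_lt(3)] col_P[OF small_lt(4)]] spans(2) by auto
  from span2_expand[OF a_carrier JJ_a_carrier this]
  obtain \<alpha> \<beta> where w: "\<And>i. i < 2 * n \<Longrightarrow> col P c $ i = \<alpha> * a $ i + \<beta> * (JJmat n *\<^sub>v a) $ i" by blast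
  have pc: "p c i = \<alpha> * a $ i + \<beta> * jj av i" if "i < 2 * n" for i
  proof -
    have "p c i = col P c $ i" using that assms n_ge_3 P_carrier by auto
    then show ?thesis using that by (simp add: w JJmat_vec[OF a_carrier])
  qed
  have jjp: "dpot n m av (jj (p d)) = 0"
  proof (cases "even d")
    case True
    then have "d + 1 < 2 * n" using assms by (auto elim!: evenE)
    have "dpot n m av (jj (p d)) = dpot n m av (p (d + 1))"
      by (rule dpot_cong) (use assms True in \<open>simp_all add: jj_p\<close>)
    also have "\<dots> = 0" by (rule dpot_a_p) (use assms \<open>d + 1 < 2 * n\<close> in auto)
    finally show ?thesis .
  next
    case False
    \<comment> \<open>An odd \<open>d\<close> is at least 5, so \<open>d - 1\<close> is again a high
      column.\<close>
    have "d \<noteq> 4" using False by auto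
    have "dpot n m av (jj (p d)) = dpot n m av (\<lambda>i. (- 1) * p (d - 1) i)"
      by (rule dpot_cong) (use assms False in \<open>simp_all add: jj_p\<close>)
    also have "\<dots> = 0" unfolding dpot_scale using assms \<open>d \<noteq> 4\<close> by (simp add: dpot_a_p)
    finally show ?thesis .
  qed
  have "hpot n m av (p c) (p d) = hpot n m av (\<lambda>i. \<alpha> * av i + \<beta> * jj av i) (p d)"
    by (rule hpot_cong) (use pc in auto)
  also have "\<dots> = 0"
    unfolding hpot_add_left hpot_scale_left using assms by (simp add: hpot_self hpot_jj jjp dpot_a_p)
  finally show ?thesis .
qed

lemma potential_pos: "0 < U"
proof -
  have pos: "0 < m i * m j / norm (body a i - body a j)" if "i < j" "j < n" for i j
  proof -
    have "body a i \<noteq> body a j" using a_free that by (auto simp: collision_free_def)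
    then show ?thesis using mass_pos[of i] mass_pos[of j] that by simp
  qed
  have "0 < (\<Sum>i<1. m i * m 1 / norm (body a i - body a 1))"
    using pos[of 0 1] n_ge_3 by simp
  also have "\<dots> \<le> U"
    unfolding potential_def
  proof (rule member_le_sum)
    show "0 \<le> (\<Sum>i<j. m i * m j / norm (body a i - body a j))" if "j \<in> {..<n} - {1}" for j
      by (rule sum_nonneg) (use pos that in \<open>auto intro: less_imp_le\<close>)
  qed (use n_ge_3 in auto)
  finally show ?thesis .
qed

lemma Rf_entry:
  assumes "i < k" "j < k"
  shows "Rf i j = of_bool (i = j) + hpot n m av (p (i + 4)) (p (j + 4)) / U"
proof -
  let ?H = "hessian (potential n m) a"
  have H: "?H \<in> carrier_mat (2 * n) (2 * n)" using a_carrier by (simp add: hessian_def)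
  have PH: "transpose_mat P * ?H \<in> carrier_mat (2 * n) (2 * n)"
    using P_carrier H by (intro mult_carrier_mat[of _ _ "2 * n"]) auto
  have ij: "i + 4 < 2 * n" "j + 4 < 2 * n" using assms by auto
  have "(transpose_mat P * ?H * P) $$ (i + 4, j + 4) = (\<Sum>l<2 * n. (transpose_mat P * ?H) $$ (i
      + 4, l) * P $$ (l, j + 4))"
    by (rule mult_mat_entry[OF PH P_carrier ij])
  also have "\<dots> = (\<Sum>l<2 * n. P $$ (l, j + 4) * hpot n m av (p (i + 4)) (unitf l))"
  proof (intro sum.cong refl)
    fix l assume "l \<in> {..<2 * n}"
    then have l: "l < 2 * n" by simp
    have "(transpose_mat P * ?H) $$ (i + 4, l) = (\<Sum>s<2 * n. transpose_mat P $$ (i + 4, s) * ?H $$ (s, l))"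
      by (rule mult_mat_entry[OF _ H ij(1) l]) (use P_carrier in simp)
    also have "\<dots> = (\<Sum>s<2 * n. p (i + 4) s * hpot n m av (unitf s) (unitf l))"
      using P_carrier ij l by (intro sum.cong) (auto simp: hessian_potential[OF a_carrier a_free])
    also have "\<dots> = hpot n m av (p (i + 4)) (unitf l)" by (rule hpot_expand_left[symmetric])
    finally show "(transpose_mat P * ?H) $$ (i + 4, l) * P $$ (l, j + 4)
        = P $$ (l, j + 4) * hpot n m av (p (i + 4)) (unitf l)"
      by simp
  qed
  also have "\<dots> = hpot n m av (p (i + 4)) (p (j + 4))" by (rule hpot_expand_right[symmetric])
  finally show ?thesis
    using assms P_carrier PH by (simp add: regularized_hessian_def Let_def)
qed

lemma Rf_sym: "i < k \<Longrightarrow> j < k \<Longrightarrow> Rf i j = Rf j i"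
  by (simp add: Rf_entry hpot_commute[of n m av "p (i + 4)"])

lemma hpot_p_high:
  assumes "c < k"
  shows "hpot n m av (p (c + 4)) (\<lambda>i. \<Sum>d<k. y d * p (d + 4) i) = U * (app k Rf y c - y c)"
proof -
  have "hpot n m av (p (c + 4)) (\<lambda>i. \<Sum>d<k. y d * p (d + 4) i) = (\<Sum>d<k. y d * hpot n m av (p (c
      + 4)) (p (d + 4)))"
    by (rule hpot_sum_right) simp
  also have "\<dots> = (\<Sum>d<k. U * (Rf c d * y d) - (if d = c then U * y d else 0))"
    using assms potential_pos by (intro sum.cong) (auto simp: Rf_entry field_simps)
  also have "\<dots> = U * (app k Rf y c - y c)"
    using assms by (simp add: sum_subtractf app_def sum_distrib_left right_diff_distrib)
  finally show ?thesis .
qed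

text \<open>The eigenvector for the least eigenvalue \<open>\<mu>\<close> of \<open>R\<close> lifts
  to a tangent vector \<open>v\<close>, by the block structure an eigenvector of the restricted
  Hessian for \<open>U * \<mu>\<close>. Being of norm 1 and orthogonal to \<open>jj a\<close>, it is
  off the trivial line, so the minimizer condition gives \<open>\<mu> > 0\<close>.\<close>

lemma coercive_Rf:
  assumes min: "nondegenerate_minimizer n m a"
  shows "\<exists>\<rho>. coercive k Rf \<rho>"
proof -
  obtain \<mu> y where one: "ip k y y = 1" and eig: "\<And>i. i < k \<Longrightarrow> app k Rf y i = \<mu> * y i"
    and low: "\<And>x. \<mu> * ip k x x \<le> ip k x (app k Rf x)"
    using rayleigh_minimizer[OF k_pos, of Rf] Rf_sym by blast
  let ?w = "\<lambda>i. \<Sum>d<k. y d * p (d + 4) i"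
  define v where "v = vec (2 * n) ?w"
  have v: "v \<in> carrier_vec (2 * n)" by (simp add: v_def)
  have vi: "v $ i = ?w i" if "i < 2 * n" for i using that by (simp add: v_def)
  have mip_pw: "mip n m (p c) ?w = (if c < 4 then 0 else y (c - 4))" if "c < 2 * n" for c
  proof -
    have "mip n m (p c) ?w = (\<Sum>d<k. y d * mip n m (p c) (p (d + 4)))"
      by (rule mip_sum_right) simp
    also have "\<dots> = (\<Sum>d<k. if d + 4 = c then y d else 0)"
      using that by (intro sum.cong) (auto simp: mip_p)
    also have "\<dots> = (if c < 4 then 0 else y (c - 4))"
    proof (cases "c < 4")
      case False
      have "(\<Sum>d<k. if d + 4 = c then y d else 0) = (\<Sum>d<k. if d = c - 4 then y d else 0)"
        using False by (intro sum.cong) auto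
      then show ?thesis using False that by auto
    qed auto
    finally show ?thesis .
  qed
  have low_part: "hpot n m av (p c) ?w = 0" if "c < 4" for c
    unfolding hpot_sum_right[OF finite_lessThan] using that by (simp add: hpot_a_low_high)
  \<comment> \<open>Weak form of the eigenvector equation, tested in the frame: on low columns both
    sides vanish, on high ones it is the equation for \<open>y\<close>.\<close>
  have key: "hpot n m av u ?w = U * (\<mu> - 1) * mip n m u ?w" for u
  proof -
    have "hpot n m av u ?w = hpot n m av (\<lambda>i. \<Sum>c<2 * n. mip n m (p c) u * p c i) ?w"
      by (rule hpot_cong) (auto intro: frame_expand)
    also have "\<dots> = (\<Sum>c<2 * n. mip n m (p c) u * hpot n m av (p c) ?w)"
      by (rule hpot_sum_left) simp
    also have "\<dots> = (\<Sum>c<2 * n. mip n m (p c) u * (U * (\<mu> - 1) * mip n m (p c) ?w))"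
    proof (intro sum.cong refl)
      fix c assume "c \<in> {..<2 * n}"
      then have c: "c < 2 * n" by simp
      show "mip n m (p c) u * hpot n m av (p c) ?w = mip n m (p c) u * (U * (\<mu> - 1) * mip n m (p c) ?w)"
      proof (cases "c < 4")
        case True
        then show ?thesis by (simp add: low_part mip_pw[OF c])
      next
        case False
        have "hpot n m av (p (c - 4 + 4)) ?w = U * (app k Rf y (c - 4) - y (c - 4))"
          by (rule hpot_p_high) (use False c in auto)
        then have "hpot n m av (p c) ?w = U * (\<mu> - 1) * y (c - 4)"
          using False c eig[of "c - 4"] by (simp add: algebra_simps)
        then show ?thesis using False by (simp add: mip_pw[OF c])
      qed
    qed
    also have "\<dots> = U * (\<mu> - 1) * (\<Sum>c<2 * n. mip n m (p c) u * mip n m ?w (p c))"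
      unfolding sum_distrib_left by (intro sum.cong refl) (subst mip_commute[of n m ?w], simp only: mult_ac)
    also have "(\<Sum>c<2 * n. mip n m (p c) u * mip n m ?w (p c))
        = mip n m ?w (\<lambda>i. \<Sum>c<2 * n. mip n m (p c) u * p c i)"
      by (rule mip_sum_right[symmetric]) simp
    also have "\<dots> = mip n m ?w u"
      by (rule mip_cong) (auto intro: frame_expand[symmetric])
    finally show ?thesis by (simp add: mip_commute[of n m u])
  qed
  have "mip n m ?w ?w = 1"
  proof -
    have "mip n m ?w ?w = (\<Sum>d<k. y d * mip n m ?w (p (d + 4)))" by (rule mip_sum_right) simp
    also have "\<dots> = ip k y y" unfolding ip_def by (intro sum.cong) (auto simp: mip_commute[of n m ?w] mip_pw)
    finally show ?thesis using one by simp
  qed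
  then have mvv: "mip n m (($) v) (($) v) = 1"
    using mip_cong[of n "($) v" ?w "($) v" ?w m] vi by simp
  have H: "hessian (potential n m) a \<in> carrier_mat (2 * n) (2 * n)"
    using a_carrier by (simp add: hessian_def)
  have RH: "restricted_hessian n m a \<in> carrier_mat (2 * n) (2 * n)"
    unfolding restricted_hessian_def using H
    by (intro add_carrier_mat smult_carrier_mat one_carrier_mat)
  have "restricted_hessian n m a *\<^sub>v v = (U * \<mu>) \<cdot>\<^sub>v v"
  proof
    show "dim_vec (restricted_hessian n m a *\<^sub>v v) = dim_vec ((U * \<mu>) \<cdot>\<^sub>v v)"
      using RH v by auto
    fix i assume "i < dim_vec ((U * \<mu>) \<cdot>\<^sub>v v)"
    then have i: "i < 2 * n" using v by auto
    have "(restricted_hessian n m a *\<^sub>v v) $ i = (inv_mass_mat n m *\<^sub>v (hessian (potential n m)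
        a *\<^sub>v v)) $ i + U * v $ i"
    proof -
      have "restricted_hessian n m a *\<^sub>v v = inv_mass_mat n m * hessian (potential n m) a *\<^sub>v v
          + U \<cdot>\<^sub>m 1\<^sub>m (2 * n) *\<^sub>v v"
        unfolding restricted_hessian_def
        by (rule add_mult_distrib_mat_vec[OF _ _ v]) (use H in \<open>auto intro!: mult_carrier_mat[OF
            inv_mass_mat_carrier]\<close>)
      also have "inv_mass_mat n m * hessian (potential n m) a *\<^sub>v v = inv_mass_mat n m *\<^sub>v (hessian
          (potential n m) a *\<^sub>v v)"
        by (rule assoc_mult_mat_vec[OF inv_mass_mat_carrier H v])
      also have "U \<cdot>\<^sub>m 1\<^sub>m (2 * n) *\<^sub>v v = U \<cdot>\<^sub>v v" using v by auto
      finally show ?thesis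
        using i v carrier_matD[OF inv_mass_mat_carrier[of n m]] by simp
    qed
    also have "(inv_mass_mat n m *\<^sub>v (hessian (potential n m) a *\<^sub>v v)) $ i
        = (hessian (potential n m) a *\<^sub>v v) $ i / m (i div 2)"
      by (rule inv_mass_mat_vec) (use H v i in auto)
    also have "(hessian (potential n m) a *\<^sub>v v) $ i = (\<Sum>l<2 * n. hessian (potential n m)
        a $$ (i, l) * v $ l)"
      by (rule mult_mat_vec_entry[OF H v i])
    also have "\<dots> = (\<Sum>l<2 * n. ?w l * hpot n m av (unitf i) (unitf l))"
      using i by (intro sum.cong) (auto simp: hessian_potential[OF a_carrier a_free] vi)
    also have "\<dots> = hpot n m av (unitf i) ?w" by (rule hpot_expand_right[symmetric])
    \<comment> \<open>Unit vectors turn the weak form into coordinates; the summand \<open>U\<close>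
      of the restricted Hessian then raises \<open>\<mu> - 1\<close> to
      \<open>\<mu>\<close>.\<close>
    also have "\<dots> = U * (\<mu> - 1) * mip n m (unitf i) ?w" by (rule key)
    also have "mip n m (unitf i) ?w = m (i div 2) * ?w i"
    proof -
      have "mip n m (unitf i) ?w = (\<Sum>l<2 * n. if l = i then m (l div 2) * ?w l else 0)"
        unfolding mip_def by (intro sum.cong) auto
      then show ?thesis using i by simp
    qed
    also have "U * (\<mu> - 1) * (m (i div 2) * ?w i) / m (i div 2) + U * v $ i = U * \<mu> * v $ i"
    proof -
      have "U * (\<mu> - 1) * (M * w) / M + U * w = U * \<mu> * w" if "0 < M" for M w
        using that by (simp add: field_simps)
      from this[OF mass_div_pos[OF i]] show ?thesis unfolding vi[OF i] .
    qed
    finally show "(restricted_hessian n m a *\<^sub>v v) $ i = ((U * \<mu>) \<cdot>\<^sub>v v) $ i"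
      using i v by simp
  qed
  moreover have "v \<noteq> 0\<^sub>v (2 * n)" using mvv by (auto simp: mip_def)
  ultimately have "eigenvector (restricted_hessian n m a) v (U * \<mu>)"
    using RH v by (auto simp: eigenvector_def)
  moreover have "v \<in> tangent_space n m a" by (rule tangent_orth(1)[OF v vi])
  moreover have "\<nexists>c. v = c \<cdot>\<^sub>v (JJmat n *\<^sub>v a)"
  proof
    assume "\<exists>c. v = c \<cdot>\<^sub>v (JJmat n *\<^sub>v a)"
    then obtain c where c: "v = c \<cdot>\<^sub>v (JJmat n *\<^sub>v a)" ..
    have "mip n m (($) v) (($) v) = mip n m (\<lambda>i. c * jj av i) (($) v)"
    proof (rule mip_cong)
      fix i assume i: "i < 2 * n"
      have "v $ i = c * (JJmat n *\<^sub>v a) $ i"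
        unfolding c using i by (intro index_smult_vec(1)) (simp only: carrier_vecD[OF JJ_a_carrier])
      then show "v $ i = c * jj av i" unfolding JJmat_vec[OF a_carrier i] .
    qed simp
    also have "\<dots> = 0" using tangent_orth(2)[OF v vi] by (simp add: mip_scale_left)
    finally show False using mvv by simp
  qed
  ultimately have "0 < U * \<mu>" using min unfolding nondegenerate_minimizer_def by blast
  then have "0 < \<mu>" using potential_pos by (simp add: zero_less_mult_iff)
  then have "coercive k Rf \<mu>" using low even_k by unfold_locales auto
  then show ?thesis ..
qed

end

section \<open>The Kepler motion\<close>

lemma cact_add: "cact (w + z) y i = cact w y i + cact z y i"
  by (simp add: cact_def algebra_simps)

lemma cact_of_real: "cact (of_real r * w) y i = r * cact w y i"
  by (simp add: cact_def algebra_simps)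

lemma rotation_mat_vec:
  assumes "v \<in> carrier_vec (2 * n)" "i < 2 * n"
  shows "(rotation_mat n \<phi> *\<^sub>v v) $ i = cact (cis \<phi>) (($) v) i"
proof -
  have JJ: "JJmat n \<in> carrier_mat (2 * n) (2 * n)" by simp
  then have R: "rotation_mat n \<phi> \<in> carrier_mat (2 * n) (2 * n)"
    unfolding rotation_mat_def by (intro add_carrier_mat smult_carrier_mat)
  have "(rotation_mat n \<phi> *\<^sub>v v) $ i = (\<Sum>l<2 * n. rotation_mat n \<phi> $$ (i, l) * v $ l)"
    by (rule mult_mat_vec_entry[OF R assms])
  also have "\<dots> = (\<Sum>l<2 * n. (if l = i then cos \<phi> * v $ l else 0) + sin \<phi> * (JJmat n $$ (i, l) * v $ l))"
    using assms carrier_matD[OF JJ] by (intro sum.cong) (auto simp: rotation_mat_def algebra_simps)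
  also have "\<dots> = cos \<phi> * v $ i + sin \<phi> * (JJmat n *\<^sub>v v) $ i"
    using assms unfolding mult_mat_vec_entry[OF JJ assms] by (simp add: sum.distrib sum_distrib_left)
  finally show ?thesis
    using assms by (simp add: JJmat_vec cact_def)
qed

text \<open>Polar equation of a Kepler conic with semi-latus rectum \<open>l\<close>, true anomaly
  \<open>s\<close> and argument of pericenter \<open>\<omega>\<close>.\<close>

definition kepler_pos :: "real \<Rightarrow> real \<Rightarrow> real \<Rightarrow> real \<Rightarrow> complex" where
  "kepler_pos l e \<omega> s = of_real (l / (1 + e * cos s)) * cis (\<omega> + s)"

lemma one_plus_e_cos_pos:
  fixes e :: real
  assumes "0 \<le> e" "e < 1"
  shows "0 < 1 + e * cos s"
proof -
  have "e * (- 1) \<le> e * cos s" using assms by (intro mult_left_mono) auto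
  with assms show ?thesis by linarith
qed

context cc_frame
begin

lemma mip_aa: "mip n m av av = 1"
proof -
  have "mip n m av av = moment_of_inertia n m a"
    unfolding mip_def sum_lessThan_pairs moment_of_inertia_def body_def
    by (intro sum.cong refl) (simp add: cmod_power2, simp add: power2_eq_square algebra_simps)
  then show ?thesis using a_inertia by simp
qed

lemma mip_a_jja: "mip n m av (jj av) = 0"
  using mip_jj_right[of n m av av] mip_commute[of n m av "jj av"] by linarith

lemma mip_jja_jja: "mip n m (jj av) (jj av) = 1"
proof -
  have "mip n m (jj av) (jj av) = - mip n m (jj (jj av)) av"
    using mip_jj_right[of n m "jj av" av] by simp
  also have "jj (jj av) = (\<lambda>i. (- 1) * av i)" by (simp add: fun_eq_iff jj_jj)
  finally show ?thesis by (simp only: mip_scale_left mip_aa)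
qed

text \<open>Since \<open>z a = w ((z / w) a)\<close>, equivariance moves the base point to
  \<open>a\<close>, where Euler's identity and rotation invariance evaluate the
  differential.\<close>

lemma dpot_cact_a:
  assumes "w \<noteq> 0"
  shows "dpot n m (cact w av) (cact z av) = - U * Re (z * cnj w) / norm w ^ 3"
proof -
  have "cact z av = cact w (cact (z / w) av)"
    using assms by (simp add: fun_eq_iff cact_cact)
  then have "dpot n m (cact w av) (cact z av) = dpot n m av (cact (z / w) av) / norm w"
    using assms by (simp add: dpot_cact)
  also have "dpot n m av (cact (z / w) av) = - U * Re (z / w)"
    unfolding cact_def dpot_add dpot_scale by (simp add: dpot_self dpot_jj)
  also have "z / w = z * cnj w / of_real ((norm w)\<^sup>2)"
    by (simp add: complex_div_cnj[of z w])
  also have "Re (z * cnj w / of_real ((norm w)\<^sup>2)) = Re (z * cnj w) / (norm w)\<^sup>2"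
    by (rule Re_divide_of_real)
  finally show ?thesis by (simp add: power2_eq_square power3_eq_cube)
qed

text \<open>Newton's equation for a homographic motion \<open>x = w a\<close>, paired with \<open>a\<close> and \<open>i a\<close>, is the
  Kepler equation for the complex scalar \<open>w\<close>.\<close>

lemma kepler_equation:
  assumes x: "n_body_motion n m x"
    and xw: "\<And>t i. i < 2 * n \<Longrightarrow> x t $ i = cact (w t) av i" and w: "\<And>t. w t \<noteq> 0"
  shows "\<exists>A B. \<forall>t. ((\<lambda>t. Re (w t)) has_real_derivative A t) (at t) \<and>
    ((\<lambda>t. Im (w t)) has_real_derivative B t) (at t) \<and>
    (A has_real_derivative - U * Re (w t) / norm (w t) ^ 3) (at t) \<and>
    (B has_real_derivative - U * Im (w t) / norm (w t) ^ 3) (at t)"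
proof -
  obtain q where x_carrier: "\<And>t. x t \<in> carrier_vec (2 * n)" and x_free: "\<And>t. collision_free n (x t)"
    and q: "\<And>t. q t \<in> carrier_vec (2 * n)"
    and dx: "\<And>t i. i < 2 * n \<Longrightarrow> ((\<lambda>s. x s $ i) has_real_derivative (inv_mass_mat n m *\<^sub>v q t) $ i) (at t)"
    and dq: "\<And>t i. i < 2 * n \<Longrightarrow> ((\<lambda>s. q s $ i) has_real_derivative gradient (potential n m) (x t)
        $ i) (at t)"
    using x unfolding n_body_motion_def by blast
  have dpot_x: "dpot n m (($) (x t)) v = dpot n m (cact (w t) av) v" for t v
    by (rule dpot_cong) (use xw in auto)
  \<comment> \<open>\<open>v\<close> is a constant test vector; below it is \<open>a\<close> or
    \<open>jj a\<close>, which pick out the real and the imaginary part of \<open>w\<close>.\<close>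
  have pair: "((\<lambda>t. mip n m v (($) (x t))) has_real_derivative (\<Sum>i<2 * n. v i * q t $ i)) (at t)"
    "((\<lambda>t. \<Sum>i<2 * n. v i * q t $ i) has_real_derivative dpot n m (cact (w t) av) v) (at t)" for v t
  proof -
    have "((\<lambda>t. mip n m v (($) (x t))) has_real_derivative
        (\<Sum>i<2 * n. m (i div 2) * v i * (inv_mass_mat n m *\<^sub>v q t) $ i)) (at t)"
      unfolding mip_def by (intro DERIV_sum DERIV_cmult dx) auto
    also have "(\<Sum>i<2 * n. m (i div 2) * v i * (inv_mass_mat n m *\<^sub>v q t) $ i) = (\<Sum>i<2 * n. v i * q t $ i)"
    proof (intro sum.cong refl)
      fix i assume "i \<in> {..<2 * n}"
      then have i: "i < 2 * n" by simp
      show "m (i div 2) * v i * (inv_mass_mat n m *\<^sub>v q t) $ i = v i * q t $ i"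
        using mass_div_pos[OF i] by (simp add: inv_mass_mat_vec[OF q i])
    qed
    finally show "((\<lambda>t. mip n m v (($) (x t))) has_real_derivative (\<Sum>i<2 * n. v i * q t $ i)) (at t)" .
    have "((\<lambda>t. \<Sum>i<2 * n. v i * q t $ i) has_real_derivative
        (\<Sum>i<2 * n. v i * gradient (potential n m) (x t) $ i)) (at t)"
      by (intro DERIV_sum DERIV_cmult dq) auto
    also have "(\<Sum>i<2 * n. v i * gradient (potential n m) (x t) $ i) = dpot n m (($) (x t)) v"
      by (subst dpot_expand) (simp add: gradient_potential[OF x_carrier x_free])
    finally show "((\<lambda>t. \<Sum>i<2 * n. v i * q t $ i) has_real_derivative dpot n m (cact (w t) av) v) (at t)"
      unfolding dpot_x .
  qed
  have xc: "mip n m v (($) (x t)) = Re (w t) * mip n m v av + Im (w t) * mip n m v (jj av)" for v t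
  proof -
    have "mip n m v (($) (x t)) = mip n m v (\<lambda>i. Re (w t) * av i + Im (w t) * jj av i)"
      by (rule mip_cong) (use xw in \<open>auto simp: cact_def\<close>)
    then show ?thesis by (simp add: mip_add_right mip_scale_right)
  qed
  have re: "mip n m av (($) (x t)) = Re (w t)" for t
    by (simp add: xc mip_aa mip_a_jja)
  have im: "mip n m (jj av) (($) (x t)) = Im (w t)" for t
    by (simp add: xc mip_jja_jja mip_commute[of n m "jj av" av] mip_a_jja)
  have dre: "dpot n m (cact (w t) av) av = - U * Re (w t) / norm (w t) ^ 3" for t
    using dpot_cact_a[OF w, of t 1] by simp
  have dim: "dpot n m (cact (w t) av) (jj av) = - U * Im (w t) / norm (w t) ^ 3" for t
    using dpot_cact_a[OF w, of t \<i>] by (simp add: cact_ii)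
  show ?thesis
    using pair[of av] pair[of "jj av"] unfolding re im dre dim
    by (intro exI[of _ "\<lambda>t. \<Sum>i<2 * n. av i * q t $ i"] exI[of _ "\<lambda>t. \<Sum>i<2 * n. jj av i * q t $ i"]) blast
qed

text \<open>The definition prescribes the orbit but not the law of \<open>\<theta>\<close>. Newton's
  equation supplies it: the conserved angular momentum \<open>h\<close> gives the derivative of
  \<open>\<theta>\<close>, and the acceleration fixes \<open>h^2 = U * l\<close>.\<close>

lemma ERE_kepler:
  assumes ERE: "elliptic_relative_equilibrium n m a e T x"
  shows "\<exists>l \<omega> \<theta> h. 0 < l \<and> 0 < h \<and> h\<^sup>2 = U * l \<and>
    (\<forall>t. (\<theta> has_real_derivative h * (1 + e * cos (\<theta> t))\<^sup>2 / l\<^sup>2) (at t)) \<and>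
    (\<forall>t. \<theta> (t + T) = \<theta> t + 2 * pi) \<and> (\<forall>t. x (t + T) = x t) \<and>
    (\<forall>t. \<forall>i<2 * n. x t $ i = cact (kepler_pos l e \<omega> (\<theta> t)) av i)"
proof -
  obtain l \<omega> \<theta> where e: "0 \<le> e" "e < 1" and T: "0 < T" and motion: "n_body_motion n m x" and l: "0 < l"
    and diff: "\<And>t. \<theta> differentiable (at t)" and per: "\<And>t. \<theta> (t + T) = \<theta> t + 2 * pi"
    and xt: "\<And>t. x t = (l / (1 + e * cos (\<theta> t))) \<cdot>\<^sub>v (rotation_mat n (\<omega> + \<theta> t) *\<^sub>v a)"
    using ERE unfolding elliptic_relative_equilibrium_def by blast
  define w where "w t = kepler_pos l e \<omega> (\<theta> t)" for t
  define r where "r t = l / (1 + e * cos (\<theta> t))" for t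
  note pos = one_plus_e_cos_pos[OF e]
  have r: "0 < r t" for t using pos[of "\<theta> t"] l by (simp add: r_def)
  have re_w: "Re (w t) = r t * cos (\<omega> + \<theta> t)" and im_w: "Im (w t) = r t * sin (\<omega> + \<theta> t)" for t
    by (simp_all add: w_def kepler_pos_def r_def)
  have norm_w: "norm (w t) = r t" for t
    using r[of t] by (simp add: w_def kepler_pos_def norm_mult abs_of_pos flip: r_def)
  have w0: "w t \<noteq> 0" for t using norm_w[of t] r[of t] by auto
  have rot_dim: "dim_vec (rotation_mat n \<phi> *\<^sub>v a) = 2 * n" for \<phi>
    using carrier_matD[OF JJmat_carrier[of n]] by (simp add: rotation_mat_def)
  have xw: "x t $ i = cact (w t) av i" if "i < 2 * n" for t i
  proof -
    have "x t $ i = r t * (rotation_mat n (\<omega> + \<theta> t) *\<^sub>v a) $ i"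
      unfolding xt r_def by (rule index_smult_vec(1)) (use that rot_dim in simp)
    then show ?thesis
      unfolding rotation_mat_vec[OF a_carrier that] w_def kepler_pos_def r_def cact_of_real .
  qed
  obtain A B where dR: "\<And>t. ((\<lambda>t. Re (w t)) has_real_derivative A t) (at t)"
    and dI: "\<And>t. ((\<lambda>t. Im (w t)) has_real_derivative B t) (at t)"
    and dA: "\<And>t. (A has_real_derivative - U * Re (w t) / norm (w t) ^ 3) (at t)"
    and dB: "\<And>t. (B has_real_derivative - U * Im (w t) / norm (w t) ^ 3) (at t)"
    using kepler_equation[OF motion xw w0] by blast
  obtain \<theta>' where d\<theta>: "\<And>t. (\<theta> has_real_derivative \<theta>' t) (at t)"
    using diff unfolding real_differentiable_def by metis
  define c where "c t = 1 + e * cos (\<theta> t)" for t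
  have c0: "c t \<noteq> 0" for t using pos[of "\<theta> t"] by (simp add: c_def)
  have dr: "(r has_real_derivative l * e * sin (\<theta> t) * \<theta>' t / (c t)\<^sup>2) (at t)" for t
    unfolding r_def[abs_def] c_def[symmetric]
    by (rule derivative_eq_intros refl d\<theta> | use c0[of t] in \<open>simp add: c_def power2_eq_square\<close>)+
  have A: "A t = l * e * sin (\<theta> t) * \<theta>' t / (c t)\<^sup>2 * cos (\<omega> + \<theta> t) - r t * sin (\<omega> + \<theta> t) * \<theta>' t" for t
  proof (rule DERIV_unique[OF dR])
    show "((\<lambda>t. Re (w t)) has_real_derivative
        l * e * sin (\<theta> t) * \<theta>' t / (c t)\<^sup>2 * cos (\<omega> + \<theta> t) - r t * sin (\<omega> + \<theta> t) * \<theta>' t) (at t)"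
      unfolding re_w by (auto intro!: derivative_eq_intros dr d\<theta>)
  qed
  have B: "B t = l * e * sin (\<theta> t) * \<theta>' t / (c t)\<^sup>2 * sin (\<omega> + \<theta> t) + r t * cos (\<omega> + \<theta> t) * \<theta>' t" for t
  proof (rule DERIV_unique[OF dI])
    show "((\<lambda>t. Im (w t)) has_real_derivative
        l * e * sin (\<theta> t) * \<theta>' t / (c t)\<^sup>2 * sin (\<omega> + \<theta> t) + r t * cos (\<omega> + \<theta> t) * \<theta>' t) (at t)"
      unfolding im_w by (auto intro!: derivative_eq_intros dr d\<theta>)
  qed
  \<comment> \<open>Angular momentum; its derivative vanishes because the force is central.\<close>
  define h where "h t = Re (w t) * B t - Im (w t) * A t" for t
  have "(h has_real_derivative 0) (at t)" for t
    unfolding h_def[abs_def]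
    by (rule DERIV_cong[OF DERIV_diff[OF DERIV_mult[OF dR dB] DERIV_mult[OF dI dA]]])
       (simp add: mult_ac)
  then have h_const: "h t = h 0" for t by (meson DERIV_isconst_all)
  have h_r: "h t = (r t)\<^sup>2 * \<theta>' t" for t
  proof -
    have "(R * C) * (X * S + R * C * Y) - (R * S) * (X * C - R * S * Y) = R\<^sup>2 * Y * (C\<^sup>2 + S\<^sup>2)"
      for R C X S Y :: real
      by (simp add: power2_eq_square algebra_simps)
    from this[of "r t" "cos (\<omega> + \<theta> t)" "l * e * sin (\<theta> t) * \<theta>' t / (c t)\<^sup>2" "sin (\<omega> + \<theta> t)" "\<theta>' t"]
    show ?thesis unfolding h_def A B re_w im_w by simp
  qed
  define H where "H = h 0"
  have \<theta>'_eq: "\<theta>' t = H * (c t)\<^sup>2 / l\<^sup>2" for t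
    using h_r[of t] h_const[of t] r[of t] l c0[of t] unfolding H_def r_def c_def[symmetric]
    by (simp add: field_simps)
  \<comment> \<open>Over one period \<open>\<theta>\<close> gains \<open>2 * pi\<close>, so by the
    mean value theorem its derivative is positive somewhere; this fixes the sign of
    \<open>H\<close>.\<close>
  have "\<exists>z. 0 < z \<and> z < T \<and> \<theta> T - \<theta> 0 = (T - 0) * \<theta>' z"
    by (rule MVT2[OF T]) (rule d\<theta>)
  then obtain z where z: "\<theta> T - \<theta> 0 = T * \<theta>' z" by auto
  have "T * \<theta>' z = 2 * pi" using z per[of 0] by simp
  then have "0 < T * \<theta>' z" by simp
  then have "0 < \<theta>' z" using T by (simp add: zero_less_mult_iff)
  then have H: "0 < H" using l by (simp add: \<theta>'_eq zero_less_mult_iff zero_less_divide_iff)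
  \<comment> \<open>The velocity runs on a circle, the hodograph. In this form it can be
    differentiated again using only the first derivative of \<open>\<theta>\<close>.\<close>
  have A2: "A t = - (H / l) * (sin (\<omega> + \<theta> t) + e * sin \<omega>)" for t
  proof -
    have "A t = (H / l) * (e * sin (\<theta> t) * cos (\<omega> + \<theta> t) - c t * sin (\<omega> + \<theta> t))"
      using c0[of t] l unfolding A \<theta>'_eq r_def c_def[symmetric] by (simp add: field_simps power2_eq_square)
    also have "e * sin (\<theta> t) * cos (\<omega> + \<theta> t) - c t * sin (\<omega> + \<theta> t) = - (sin (\<omega> + \<theta> t)
        + e * (sin (\<omega> + \<theta> t) * cos (\<theta> t) - cos (\<omega> + \<theta> t) * sin (\<theta> t)))"
      by (simp add: c_def algebra_simps)
    also have "sin (\<omega> + \<theta> t) * cos (\<theta> t) - cos (\<omega> + \<theta> t) * sin (\<theta> t) = sin \<omega>"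
      by (simp flip: sin_diff)
    finally show ?thesis by (simp only: mult_minus_left mult_minus_right)
  qed
  have B2: "B t = (H / l) * (cos (\<omega> + \<theta> t) + e * cos \<omega>)" for t
  proof -
    have "B t = (H / l) * (e * sin (\<theta> t) * sin (\<omega> + \<theta> t) + c t * cos (\<omega> + \<theta> t))"
      using c0[of t] l unfolding B \<theta>'_eq r_def c_def[symmetric] by (simp add: field_simps power2_eq_square)
    also have "e * sin (\<theta> t) * sin (\<omega> + \<theta> t) + c t * cos (\<omega> + \<theta> t) = cos (\<omega> + \<theta> t)
        + e * (cos (\<omega> + \<theta> t) * cos (\<theta> t) + sin (\<omega> + \<theta> t) * sin (\<theta> t))"
      by (simp add: c_def algebra_simps)
    also have "cos (\<omega> + \<theta> t) * cos (\<theta> t) + sin (\<omega> + \<theta> t) * sin (\<theta> t) = cos \<omega>"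
      by (simp flip: cos_diff)
    finally show ?thesis by simp
  qed
  have A3: "U * cos (\<omega> + \<theta> 0) = H\<^sup>2 / l * cos (\<omega> + \<theta> 0)"
  proof -
    have "(A has_real_derivative - (H / l) * (cos (\<omega> + \<theta> 0) * \<theta>' 0)) (at 0)"
      unfolding A2[abs_def] using l by (auto intro!: derivative_eq_intros d\<theta>)
    from DERIV_unique[OF dA this] have "U * cos (\<omega> + \<theta> 0) / (r 0)\<^sup>2 = (H / l) * (cos (\<omega> + \<theta> 0) * \<theta>' 0)"
      using r[of 0] unfolding norm_w re_w by (simp add: power3_eq_cube power2_eq_square)
    then have "U * cos (\<omega> + \<theta> 0) = (H / l) * (cos (\<omega> + \<theta> 0) * ((r 0)\<^sup>2 * \<theta>' 0))"
      using r[of 0] by (simp add: field_simps)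
    then show ?thesis using h_r[of 0] by (simp add: H_def power2_eq_square)
  qed
  have B3: "U * sin (\<omega> + \<theta> 0) = H\<^sup>2 / l * sin (\<omega> + \<theta> 0)"
  proof -
    have "(B has_real_derivative (H / l) * (- sin (\<omega> + \<theta> 0) * \<theta>' 0)) (at 0)"
      unfolding B2[abs_def] using l by (auto intro!: derivative_eq_intros d\<theta>)
    from DERIV_unique[OF dB this] have "U * sin (\<omega> + \<theta> 0) / (r 0)\<^sup>2 = (H / l) * (sin (\<omega> + \<theta> 0) * \<theta>' 0)"
      using r[of 0] unfolding norm_w im_w by (simp add: power3_eq_cube power2_eq_square)
    then have "U * sin (\<omega> + \<theta> 0) = (H / l) * (sin (\<omega> + \<theta> 0) * ((r 0)\<^sup>2 * \<theta>' 0))"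
      using r[of 0] by (simp add: field_simps)
    then show ?thesis using h_r[of 0] by (simp add: H_def power2_eq_square)
  qed
  \<comment> \<open>Sine and cosine do not vanish together, so one of the two components determines
    \<open>U\<close>.\<close>
  have "U = H\<^sup>2 / l"
  proof (cases "sin (\<omega> + \<theta> 0) = 0")
    case True
    then have "cos (\<omega> + \<theta> 0) \<noteq> 0" using sin_zero_norm_cos_one by fastforce
    with A3 show ?thesis by (simp only: mult_cancel_right) simp
  next
    case False
    with B3 show ?thesis by (simp only: mult_cancel_right) simp
  qed
  then have "H\<^sup>2 = U * l" using l by simp
  moreover have "x (t + T) = x t" for t
    by (simp add: xt per rotation_mat_def flip: add.assoc)
  moreover have "(\<theta> has_real_derivative H * (1 + e * cos (\<theta> t))\<^sup>2 / l\<^sup>2) (at t)" for t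
    using d\<theta>[of t] by (simp add: \<theta>'_eq c_def)
  ultimately show ?thesis
    using l H per xw unfolding w_def by blast
qed

end

text \<open>The gain of \<open>2 * pi\<close> in each period makes \<open>\<theta>\<close> unbounded
  in both directions, so the intermediate value theorem gives surjectivity and the anomaly can serve
  as time on the whole real axis.\<close>

lemma anomaly_inverse:
  fixes \<theta> \<theta>' :: "real \<Rightarrow> real"
  assumes T: "0 < T" and per: "\<And>t. \<theta> (t + T) = \<theta> t + 2 * pi"
    and d: "\<And>t. (\<theta> has_real_derivative \<theta>' t) (at t)" and pos: "\<And>t. 0 < \<theta>' t"
  shows "\<exists>g. (\<forall>t. g (\<theta> t) = t) \<and> (\<forall>s. \<theta> (g s) = s) \<and> (\<forall>s. (g has_real_derivative inverse (\<theta>' (g s)))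
      (at s))"
proof -
  have mono: "\<theta> s < \<theta> t" if "s < t" for s t
    using DERIV_pos_imp_increasing[OF that, of \<theta>] d pos by blast
  have inj: "inj \<theta>"
    by (rule injI) (metis mono less_irrefl linorder_less_linear)
  have cont: "isCont \<theta> t" for t using d by (rule DERIV_isCont)
  have up: "\<theta> (of_nat j * T) = \<theta> 0 + 2 * pi * of_nat j" and down: "\<theta> (- of_nat j * T)
      = \<theta> 0 - 2 * pi * of_nat j" for j
  proof -
    show "\<theta> (of_nat j * T) = \<theta> 0 + 2 * pi * of_nat j"
    proof (induction j)
      case (Suc j)
      then show ?case using per[of "of_nat j * T"] by (simp add: algebra_simps)
    qed simp
    show "\<theta> (- of_nat j * T) = \<theta> 0 - 2 * pi * of_nat j"
    proof (induction j)
      case (Suc j)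
      then show ?case using per[of "- of_nat (Suc j) * T"] by (simp add: algebra_simps)
    qed simp
  qed
  have surj: "\<exists>t. \<theta> t = s" for s
  proof -
    obtain j :: nat where j: "\<bar>s - \<theta> 0\<bar> / (2 * pi) \<le> of_nat j" using real_arch_simple by blast
    then have j': "\<bar>s - \<theta> 0\<bar> \<le> 2 * pi * of_nat j" by (simp add: pos_divide_le_eq mult_ac)
    have "\<exists>t\<ge>- of_nat j * T. t \<le> of_nat j * T \<and> \<theta> t = s"
      by (rule IVT) (use j' up[of j] down[of j] T cont in auto)
    then show ?thesis by blast
  qed
  define g where "g s = (THE t. \<theta> t = s)" for s
  have g\<theta>: "g (\<theta> t) = t" for t
    unfolding g_def by (rule the_equality) (use inj in \<open>auto dest: injD\<close>)
  have \<theta>g: "\<theta> (g s) = s" for s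
    using surj[of s] g\<theta> by metis
  have "isCont g s" for s
    using isCont_inverse_function[of 1 "g s" g \<theta>] g\<theta> cont \<theta>g by simp
  then have "(g has_real_derivative inverse (\<theta>' (g s))) (at s)" for s
    by (intro DERIV_inverse_function[OF d, where a = "s - 1" and b = "s + 1"]) (use pos[of "g s"]
        \<theta>g in auto)
  with g\<theta> \<theta>g show ?thesis by blast
qed

section \<open>Bounded solutions from unit multipliers\<close>

text \<open>Gronwall from zero data. It extends the eigenvector relation, which compares two
  solutions at time 0, to all times.\<close>

lemma linear_system_unique:
  fixes D :: "real \<Rightarrow> nat \<Rightarrow> real" and A :: "real \<Rightarrow> nat \<Rightarrow> nat \<Rightarrow> real"
  assumes d: "\<And>t i. i < N \<Longrightarrow> ((\<lambda>s. D s i) has_real_derivative app N (A t) (D t) i) (at t)"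
    and bd: "\<And>t i j. i < N \<Longrightarrow> j < N \<Longrightarrow> \<bar>A t i j\<bar> \<le> \<kappa>"
    and z: "\<And>i. i < N \<Longrightarrow> D 0 i = 0" and i: "i < N"
  shows "D t i = 0"
proof -
  define L where "L = 1 + (\<Sum>i<N. \<Sum>j<N. \<kappa>\<^sup>2)"
  have sq: "sqnorm N (A t) \<le> (\<Sum>i<N. \<Sum>j<N. \<kappa>\<^sup>2)" for t
    unfolding sqnorm_def
  proof (intro sum_mono)
    fix i j assume "i \<in> {..<N}" "j \<in> {..<N}"
    then have "\<bar>A t i j\<bar> \<le> \<bar>\<kappa>\<bar>" using bd[of i j t] by simp
    then show "(A t i j)\<^sup>2 \<le> \<kappa>\<^sup>2" by (simp add: abs_le_square_iff)
  qed
  have "ip N (D t) (D t) \<le> ip N (D 0) (D 0) * exp (L * \<bar>t\<bar>)"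
  proof (rule gronwall[where b = "\<bar>t\<bar>"])
    fix s
    show "((\<lambda>t. ip N (D t) (D t)) has_real_derivative 2 * ip N (D s) (app N (A s) (D s))) (at s)"
      by (rule DERIV_ip_self) (rule d)
    have "2 * \<bar>ip N (D s) (app N (A s) (D s))\<bar> \<le> ip N (D s) (D s) + sqnorm N (A s) * ip N (D s) (D s)"
      using two_ip_le[of N "D s" "app N (A s) (D s)"] app_bound[of N "A s" "D s"] by linarith
    also have "\<dots> \<le> L * ip N (D s) (D s)"
      using mult_right_mono[OF sq[of s] ip_nonneg[of N "D s"]] by (simp add: L_def distrib_right)
    finally show "\<bar>2 * ip N (D s) (app N (A s) (D s))\<bar> \<le> L * ip N (D s) (D s)" by simp
  qed simp
  also have "ip N (D 0) (D 0) = 0" using z by (simp add: ip_eq_0_iff)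
  finally have "ip N (D t) (D t) = 0" using ip_nonneg[of N "D t"] by simp
  then show ?thesis using i by (simp add: ip_eq_0_iff)
qed

lemma periodic_bounded:
  fixes f :: "real \<Rightarrow> real"
  assumes cont: "\<And>t. isCont f t" and per: "\<And>t. f (t + T) = f t" and T: "0 < T"
  shows "\<exists>B. \<forall>t. f t \<le> B"
proof -
  have "continuous_on {0..T} f" by (intro continuous_at_imp_continuous_on ballI cont)
  then obtain M where M: "\<And>t. t \<in> {0..T} \<Longrightarrow> f t \<le> M"
    using continuous_attains_sup[of "{0..T}" f] T by force
  have nat_per: "f (t + of_nat j * T) = f t" for t j
  proof (induction j)
    case (Suc j)
    then show ?case using per[of "t + of_nat j * T"] by (simp add: algebra_simps)
  qed simp
  have "f t \<le> M" for t
  proof -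
    define j where "j = \<lfloor>t / T\<rfloor>"
    have "of_int j \<le> t / T" "t / T < of_int j + 1" unfolding j_def by linarith+
    then have in_T: "t - of_int j * T \<in> {0..T}"
      using T by (simp add: pos_le_divide_eq pos_divide_less_eq algebra_simps)
    have "f t = f (t - of_int j * T)"
    proof (cases "0 \<le> j")
      case True
      then show ?thesis using nat_per[of "t - of_int j * T" "nat j"] by simp
    next
      case False
      then have "of_nat (nat (- j)) = - (of_int j :: real)" by simp
      then show ?thesis using nat_per[of t "nat (- j)"] by simp
    qed
    then show ?thesis using M[OF in_T] by simp
  qed
  then show ?thesis by blast
qed

lemma fundamental_solution_apply:
  assumes fs: "fundamental_solution N A \<Gamma>" and A: "A t \<in> carrier_mat N N" and i: "i < N"
  shows "((\<lambda>s. \<Sum>j<N. \<Gamma> s $$ (i, j) * u j) has_real_derivative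
    app N (\<lambda>i j. A t $$ (i, j)) (\<lambda>i. \<Sum>j<N. \<Gamma> t $$ (i, j) * u j) i) (at t)"
proof -
  have \<Gamma>: "\<And>t. \<Gamma> t \<in> carrier_mat N N"
    and d\<Gamma>: "\<And>j. j < N \<Longrightarrow> ((\<lambda>s. \<Gamma> s $$ (i, j)) has_real_derivative (A t * \<Gamma> t) $$ (i, j)) (at t)"
    using fs i unfolding fundamental_solution_def by blast+
  have "((\<lambda>s. \<Sum>j<N. \<Gamma> s $$ (i, j) * u j) has_real_derivative (\<Sum>j<N. (A t * \<Gamma> t) $$ (i, j) * u j)) (at t)"
    by (intro DERIV_sum DERIV_cmult_right d\<Gamma>) auto
  also have "(\<Sum>j<N. (A t * \<Gamma> t) $$ (i, j) * u j) = (\<Sum>j<N. \<Sum>l<N. A t $$ (i, l) * (\<Gamma> t $$ (l, j) * u j))"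
    using mult_mat_entry[OF A \<Gamma> i] by (intro sum.cong) (auto simp: sum_distrib_right mult.assoc)
  also have "\<dots> = app N (\<lambda>i j. A t $$ (i, j)) (\<lambda>i. \<Sum>j<N. \<Gamma> t $$ (i, j) * u j) i"
    by (subst sum.swap) (simp add: app_def sum_distrib_left)
  finally show ?thesis .
qed

lemma fundamental_solution_0:
  assumes "fundamental_solution N A \<Gamma>" "i < N"
  shows "(\<Sum>j<N. \<Gamma> 0 $$ (i, j) * u j) = u i"
proof -
  have "(\<Sum>j<N. \<Gamma> 0 $$ (i, j) * u j) = (\<Sum>j<N. if j = i then u j else 0)"
    using assms by (intro sum.cong) (auto simp: fundamental_solution_def)
  then show ?thesis using assms by simp
qed

text \<open>Floquet: a complex multiplier of modulus one makes the complex solution through the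
  eigenvector quasi-periodic, so that its real and imaginary parts are bounded.\<close>

lemma unit_multiplier_bounded:
  assumes fs: "fundamental_solution N A \<Gamma>"
    and A: "\<And>t. A t \<in> carrier_mat N N" and per: "\<And>t. A (t + T) = A t" and T: "0 < T"
    and bd: "\<And>t i j. i < N \<Longrightarrow> j < N \<Longrightarrow> \<bar>A t $$ (i, j)\<bar> \<le> \<kappa>"
    and ev: "eigenvector (map_mat complex_of_real (\<Gamma> T)) v \<mu>" and \<mu>: "cmod \<mu> = 1"
    and r: "r = map_vec Re v \<or> r = map_vec Im v"
  shows "\<exists>B. \<forall>t. \<forall>i<N. \<bar>\<Sum>j<N. \<Gamma> t $$ (i, j) * r $ j\<bar> \<le> B"
proof -
  have \<Gamma>: "\<And>t. \<Gamma> t \<in> carrier_mat N N"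
    using fs unfolding fundamental_solution_def by blast
  define y where "y u t i = (\<Sum>j<N. \<Gamma> t $$ (i, j) * u j)" for u t i
  define Af where "Af t i j = A t $$ (i, j)" for t i j
  have dy: "((\<lambda>s. y u s i) has_real_derivative app N (Af t) (y u t) i) (at t)" if "i < N" for u t i
    unfolding y_def[abs_def] Af_def[abs_def] by (rule fundamental_solution_apply[OF fs A that])
  have y0: "y u 0 i = u i" if "i < N" for u i
    unfolding y_def by (rule fundamental_solution_0[OF fs that])
  have dimv: "dim_vec v = N" and Gv: "map_mat complex_of_real (\<Gamma> T) *\<^sub>v v = \<mu> \<cdot>\<^sub>v v"
    using ev \<Gamma>[of T] unfolding eigenvector_def by auto
  define vr where "vr j = Re (v $ j)" for j
  define vi where "vi j = Im (v $ j)" for j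
  have eig: "(\<Sum>j<N. of_real (\<Gamma> T $$ (i, j)) * v $ j) = \<mu> * v $ i" if i: "i < N" for i
  proof -
    have "(map_mat complex_of_real (\<Gamma> T) *\<^sub>v v) $ i = (\<Sum>j<N. map_mat complex_of_real (\<Gamma> T) $$ (i, j)
        * v $ j)"
      by (rule mult_mat_vec_entry) (use \<Gamma>[of T] dimv i in auto)
    also have "\<dots> = (\<Sum>j<N. of_real (\<Gamma> T $$ (i, j)) * v $ j)"
      using \<Gamma>[of T] i by (intro sum.cong) auto
    finally show ?thesis using i dimv by (simp add: Gv)
  qed
  have yT: "y vr T i = Re \<mu> * vr i - Im \<mu> * vi i" "y vi T i = Re \<mu> * vi i + Im \<mu> * vr i" if "i < N" for i
    using arg_cong[OF eig[OF that], of Re] arg_cong[OF eig[OF that], of Im]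
    by (simp_all add: y_def vr_def vi_def)
  have dy_shift: "((\<lambda>s. y u (s + T) i) has_real_derivative app N (Af t) (y u (t + T)) i) (at t)"
      if "i < N" for u t i
  proof -
    have "Af (t + T) = Af t" by (simp add: Af_def fun_eq_iff per)
    then show ?thesis using dy[OF that, of u "t + T"] by (simp add: DERIV_shift)
  qed
  \<comment> \<open>Both sides of \<open>y (t + T) = \<mu> y t\<close> solve the same periodic
    system and agree at \<open>t = 0\<close>; this is the real part.\<close>
  have qr: "y vr (t + T) i - (Re \<mu> * y vr t i - Im \<mu> * y vi t i) = 0" if i: "i < N" for t i
  proof (rule linear_system_unique[where D = "\<lambda>t i. y vr (t + T) i - (Re \<mu> * y vr t i
      - Im \<mu> * y vi t i)" and N = N
        and A = Af and \<kappa> = \<kappa>])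
    show "((\<lambda>s. y vr (s + T) i - (Re \<mu> * y vr s i - Im \<mu> * y vi s i)) has_real_derivative
        app N (Af t) (\<lambda>i. y vr (t + T) i - (Re \<mu> * y vr t i - Im \<mu> * y vi t i)) i) (at t)"
            if "i < N" for t i
      unfolding app_diff app_scale using that by (intro derivative_intros DERIV_diff DERIV_cmult dy
          dy_shift)
  qed (use bd yT y0 i in \<open>auto simp: Af_def\<close>)
  have qi: "y vi (t + T) i - (Re \<mu> * y vi t i + Im \<mu> * y vr t i) = 0" if i: "i < N" for t i
  proof (rule linear_system_unique[where D = "\<lambda>t i. y vi (t + T) i - (Re \<mu> * y vi t i
      + Im \<mu> * y vr t i)" and N = N
        and A = Af and \<kappa> = \<kappa>])
    show "((\<lambda>s. y vi (s + T) i - (Re \<mu> * y vi s i + Im \<mu> * y vr s i)) has_real_derivative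
        app N (Af t) (\<lambda>i. y vi (t + T) i - (Re \<mu> * y vi t i + Im \<mu> * y vr t i)) i) (at t)"
            if "i < N" for t i
      unfolding app_diff app_add app_scale using that by (intro DERIV_diff DERIV_add DERIV_cmult dy
          dy_shift)
  qed (use bd yT y0 i in \<open>auto simp: Af_def\<close>)
  \<comment> \<open>The squared length of the complex solution; multiplication by
    \<open>\<mu>\<close> of modulus one preserves it, so it has period \<open>T\<close>.\<close>
  define f where "f t = ip N (y vr t) (y vr t) + ip N (y vi t) (y vi t)" for t
  have "isCont f t" for t
  proof -
    have "isCont (\<lambda>s. y u s i) t" if "i < N" for u i by (rule DERIV_isCont[OF dy[OF that]])
    then show ?thesis unfolding f_def ip_def by (intro continuous_intros) auto
  qed
  moreover have "f (t + T) = f t" for t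
  proof -
    have "(Re \<mu>)\<^sup>2 + (Im \<mu>)\<^sup>2 = 1" using \<mu> by (simp add: cmod_def)
    then have rot: "(Re \<mu> * p - Im \<mu> * q) * (Re \<mu> * p - Im \<mu> * q)
        + (Re \<mu> * q + Im \<mu> * p) * (Re \<mu> * q + Im \<mu> * p)
        = p * p + q * q" for p q
    proof -
      have "(Re \<mu> * p - Im \<mu> * q) * (Re \<mu> * p - Im \<mu> * q) + (Re \<mu> * q + Im \<mu> * p) * (Re \<mu> * q + Im \<mu> * p)
        = ((Re \<mu>)\<^sup>2 + (Im \<mu>)\<^sup>2) * (p * p + q * q)" by (simp add: power2_eq_square algebra_simps)
      then show ?thesis using \<open>(Re \<mu>)\<^sup>2 + (Im \<mu>)\<^sup>2 = 1\<close> by simp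
    qed
    have "f (t + T) = (\<Sum>i<N. y vr (t + T) i * y vr (t + T) i + y vi (t + T) i * y vi (t + T) i)"
      by (simp add: f_def ip_def sum.distrib)
    also have "\<dots> = (\<Sum>i<N. y vr t i * y vr t i + y vi t i * y vi t i)"
    proof (intro sum.cong refl)
      fix i assume "i \<in> {..<N}"
      then have "y vr (t + T) i = Re \<mu> * y vr t i - Im \<mu> * y vi t i" "y vi (t + T) i
          = Re \<mu> * y vi t i + Im \<mu> * y vr t i"
        using qr[of i t] qi[of i t] by auto
      then show "y vr (t + T) i * y vr (t + T) i + y vi (t + T) i * y vi (t + T) i
          = y vr t i * y vr t i + y vi t i * y vi t i"
        using rot by simp
    qed
    finally show ?thesis by (simp add: f_def ip_def sum.distrib)
  qed
  ultimately obtain B where B: "\<And>t. f t \<le> B" using periodic_bounded[OF _ _ T] by blast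
  have "\<bar>y u t i\<bar> \<le> sqrt B" if "u = vr \<or> u = vi" "i < N" for u t i
  proof -
    have "ip N (y u t) (y u t) \<le> B"
      using that B[of t] ip_nonneg[of N "y vr t"] ip_nonneg[of N "y vi t"] unfolding f_def by auto
    then show ?thesis using abs_le_sqrt_ip[OF that(2), of "y u t"] real_sqrt_le_mono order_trans by blast
  qed
  moreover have "\<exists>u. (u = vr \<or> u = vi) \<and> (\<forall>j<N. r $ j = u j)"
    using r dimv by (auto simp: vr_def vi_def)
  then obtain u where u: "u = vr \<or> u = vi" "\<And>j. j < N \<Longrightarrow> r $ j = u j" by blast
  moreover have "(\<Sum>j<N. \<Gamma> t $$ (i, j) * r $ j) = y u t i" for t i
    unfolding y_def by (intro sum.cong) (auto simp: u(2))
  ultimately show ?thesis by (intro exI[of _ "sqrt B"]) auto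
qed

section \<open>Reduction to the third factor\<close>

lemma cact_cong:
  assumes "even k" "\<And>j. j < k \<Longrightarrow> x j = y j" "i < k"
  shows "cact w x i = cact w y i"
  unfolding cact_def using assms(2)[OF assms(3)] jj_cong[OF assms] by simp

lemma jj_cact: "jj (cact z y) i = cact (\<i> * z) y i"
  by (simp add: jj_def cact_def)

lemma cact_scale_right: "cact z (\<lambda>i. r * y i) i = cact (of_real r * z) y i"
  by (simp add: cact_def jj_scale algebra_simps)

lemma ip_cact:
  assumes "even k"
  shows "ip k (cact z y) (cact z y) = (cmod z)\<^sup>2 * ip k y y"
proof -
  have "ip k (cact z y) (cact z y) = (Re z)\<^sup>2 * ip k y y + (Im z)\<^sup>2 * ip k (jj y) (jj y)
      + 2 * Re z * Im z * ip k y (jj y)"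
    unfolding cact_def[abs_def] ip_linear ip_commute[of k "jj y" y]
        by (simp add: power2_eq_square algebra_simps)
  also have "\<dots> = ((Re z)\<^sup>2 + (Im z)\<^sup>2) * ip k y y"
    by (simp add: ip_jj_jj[OF assms] ip_jj_self[OF assms] distrib_right)
  finally show ?thesis by (simp add: cmod_power2)
qed

lemma DERIV_cact:
  assumes "even k"
    and "((\<lambda>s. Re (z s)) has_real_derivative Re z') (at t)" "((\<lambda>s. Im (z s))
        has_real_derivative Im z') (at t)"
    and "\<And>i. i < k \<Longrightarrow> ((\<lambda>s. y s i) has_real_derivative y' i) (at t)" and "i < k"
  shows "((\<lambda>s. cact (z s) (y s) i) has_real_derivative cact z' (y t) i + cact (z t) y' i) (at t)"
  unfolding cact_def
  by (rule DERIV_cong[OF DERIV_add[OF DERIV_mult[OF assms(2) assms(4)[OF assms(5)]]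
          DERIV_mult[OF assms(3) DERIV_jj[OF assms(1,4,5)]]]])
     (simp_all add: algebra_simps)

lemma sum_lessThan_add4: "(\<Sum>d<k + 4. f d) = (\<Sum>d<4. f d) + (\<Sum>d<k. f (d + 4))"
  for f :: "nat \<Rightarrow> real"
proof (induction k)
  case (Suc k)
  show ?case unfolding add_Suc sum.lessThan_Suc Suc by simp
qed simp

context cc_frame
begin

text \<open>Frame coordinates of a displacement beyond the first four; the even shift keeps the
  pairing of coordinates under \<open>jj\<close>.\<close>

definition sig :: "(nat \<Rightarrow> real) \<Rightarrow> nat \<Rightarrow> real" where
  "sig \<xi> c = mip n m (p (c + 4)) \<xi>"

lemma sig_jj:
  assumes "c < k"
  shows "sig (jj \<xi>) c = jj (sig \<xi>) c"
proof -
  have c: "c + 4 < 2 * n" using assms by simp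
  have "sig (jj \<xi>) c = - mip n m (jj (p (c + 4))) \<xi>" by (simp add: sig_def mip_jj_right)
  also have "\<dots> = jj (sig \<xi>) c"
  proof (cases "even c")
    case True
    have "mip n m (jj (p (c + 4))) \<xi> = mip n m (p (c + 1 + 4)) \<xi>"
      by (rule mip_cong) (use True c in \<open>simp_all add: jj_p\<close>)
    then show ?thesis using True by (simp add: jj_def sig_def)
  next
    case False
    then obtain c' where c': "c = Suc c'" by (cases c) auto
    have "mip n m (jj (p (c + 4))) \<xi> = mip n m (\<lambda>i. (- 1) * p (c - 1 + 4) i) \<xi>"
      by (rule mip_cong) (use False c c' in \<open>simp_all add: jj_p add.commute[of 4]\<close>)
    also have "\<dots> = - sig \<xi> (c - 1)" unfolding mip_scale_left sig_def by simp
    finally show ?thesis using False by (simp add: jj_def)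
  qed
  finally show ?thesis .
qed

lemma sig_cact: "c < k \<Longrightarrow> sig (cact w \<xi>) c = cact w (sig \<xi>) c"
  unfolding cact_def[abs_def]
  by (subst sig_def) (simp add: mip_add_right mip_scale_right sig_jj[symmetric] flip: sig_def)

text \<open>By the block structure only the high coordinates of \<open>\<eta>\<close> contribute,
  and on them the Hessian is \<open>U * (R - I)\<close>.\<close>

lemma hpot_high:
  assumes "c < k"
  shows "hpot n m av (p (c + 4)) \<eta> = U * (app k Rf (sig \<eta>) c - sig \<eta> c)"
proof -
  have "hpot n m av (p (c + 4)) \<eta> = hpot n m av (p (c + 4)) (\<lambda>i. \<Sum>d<k + 4. mip n m (p d) \<eta> * p d i)"
    by (rule hpot_cong) (auto simp: k4 intro: frame_expand)
  also have "\<dots> = (\<Sum>d<k + 4. mip n m (p d) \<eta> * hpot n m av (p (c + 4)) (p d))"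
    by (rule hpot_sum_right) simp
  also have "\<dots> = (\<Sum>d<4. mip n m (p d) \<eta> * hpot n m av (p (c + 4)) (p d))
      + (\<Sum>d<k. sig \<eta> d * hpot n m av (p (c + 4)) (p (d + 4)))"
    unfolding sum_lessThan_add4 sig_def ..
  also have "(\<Sum>d<4. mip n m (p d) \<eta> * hpot n m av (p (c + 4)) (p d)) = 0"
    using assms by (intro sum.neutral ballI)
      (simp add: hpot_commute[of n m av "p (c + 4)"] hpot_a_low_high)
  also have "(\<Sum>d<k. sig \<eta> d * hpot n m av (p (c + 4)) (p (d + 4)))
      = hpot n m av (p (c + 4)) (\<lambda>i. \<Sum>d<k. sig \<eta> d * p (d + 4) i)"
    by (rule hpot_sum_right[symmetric]) simp
  also have "\<dots> = U * (app k Rf (sig \<eta>) c - sig \<eta> c)" by (rule hpot_p_high[OF assms])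
  finally show ?thesis by simp
qed

text \<open>Equivariance pulls both arguments back to \<open>a\<close>. The factor
  \<open>1 / w\<close> on the frame vector then moves to the value as its conjugate, since pairing
  with \<open>jj\<close> of the columns gives minus \<open>jj\<close> of the pairings.\<close>

lemma hpot_reduced:
  assumes w: "w \<noteq> 0" and c: "c < k" and X: "\<And>d. d < k \<Longrightarrow> X d = cact (1 / w) (sig \<xi>) d"
  shows "hpot n m (cact w av) (p (c + 4)) \<xi>
    = U / cmod w * cact (cnj (1 / w)) (\<lambda>c. app k Rf X c - X c) c"
proof -
  let ?u = "1 / w"
  define \<eta> where "\<eta> = cact ?u \<xi>"
  have sX: "sig \<eta> d = X d" if "d < k" for d
    using X[OF that] that by (simp add: \<eta>_def sig_cact)
  define F where "F d = hpot n m av (p (d + 4)) \<eta>" for d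
  have F: "F d = U * (app k Rf X d - X d)" if "d < k" for d
    using hpot_high[OF that, of \<eta>] app_cong[of k "sig \<eta>" X Rf d] sX that by (simp add: F_def)
  have act_inv: "cact w (cact ?u y) = y" for y
    using w by (simp add: fun_eq_iff cact_cact)
  have "hpot n m (cact w av) (p (c + 4)) \<xi> = hpot n m (cact w av) (cact w (cact ?u (p (c + 4)))) (cact w \<eta>)"
    unfolding \<eta>_def act_inv ..
  also have "\<dots> = hpot n m av (cact ?u (p (c + 4))) \<eta> / cmod w" by (rule hpot_cact[OF w])
  also have "hpot n m av (cact ?u (p (c + 4))) \<eta> = Re ?u * F c + Im ?u * hpot n m av (jj (p (c + 4))) \<eta>"
    unfolding cact_def[abs_def] hpot_add_left hpot_scale_left F_def ..
  also have "hpot n m av (jj (p (c + 4))) \<eta> = - jj F c"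
  proof (cases "even c")
    case True
    have "hpot n m av (jj (p (c + 4))) \<eta> = hpot n m av (p (c + 1 + 4)) \<eta>"
      by (rule hpot_cong) (use True c in \<open>simp_all add: jj_p\<close>)
    then show ?thesis using True by (simp add: jj_def F_def)
  next
    case False
    then obtain c' where c': "c = Suc c'" by (cases c) auto
    have "hpot n m av (jj (p (c + 4))) \<eta> = hpot n m av (\<lambda>i. (- 1) * p (c - 1 + 4) i) \<eta>"
      by (rule hpot_cong) (use False c c' in \<open>simp_all add: jj_p add.commute[of 4]\<close>)
    also have "\<dots> = - F (c - 1)" unfolding hpot_scale_left F_def by simp
    finally show ?thesis using False by (simp add: jj_def)
  qed
  also have "Re ?u * F c + Im ?u * - jj F c = cact (cnj ?u) F c"
    by (simp only: cact_def cnj.simps mult_minus_left mult_minus_right)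
  also have "cact (cnj ?u) F c = cact (cnj ?u) (\<lambda>c. U * (app k Rf X c - X c)) c"
    by (rule cact_cong[OF even_k F c])
  also have "\<dots> = U * cact (cnj ?u) (\<lambda>c. app k Rf X c - X c) c"
    unfolding cact_scale_right cact_of_real ..
  finally show ?thesis by simp
qed

text \<open>The reduction to \<open>E3\<close>: with \<open>\<sigma>\<close> the last coordinates of the displacement in the frame \<open>P\<close>,
  \<open>X = w\<^sup>-\<^sup>1 \<sigma>\<close> as a function of the true anomaly solves \<open>X'' + 2 J X' = R X / (1 + e cos s)\<close>.\<close>

lemma reduced_solution:
  assumes e: "0 \<le> e" "e < 1" and l: "0 < l" and h: "0 < h" "h\<^sup>2 = U * l"
    and \<theta>g: "\<And>s. \<theta> (g s) = s"
    and dg: "\<And>s. (g has_real_derivative inverse (h * (1 + e * cos s)\<^sup>2 / l\<^sup>2)) (at s)"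
    and d\<xi>: "\<And>t i. i < 2 * n \<Longrightarrow> ((\<lambda>s. \<xi> s i) has_real_derivative q t i / m (i div 2)) (at t)"
    and dq: "\<And>t i. i < 2 * n \<Longrightarrow> ((\<lambda>s. q s i) has_real_derivative
       hpot n m (cact (kepler_pos l e \<omega> (\<theta> t)) av) (unitf i) (\<xi> t)) (at t)"
    and bd: "\<And>t i. i < 2 * n \<Longrightarrow> \<bar>\<xi> t i\<bar> \<le> B"
    and nz: "c0 < k" "sig (\<xi> t0) c0 \<noteq> 0 \<or> (\<Sum>i<2 * n. p (c0 + 4) i * q t0 i) \<noteq> 0" "g s0 = t0"
  shows "\<exists>X Y C. lin_kepler k Rf e UNIV X Y \<and> (\<forall>t. ip k (X t) (X t) \<le> C) \<and>
    (\<exists>t. 0 < ip k (X t) (X t) + ip k (Y t) (Y t))"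
proof -
  note pos = one_plus_e_cos_pos[OF e]
  define \<sigma> where "\<sigma> t = sig (\<xi> t)" for t
  define \<pi>' where "\<pi>' t c = (\<Sum>i<2 * n. p (c + 4) i * q t i)" for t c
  define D where "D s = 1 + e * cos s" for s
  have D: "0 < D s" for s using pos by (simp add: D_def)
  \<comment> \<open>\<open>E\<close> is the conjugate of \<open>cis (\<omega> + s)\<close>. Along
    the orbit \<open>u\<close> is thus \<open>1 / w\<close> and \<open>c\<close> the conjugate of
    \<open>w\<close>; \<open>u1\<close>, \<open>u2\<close>, \<open>c1\<close> are derivatives in the
    anomaly \<open>s\<close>, and \<open>g'\<close> is that of time.\<close>
  define E where "E s = Complex (cos (\<omega> + s)) (- sin (\<omega> + s))" for s
  define u where "u s = of_real (D s / l) * E s" for s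
  define u1 where "u1 s = E s * Complex (- e * sin s / l) (- D s / l)" for s
  define u2 where "u2 s = E s * Complex ((1 - 2 * D s) / l) (2 * e * sin s / l)" for s
  define c where "c s = of_real (l / D s) * E s" for s
  define c1 where "c1 s = E s * Complex (l * e * sin s / (D s)\<^sup>2) (- l / D s)" for s
  define g' where "g' s = l\<^sup>2 / (h * (D s)\<^sup>2)" for s
  have dg': "(g has_real_derivative g' s) (at s)" for s
    using dg[of s] by (simp add: g'_def D_def)
  have dD: "(D has_real_derivative - e * sin s) (at s)" for s
    unfolding D_def[abs_def] by (auto intro!: derivative_eq_intros)
  have du: "((\<lambda>s. Re (u s)) has_real_derivative Re (u1 s)) (at s)"
    "((\<lambda>s. Im (u s)) has_real_derivative Im (u1 s)) (at s)" for s
    unfolding u_def u1_def E_def using l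
    by (auto intro!: derivative_eq_intros dD simp: field_simps)
  have du1: "((\<lambda>s. Re (u1 s)) has_real_derivative Re (u2 s)) (at s)"
    "((\<lambda>s. Im (u1 s)) has_real_derivative Im (u2 s)) (at s)" for s
    unfolding u1_def u2_def E_def using l
    by (auto intro!: derivative_eq_intros dD simp: field_simps D_def)
  have dc: "((\<lambda>s. Re (c s)) has_real_derivative Re (c1 s)) (at s)"
    "((\<lambda>s. Im (c s)) has_real_derivative Im (c1 s)) (at s)" for s
    unfolding c_def c1_def E_def using l D[of s]
    by (auto intro!: derivative_eq_intros dD simp: field_simps power2_eq_square)
  have d\<sigma>: "((\<lambda>t. \<sigma> t c) has_real_derivative \<pi>' t c) (at t)" for t c
  proof -
    have "((\<lambda>t. \<sigma> t c) has_real_derivative (\<Sum>i<2 * n. m (i div 2) * p (c + 4) i * (q t i / m (i div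
        2)))) (at t)"
      unfolding \<sigma>_def sig_def mip_def by (intro DERIV_sum DERIV_cmult d\<xi>) auto
    also have "(\<Sum>i<2 * n. m (i div 2) * p (c + 4) i * (q t i / m (i div 2))) = \<pi>' t c"
      unfolding \<pi>'_def
    proof (intro sum.cong refl)
      fix i assume "i \<in> {..<2 * n}"
      then show "m (i div 2) * p (c + 4) i * (q t i / m (i div 2)) = p (c + 4) i * q t i"
        using mass_div_pos[of i] by simp
    qed
    finally show ?thesis .
  qed
  define X where "X s = cact (u s) (\<sigma> (g s))" for s
  \<comment> \<open>Intended as the derivative of \<open>X\<close>: the factor \<open>g' u\<close>
    of the momenta simplifies to \<open>c / h\<close>.\<close>
  define Y where "Y s i = cact (u1 s) (\<sigma> (g s)) i + cact (c s / of_real h) (\<pi>' (g s)) i" for s i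
  have kp: "kepler_pos l e \<omega> s \<noteq> 0" "1 / kepler_pos l e \<omega> s = u s" "cmod (kepler_pos l e \<omega> s)
      = l / D s" for s
  proof -
    have n: "cmod (kepler_pos l e \<omega> s) = l / D s"
      unfolding kepler_pos_def norm_mult norm_of_real norm_cis using D[of s] l by (simp add: D_def)
    show "cmod (kepler_pos l e \<omega> s) = l / D s" by (rule n)
    show nz: "kepler_pos l e \<omega> s \<noteq> 0" using n D[of s] l by auto
    have "cis (\<omega> + s) * E s = 1" by (simp add: E_def complex_eq_iff flip: power2_eq_square)
    then have "kepler_pos l e \<omega> s * u s = of_real (l / D s) * of_real (D s / l)"
      by (simp add: kepler_pos_def u_def D_def[symmetric] mult_ac)
    also have "\<dots> = 1" using D[of s] l by (simp flip: of_real_mult)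
    finally show "1 / kepler_pos l e \<omega> s = u s" using nz by (simp add: field_simps)
  qed
  have d\<pi>: "((\<lambda>t. \<pi>' t i) has_real_derivative
      U * D s / l * cact (cnj (u s)) (\<lambda>i. app k Rf (X s) i - X s i) i) (at (g s))" if "i < k" for s i
  proof -
    have "((\<lambda>t. \<pi>' t i) has_real_derivative
        (\<Sum>j<2 * n. p (i + 4) j * hpot n m (cact (kepler_pos l e \<omega> s) av) (unitf j) (\<xi> (g s)))) (at (g s))"
      unfolding \<pi>'_def using dq[of _ "g s"] unfolding \<theta>g by (intro DERIV_sum DERIV_cmult) auto
    also have "(\<Sum>j<2 * n. p (i + 4) j * hpot n m (cact (kepler_pos l e \<omega> s) av) (unitf j) (\<xi> (g s)))
        = hpot n m (cact (kepler_pos l e \<omega> s) av) (p (i + 4)) (\<xi> (g s))"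
      by (rule hpot_expand_left[symmetric])
    also have "\<dots> = U / cmod (kepler_pos l e \<omega> s)
        * cact (cnj (1 / kepler_pos l e \<omega> s)) (\<lambda>i. app k Rf (X s) i - X s i) i"
      by (rule hpot_reduced[OF kp(1) that]) (simp add: X_def \<sigma>_def kp(2))
    also have "\<dots> = U * D s / l * cact (cnj (u s)) (\<lambda>i. app k Rf (X s) i - X s i) i"
      unfolding kp(2,3) by simp
    finally show ?thesis .
  qed
  have "lin_kepler k Rf e UNIV X Y"
    unfolding lin_kepler_def
  proof (intro ballI allI impI conjI)
    fix s i assume i: "i < k"
    have d\<sigma>g: "((\<lambda>s. \<sigma> (g s) j) has_real_derivative g' s * \<pi>' (g s) j) (at s)" for j
      using DERIV_chain'[OF dg'[of s] d\<sigma>[where c = j]] by (simp add: mult.commute)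
    have d\<pi>g: "((\<lambda>s. \<pi>' (g s) j) has_real_derivative
        g' s * (U * D s / l) * cact (cnj (u s)) (\<lambda>i. app k Rf (X s) i - X s i) j) (at s)" if "j < k" for j
      using DERIV_chain'[OF dg'[of s] d\<pi>[OF that, of s]] by (simp add: mult_ac)
    have gu: "of_real (g' s) * u s = c s / of_real h"
      using l h D[of s] by (simp add: g'_def u_def c_def power2_eq_square)
    show "((\<lambda>s. X s i) has_real_derivative Y s i) (at s)"
    proof -
      have "((\<lambda>s. X s i) has_real_derivative cact (u1 s) (\<sigma> (g s)) i
          + cact (u s) (\<lambda>j. g' s * \<pi>' (g s) j) i) (at s)"
        unfolding X_def by (rule DERIV_cact[OF even_k du d\<sigma>g i])
      then show ?thesis by (simp add: Y_def cact_scale_right gu)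
    qed
    \<comment> \<open>\<open>I1\<close> and \<open>I2\<close> produce the Coriolis term, and the
      remainder \<open>u / D\<close> in \<open>I1\<close> cancels the \<open>- X\<close> in
      \<open>R X - X\<close>. In \<open>I3\<close> the relation \<open>h^2 = U * l\<close> makes the
      coefficient exactly \<open>1 / D\<close>.\<close>
    have I1: "u2 s = - 2 * (\<i> * u1 s) + of_real (1 / D s) * u s"
      using l D[of s] unfolding u2_def u1_def u_def by (simp add: complex_eq_iff field_simps)
    have I2: "of_real (g' s) * u1 s + c1 s / of_real h = - 2 * (\<i> * (c s / of_real h))"
      using l h D[of s] unfolding g'_def u1_def c1_def c_def
      by (simp add: complex_eq_iff field_simps power2_eq_square)
    have I3: "of_real (g' s * (U * D s / l)) * ((c s / of_real h) * cnj (u s)) = of_real (1 / D s)"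
    proof -
      have "E s * cnj (E s) = 1" by (simp add: E_def complex_eq_iff flip: power2_eq_square)
      then have "c s * cnj (u s) = of_real (l / D s) * of_real (D s / l)"
        by (simp add: c_def u_def mult_ac)
      also have "\<dots> = 1" using D[of s] l by (simp flip: of_real_mult)
      finally have "c s * cnj (u s) = 1" .
      then have "of_real (g' s * (U * D s / l)) * ((c s / of_real h) * cnj (u s))
          = of_real (g' s * (U * D s / l) / h)"
        by simp
      also have "g' s * (U * D s / l) / h = (U * l) / h\<^sup>2 / D s"
        using l h(1) D[of s] by (simp add: g'_def power2_eq_square field_simps)
      also have "(U * l) / h\<^sup>2 / D s = 1 / D s"
        using h l potential_pos by simp
      finally show ?thesis .
    qed
    let ?G = "\<lambda>i. app k Rf (X s) i - X s i"
    have dch: "((\<lambda>s. Re (c s / of_real h)) has_real_derivative Re (c1 s / of_real h)) (at s)"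
      "((\<lambda>s. Im (c s / of_real h)) has_real_derivative Im (c1 s / of_real h)) (at s)"
      unfolding Re_divide_of_real Im_divide_of_real by (intro DERIV_cdivide dc)+
    have "((\<lambda>s. Y s i) has_real_derivative
        (cact (u2 s) (\<sigma> (g s)) i + cact (u1 s) (\<lambda>j. g' s * \<pi>' (g s) j) i)
        + (cact (c1 s / of_real h) (\<pi>' (g s)) i
          + cact (c s / of_real h) (\<lambda>j. g' s * (U * D s / l) * cact (cnj (u s)) ?G j) i)) (at s)"
      unfolding Y_def
      by (intro DERIV_add DERIV_cact[OF even_k du1 d\<sigma>g i] DERIV_cact[OF even_k dch d\<pi>g i])
    moreover have "(cact (u2 s) (\<sigma> (g s)) i + cact (u1 s) (\<lambda>j. g' s * \<pi>' (g s) j) i)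
        + (cact (c1 s / of_real h) (\<pi>' (g s)) i
          + cact (c s / of_real h) (\<lambda>j. g' s * (U * D s / l) * cact (cnj (u s)) ?G j) i)
        = - 2 * jj (Y s) i + app k Rf (X s) i / (1 + e * cos s)"
    proof -
      have a1: "cact (u2 s) (\<sigma> (g s)) i = - 2 * cact (\<i> * u1 s) (\<sigma> (g s)) i + X s i / D s"
        using cact_of_real[of "- 2" "\<i> * u1 s" "\<sigma> (g s)" i] cact_of_real[of "1 / D s" "u s" "\<sigma> (g s)" i]
        unfolding I1 cact_add X_def by simp
      have a2: "cact (u1 s) (\<lambda>j. g' s * \<pi>' (g s) j) i + cact (c1 s / of_real h) (\<pi>' (g s)) i
          = - 2 * cact (\<i> * (c s / of_real h)) (\<pi>' (g s)) i"
        using cact_of_real[of "- 2" "\<i> * (c s / of_real h)" "\<pi>' (g s)" i]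
        unfolding cact_scale_right cact_add[symmetric] I2 by simp
      have a3: "cact (c s / of_real h) (\<lambda>j. g' s * (U * D s / l) * cact (cnj (u s)) ?G j) i = ?G i / D s"
      proof -
        have "cact (c s / of_real h) (\<lambda>j. g' s * (U * D s / l) * cact (cnj (u s)) ?G j) i
            = cact (of_real (g' s * (U * D s / l)) * (c s / of_real h)) (cact (cnj (u s)) ?G) i"
          by (rule cact_scale_right)
        also have "\<dots> = cact (of_real (1 / D s)) ?G i"
          unfolding cact_cact mult.assoc[of "of_real (g' s * (U * D s / l))"] I3 ..
        also have "\<dots> = ?G i / D s"
          using cact_of_real[of "1 / D s" 1 ?G i] by simp
        finally show ?thesis .
      qed
      have a4: "jj (Y s) i = cact (\<i> * u1 s) (\<sigma> (g s)) i + cact (\<i> * (c s / of_real h)) (\<pi>' (g s)) i"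
        unfolding Y_def[abs_def] jj_add jj_cact ..
      show ?thesis
        using a1 a2 a3 a4 by (simp add: D_def diff_divide_distrib)
    qed
    ultimately show "((\<lambda>s. Y s i) has_real_derivative - 2 * jj (Y s) i + app k Rf (X s) i / (1
        + e * cos s)) (at s)"
      by simp
  qed
  moreover have "\<exists>C. \<forall>s. ip k (X s) (X s) \<le> C"
  proof -
    define S where "S = (\<Sum>c<k. (\<Sum>i<2 * n. \<bar>m (i div 2) * p (c + 4) i\<bar> * B)\<^sup>2)"
    have "\<bar>\<sigma> t c\<bar> \<le> (\<Sum>i<2 * n. \<bar>m (i div 2) * p (c + 4) i\<bar> * B)" for t c
      unfolding \<sigma>_def sig_def mip_def
    proof (rule order_trans[OF sum_abs], intro sum_mono)
      fix i assume "i \<in> {..<2 * n}"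
      then show "\<bar>m (i div 2) * p (c + 4) i * \<xi> t i\<bar> \<le> \<bar>m (i div 2) * p (c + 4) i\<bar> * B"
        unfolding abs_mult[of "m (i div 2) * p (c + 4) i"] using bd[of i t] by (intro mult_left_mono) auto
    qed
    then have "(\<sigma> t c)\<^sup>2 \<le> (\<Sum>i<2 * n. \<bar>m (i div 2) * p (c + 4) i\<bar> * B)\<^sup>2" for t c
      by (simp add: abs_le_square_iff[symmetric]) (meson abs_ge_self order_trans)
    then have S: "ip k (\<sigma> t) (\<sigma> t) \<le> S" for t
      unfolding S_def ip_def power2_eq_square[of "\<sigma> t _", symmetric] by (intro sum_mono)
    have "ip k (X s) (X s) \<le> (2 / l)\<^sup>2 * S" for s
    proof -
      have "cmod (E s) = 1" by (simp add: E_def cmod_def)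
      then have "cmod (u s) = D s / l"
        unfolding u_def norm_mult norm_of_real using D[of s] l by simp
      moreover have "D s \<le> 2"
      proof -
        have "e * cos s \<le> e * 1" using e by (intro mult_left_mono) auto
        then show ?thesis using e by (simp add: D_def)
      qed
      ultimately have "(cmod (u s))\<^sup>2 \<le> (2 / l)\<^sup>2"
        using D[of s] l by (intro power_mono) (auto simp: divide_right_mono)
      then show ?thesis
        unfolding X_def ip_cact[OF even_k] using S[of "g s"] by (intro mult_mono ip_nonneg) auto
    qed
    then show ?thesis by blast
  qed
  moreover have "0 < ip k (X s0) (X s0) + ip k (Y s0) (Y s0)"
  proof (rule ccontr)
    assume "\<not> ?thesis"
    then have "ip k (X s0) (X s0) = 0" "ip k (Y s0) (Y s0) = 0"
      using ip_nonneg[of k "X s0"] ip_nonneg[of k "Y s0"] by linarith+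
    then have XY: "X s0 i = 0" "Y s0 i = 0" if "i < k" for i
      using that by (auto simp: ip_eq_0_iff)
    have E0: "E s0 * cnj (E s0) = 1" by (simp add: E_def complex_eq_iff flip: power2_eq_square)
    have zero: "cact z (\<lambda>_. 0) i = 0" for z i by (simp add: cact_def jj_def)
    \<comment> \<open>The passage from \<open>\<sigma>\<close>, \<open>\<pi>'\<close> to
      \<open>X\<close>, \<open>Y\<close> is triangular with nonzero factors \<open>u\<close> and
      \<open>c / h\<close>, so zero data come only from zero data.\<close>
    have \<sigma>0: "\<sigma> t0 i = 0" if "i < k" for i
    proof -
      have "u s0 \<noteq> 0" using E0 D[of s0] l by (auto simp: u_def)
      then have "\<sigma> t0 i = cact (1 / u s0) (X s0) i"
        using nz(3) by (simp add: X_def cact_cact)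
      also have "\<dots> = cact (1 / u s0) (\<lambda>_. 0) i" by (rule cact_cong[OF even_k XY(1) that])
      finally show ?thesis by (simp add: zero)
    qed
    have "\<pi>' t0 i = 0" if "i < k" for i
    proof -
      define z where "z = c s0 / of_real h"
      have z: "z \<noteq> 0" using E0 D[of s0] l h by (auto simp: z_def c_def)
      have *: "cact z (\<pi>' t0) j = 0" if "j < k" for j
      proof -
        have "cact (u1 s0) (\<sigma> t0) j = cact (u1 s0) (\<lambda>_. 0) j" by (rule cact_cong[OF even_k \<sigma>0 that])
        then show ?thesis using XY(2)[OF that] nz(3) by (simp add: Y_def z_def zero)
      qed
      have "\<pi>' t0 i = cact (1 / z) (cact z (\<pi>' t0)) i" using z by (simp add: cact_cact)
      also have "\<dots> = cact (1 / z) (\<lambda>_. 0) i" by (rule cact_cong[OF even_k * that])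
      finally show ?thesis by (simp add: zero)
    qed
    with \<sigma>0 nz show False by (auto simp: \<sigma>_def \<pi>'_def)
  qed
  ultimately show ?thesis by blast
qed

end

section \<open>Hyperbolicity\<close>

lemma sum_lessThan_double: "(\<Sum>l<2 * N. f l) = (\<Sum>l<N. f l) + (\<Sum>l<N. f (N + l))"
  for f :: "nat \<Rightarrow> real"
proof -
  have "(\<Sum>l<N + M. f l) = (\<Sum>l<N. f l) + (\<Sum>l<M. f (N + l))" for M
    by (induction M) (simp_all add: add.assoc)
  from this[of N] show ?thesis by (simp add: mult_2)
qed

lemma JJmat_sum:
  assumes "i < 2 * j"
  shows "(\<Sum>l<2 * j. JJmat j $$ (i, l) * f l) = jj f i"
proof -
  have v: "vec (2 * j) f \<in> carrier_vec (2 * j)" by simp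
  have "(\<Sum>l<2 * j. JJmat j $$ (i, l) * f l) = (\<Sum>l<2 * j. JJmat j $$ (i, l) * vec (2 * j) f $ l)"
    by (intro sum.cong) auto
  also have "\<dots> = (JJmat j *\<^sub>v vec (2 * j) f) $ i"
    by (rule mult_mat_vec_entry[OF JJmat_carrier v assms, symmetric])
  also have "\<dots> = jj (($) (vec (2 * j) f)) i" by (rule JJmat_vec[OF v assms])
  also have "\<dots> = jj f i" by (rule jj_cong[of "2 * j"]) (use assms in auto)
  finally show ?thesis .
qed

lemma Jmat_mult_entry:
  assumes H: "H \<in> carrier_mat (2 * j) s" and "i < j" "l < s"
  shows "(Jmat j * H) $$ (i, l) = - H $$ (j + i, l)" "(Jmat j * H) $$ (j + i, l) = H $$ (i, l)"
proof -
  have c: "col H l \<in> carrier_vec (2 * j)" using carrier_matD[OF H] by (intro carrier_vecI) simp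
  have "(Jmat j * H) $$ (i', l) = (Jmat j *\<^sub>v col H l) $ i'" if "i' < 2 * j" for i'
    using that assms carrier_matD[OF Jmat_carrier[of j]] by simp
  then show "(Jmat j * H) $$ (i, l) = - H $$ (j + i, l)" "(Jmat j * H) $$ (j + i, l) = H $$ (i, l)"
    using Jmat_vec[OF c assms(2)] assms by auto
qed

lemma coll_mat_carrier:
  assumes k: "2 * j = k" and R: "R \<in> carrier_mat k k"
  shows "coll_mat j R \<tau> \<in> carrier_mat (2 * k) (2 * k)"
proof -
  have "coll_mat j R \<tau> \<in> carrier_mat (k + k) (k + k)"
    unfolding coll_mat_def Let_def k by (rule four_block_carrier_mat) (use R in auto)
  then show ?thesis by (simp add: mult_2)
qed

lemma coll_mat_apply:
  fixes z :: "real Matrix.vec"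
  assumes k: "2 * j = k" and R: "R \<in> carrier_mat k k" and zc: "z \<in> carrier_vec (2 * k)"
    and zy: "\<And>i. i < k \<Longrightarrow> z $ i = y i" and zx: "\<And>i. i < k \<Longrightarrow> z $ (k + i) = x i" and i: "i < k"
  shows "(coll_mat j R \<tau> *\<^sub>v z) $ i = y i + coll_Q \<tau> / 4 * x i - coll_q \<tau> * jj x i"
    and "(coll_mat j R \<tau> *\<^sub>v z) $ (k + i) =
      coll_Q \<tau> / 4 * y i + coll_q \<tau> * jj y i + (coll_q \<tau>)\<^sup>2 * x i - app k (\<lambda>i l. R $$ (i, l)) x i"
proof -
  note C = coll_mat_carrier[OF k R]
  have JJ: "dim_row (JJmat j) = k" "dim_col (JJmat j) = k"
      using carrier_matD[OF JJmat_carrier[of j]] k by auto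
  have JJs: "(\<Sum>l<k. JJmat j $$ (i, l) * f l) = jj f i" for f
    using JJmat_sum[of i j f] i unfolding k by simp
  note dims = JJ carrier_matD[OF R]
  let ?C = "coll_mat j R \<tau>"
  have entry: "?C $$ (i, l) = (if l = i then 1 else 0)"
    "?C $$ (i, k + l) = (if l = i then coll_Q \<tau> / 4 else 0) - coll_q \<tau> * JJmat j $$ (i, l)"
    "?C $$ (k + i, l) = (if l = i then coll_Q \<tau> / 4 else 0) + coll_q \<tau> * JJmat j $$ (i, l)"
    "?C $$ (k + i, k + l) = (if l = i then (coll_q \<tau>)\<^sup>2 else 0) - R $$ (i, l)" if l: "l < k" for l
    using i l dims by (auto simp: coll_mat_def Let_def k)
  have "(?C *\<^sub>v z) $ i = (\<Sum>l<2 * k. ?C $$ (i, l) * z $ l)"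
    by (rule mult_mat_vec_entry[OF C zc]) (use i in simp)
  also have "\<dots> = (\<Sum>l<k. if l = i then y l else 0) + (\<Sum>l<k. (if l = i then coll_Q \<tau> / 4 * x l else 0)
      - coll_q \<tau> * (JJmat j $$ (i, l) * x l))"
    unfolding sum_lessThan_double[of _ k]
    by (intro arg_cong2[of _ _ _ _ "(+)"] sum.cong refl) (simp_all add: entry zx zy
        left_diff_distrib mult.assoc)
  also have "\<dots> = y i + (coll_Q \<tau> / 4 * x i - coll_q \<tau> * jj x i)"
    using i JJs by (simp add: sum_subtractf flip: sum_distrib_left)
  finally show "(?C *\<^sub>v z) $ i = y i + coll_Q \<tau> / 4 * x i - coll_q \<tau> * jj x i" by simp
  have "(?C *\<^sub>v z) $ (k + i) = (\<Sum>l<2 * k. ?C $$ (k + i, l) * z $ l)"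
    by (rule mult_mat_vec_entry[OF C zc]) (use i in simp)
  also have "\<dots> = (\<Sum>l<k. (if l = i then coll_Q \<tau> / 4 * y l else 0) + coll_q \<tau> * (JJmat j $$ (i, l) * y l))
      + (\<Sum>l<k. (if l = i then (coll_q \<tau>)\<^sup>2 * x l else 0) - R $$ (i, l) * x l)"
    unfolding sum_lessThan_double[of _ k]
    by (intro arg_cong2[of _ _ _ _ "(+)"] sum.cong refl)
       (simp_all add: entry zx zy left_diff_distrib distrib_right mult.assoc)
  also have "\<dots> = coll_Q \<tau> / 4 * y i + coll_q \<tau> * jj y i + ((coll_q \<tau>)\<^sup>2 * x i
      - app k (\<lambda>i l. R $$ (i, l)) x i)"
    using i JJs by (simp add: sum_subtractf sum.distrib app_def flip: sum_distrib_left)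
  finally show "(?C *\<^sub>v z) $ (k + i) =
      coll_Q \<tau> / 4 * y i + coll_q \<tau> * jj y i + (coll_q \<tau>)\<^sup>2 * x i - app k (\<lambda>i l. R $$ (i, l)) x i" by simp
qed

context cc_frame
begin

lemma hamiltonian_hessian_carrier: "y \<in> carrier_vec (2 * n) \<Longrightarrow>
    hamiltonian_hessian n m y \<in> carrier_mat (2 * (2 * n)) (2 * (2 * n))"
  using four_block_carrier_mat[OF inv_mass_mat_carrier[of n m], of "- hessian (potential n m) y"
      "2 * n" "2 * n"]
  by (simp add: hamiltonian_hessian_def hessian_def mult_2)

text \<open>Momenta come first, so the upper rows are the force equation and the lower rows the
  velocities.\<close>

lemma flow_entry:
  assumes y: "y \<in> carrier_vec (2 * n)" and i: "i < 2 * n" and l: "l < 2 * n"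
  shows "(Jmat (2 * n) * hamiltonian_hessian n m y) $$ (i, l) = 0"
    "(Jmat (2 * n) * hamiltonian_hessian n m y) $$ (i, 2 * n + l) = hessian (potential n m) y $$ (i, l)"
    "(Jmat (2 * n) * hamiltonian_hessian n m y) $$ (2 * n + i, l) = (if l = i then 1 / m (i div 2) else 0)"
    "(Jmat (2 * n) * hamiltonian_hessian n m y) $$ (2 * n + i, 2 * n + l) = 0"
proof -
  note J = Jmat_mult_entry[OF hamiltonian_hessian_carrier[OF y] i]
  have H: "dim_row (hessian (potential n m) y) = 2 * n" "dim_col (hessian (potential n m) y) = 2 * n"
    using y by (auto simp: hessian_def)
  have M: "dim_row (inv_mass_mat n m) = 2 * n" "dim_col (inv_mass_mat n m) = 2 * n"
    using carrier_matD[OF inv_mass_mat_carrier[of n m]] by auto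
  show "(Jmat (2 * n) * hamiltonian_hessian n m y) $$ (i, l) = 0"
    using J(1)[of l] i l H M by (simp add: hamiltonian_hessian_def)
  show "(Jmat (2 * n) * hamiltonian_hessian n m y) $$ (i, 2 * n + l) = hessian (potential n m) y $$ (i, l)"
    using J(1)[of "2 * n + l"] i l H M by (simp add: hamiltonian_hessian_def)
  show "(Jmat (2 * n) * hamiltonian_hessian n m y) $$ (2 * n + i, l)
      = (if l = i then 1 / m (i div 2) else 0)"
    using J(2)[of l] i l H M by (simp add: hamiltonian_hessian_def inv_mass_mat_def mat_diag_def)
  show "(Jmat (2 * n) * hamiltonian_hessian n m y) $$ (2 * n + i, 2 * n + l) = 0"
    using J(2)[of "2 * n + l"] i l H M by (simp add: hamiltonian_hessian_def)
qed

text \<open>The pull-back by \<open>w\<close> costs one factor \<open>1 / w\<close> for each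
  argument and its modulus for the homogeneity, so the Hessian at \<open>w a\<close> is at most
  \<open>b ^ 3\<close> times a constant of \<open>a\<close>. This bounds the coefficients along the
  orbit, as uniqueness requires.\<close>

lemma hpot_unitf_bounded:
  assumes "0 < b"
  shows "\<exists>\<kappa>. \<forall>w i j. w \<noteq> 0 \<longrightarrow> cmod (1 / w) \<le> b \<longrightarrow> i < 2 * n \<longrightarrow> j < 2 * n \<longrightarrow>
    \<bar>hpot n m (cact w av) (unitf i) (unitf j)\<bar> \<le> \<kappa>"
proof -
  define K where "K i j = \<bar>hpot n m av (unitf i) (unitf j)\<bar> + \<bar>hpot n m av (unitf i) (jj (unitf j))\<bar>
     + \<bar>hpot n m av (jj (unitf i)) (unitf j)\<bar> + \<bar>hpot n m av (jj (unitf i)) (jj (unitf j))\<bar>" for i j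
  define \<kappa> where "\<kappa> = b * b * b * (\<Sum>i<2 * n. \<Sum>j<2 * n. K i j)"
  have "\<bar>hpot n m (cact w av) (unitf i) (unitf j)\<bar> \<le> \<kappa>"
    if w: "w \<noteq> 0" and u: "cmod (1 / w) \<le> b" and ij: "i < 2 * n" "j < 2 * n" for w i j
  proof -
    let ?u = "1 / w"
    let ?h = "hpot n m av"
    have act_inv: "cact w (cact ?u y) = y" for y using w by (simp add: fun_eq_iff cact_cact)
    have "hpot n m (cact w av) (unitf i) (unitf j)
        = hpot n m (cact w av) (cact w (cact ?u (unitf i))) (cact w (cact ?u (unitf j)))"
      unfolding act_inv ..
    also have "\<dots> = ?h (cact ?u (unitf i)) (cact ?u (unitf j)) / cmod w" by (rule hpot_cact[OF w])
    also have "\<dots> = ?h (cact ?u (unitf i)) (cact ?u (unitf j)) * cmod ?u" by (simp add: norm_divide)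
    finally have eq: "\<bar>hpot n m (cact w av) (unitf i) (unitf j)\<bar> = \<bar>?h (cact ?u (unitf i))
        (cact ?u (unitf j))\<bar> * cmod ?u"
      by (simp add: abs_mult)
    have re: "\<bar>Re ?u\<bar> \<le> b" and im: "\<bar>Im ?u\<bar> \<le> b"
      using abs_Re_le_cmod[of ?u] abs_Im_le_cmod[of ?u] u by linarith+
    have four_terms: "\<bar>p + q + (r + s)\<bar> \<le> c * (p' + q' + r' + s')"
      if "\<bar>p\<bar> \<le> c * p'" "\<bar>q\<bar> \<le> c * q'" "\<bar>r\<bar> \<le> c * r'" "\<bar>s\<bar> \<le> c * s'" for p q r s c p' q' r' s' :: real
      using that unfolding distrib_left by linarith
    have product_bound: "\<bar>p * (q * z)\<bar> \<le> b * b * \<bar>z\<bar>" if "\<bar>p\<bar> \<le> b" "\<bar>q\<bar> \<le> b" for p q z :: real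
    proof -
      have "\<bar>p\<bar> * \<bar>q\<bar> \<le> b * b" using that assms by (intro mult_mono) auto
      then have "\<bar>p\<bar> * \<bar>q\<bar> * \<bar>z\<bar> \<le> b * b * \<bar>z\<bar>" by (rule mult_right_mono) simp
      then show ?thesis by (simp add: abs_mult mult.assoc)
    qed
    have "?h (cact ?u (unitf i)) (cact ?u (unitf j)) =
        Re ?u * (Re ?u * ?h (unitf i) (unitf j)) + Im ?u * (Re ?u * ?h (unitf i) (jj (unitf j)))
        + (Re ?u * (Im ?u * ?h (jj (unitf i)) (unitf j)) + Im ?u * (Im ?u * ?h (jj (unitf i))
            (jj (unitf j))))"
      unfolding cact_def[abs_def] hpot_add_left hpot_scale_left hpot_add_right hpot_scale_right
      by (simp only: distrib_left mult_ac add_ac)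
    then have "\<bar>?h (cact ?u (unitf i)) (cact ?u (unitf j))\<bar> \<le> b * b * K i j"
      by (simp only: four_terms[OF product_bound[OF re re] product_bound[OF im re]
            product_bound[OF re im] product_bound[OF im im]] K_def)
    then have "\<bar>?h (cact ?u (unitf i)) (cact ?u (unitf j))\<bar> * cmod ?u \<le> b * b * K i j * b"
      using u assms by (intro mult_mono) (auto simp: K_def)
    also have "b * b * K i j * b \<le> \<kappa>"
    proof -
      have "K i j \<le> (\<Sum>j<2 * n. K i j)"
        by (rule member_le_sum) (use ij in \<open>auto simp: K_def\<close>)
      also have "\<dots> \<le> (\<Sum>i<2 * n. \<Sum>j<2 * n. K i j)"
        by (rule member_le_sum[of i _ "\<lambda>i. \<Sum>j<2 * n. K i j"]) (use ij in \<open>auto simp: K_def intro!: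
            sum_nonneg\<close>)
      finally have "b * b * b * K i j \<le> \<kappa>"
        unfolding \<kappa>_def using assms by (intro mult_left_mono) auto
      then show ?thesis by (simp add: mult_ac)
    qed
    finally show ?thesis unfolding eq .
  qed
  then show ?thesis by blast
qed

text \<open>\<open>E1\<close> and \<open>E2\<close> are products of a momentum and a position space,
  so 0 may be taken in either slot; the symplectic condition splits into one for positions and one
  for momenta.\<close>

lemma E3_orth:
  assumes z: "z \<in> E3 n m a" and c: "c < 4"
  shows "mip n m (p c) (\<lambda>i. z $ (2 * n + i)) = 0" "(\<Sum>i<2 * n. p c i * z $ i) = 0"
proof -
  have zc: "z \<in> carrier_vec (2 * (2 * n))" using z by (simp add: E3_def)
  have c2: "c < 2 * n" using c n_ge_3 by simp
  define V where "V = (if c < 2 then translation_directions n else span2 a (JJmat n *\<^sub>v a))"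
  have "c = 0 \<or> c = 1 \<or> c = 2 \<or> c = 3" using c by auto
  then have colV: "col P c \<in> V"
    using span2_left[OF col_P[OF small_lt(1)] col_P[OF small_lt(2)]]
      span2_right[OF col_P[OF small_lt(1)] col_P[OF small_lt(2)]]
      span2_left[OF col_P[OF small_lt(3)] col_P[OF small_lt(4)]]
      span2_right[OF col_P[OF small_lt(3)] col_P[OF small_lt(4)]] spans
    by (auto simp: V_def)
  have zeroV: "0\<^sub>v (2 * n) \<in> V"
  proof (cases "c < 2")
    case True
    have "0\<^sub>v (2 * n) = vec (2 * n) (\<lambda>i. if even i then 0 else 0 :: real)" by auto
    then show ?thesis using True unfolding V_def translation_directions_def by (auto intro!: exI[of _ 0])
  next
    case False
    have "0\<^sub>v (2 * n) = 0 \<cdot>\<^sub>v a + 0 \<cdot>\<^sub>v (JJmat n *\<^sub>v a)"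
      by (intro eq_vecI) (use carrier_vecD[OF a_carrier] carrier_matD[OF JJmat_carrier[of n]] in auto)
    then show ?thesis using False unfolding V_def span2_def by auto
  qed
  have pair: "(\<Sum>i<2 * n. v1 $ i * z $ i) = mip n m (($) w1) (\<lambda>i. z $ (2 * n + i))"
    if "w1 \<in> V" "v1 \<in> V" "w1 \<in> carrier_vec (2 * n)" "v1 \<in> carrier_vec (2 * n)" for w1 v1
  proof -
    let ?w = "(mass_mat n m *\<^sub>v w1) @\<^sub>v v1"
    have Mw: "mass_mat n m *\<^sub>v w1 \<in> carrier_vec (2 * n)"
      using that by (intro mult_mat_vec_carrier[OF mass_mat_carrier])
    have wc: "?w \<in> carrier_vec (2 * (2 * n))"
      using append_carrier_vec[OF Mw that(4)] by (simp add: mult_2)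
    have "?w \<in> E1 n m \<union> E2 n m a"
      using that(1,2) unfolding E1_def E2_def phase_subspace_def V_def by (auto split: if_splits)
    then have "0 = (Jmat (2 * n) *\<^sub>v z) \<bullet> ?w" using z by (simp add: E3_def)
    also have "\<dots> = (\<Sum>l<2 * n. (Jmat (2 * n) *\<^sub>v z) $ l * ?w $ l)
        + (\<Sum>l<2 * n. (Jmat (2 * n) *\<^sub>v z) $ (2 * n + l) * ?w $ (2 * n + l))"
      unfolding scalar_prod_sum[OF wc] sum_lessThan_double[of _ "2 * n"] ..
    also have "(\<Sum>l<2 * n. (Jmat (2 * n) *\<^sub>v z) $ l * ?w $ l) = - mip n m (($) w1) (\<lambda>i. z $ (2 * n + i))"
      unfolding mip_def sum_negf[symmetric]
    proof (intro sum.cong refl)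
      fix l assume "l \<in> {..<2 * n}"
      then have l: "l < 2 * n" by simp
      have "?w $ l = (mass_mat n m *\<^sub>v w1) $ l" using l carrier_vecD[OF Mw] carrier_vecD[OF that(4)]
          by (subst index_append_vec) auto
      then show "(Jmat (2 * n) *\<^sub>v z) $ l * ?w $ l = - (m (l div 2) * w1 $ l * z $ (2 * n + l))"
        unfolding Jmat_vec(1)[OF zc l] mass_mat_vec[OF that(3) l] by simp
    qed
    also have "(\<Sum>l<2 * n. (Jmat (2 * n) *\<^sub>v z) $ (2 * n + l) * ?w $ (2 * n + l))
        = (\<Sum>i<2 * n. v1 $ i * z $ i)"
    proof (intro sum.cong refl)
      fix l assume "l \<in> {..<2 * n}"
      then have l: "l < 2 * n" by simp
      have "?w $ (2 * n + l) = v1 $ l" using l carrier_vecD[OF Mw] carrier_vecD[OF that(4)]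
          by (subst index_append_vec) auto
      then show "(Jmat (2 * n) *\<^sub>v z) $ (2 * n + l) * ?w $ (2 * n + l) = v1 $ l * z $ l"
        unfolding Jmat_vec(2)[OF zc l] by simp
    qed
    finally show ?thesis by simp
  qed
  have colc: "col P c $ i = p c i" if "i < 2 * n" for i using that c2 P_carrier by auto
  have "mip n m (p c) (\<lambda>i. z $ (2 * n + i)) = mip n m (($) (col P c)) (\<lambda>i. z $ (2 * n + i))"
    by (rule mip_cong) (use colc in auto)
  also have "\<dots> = (\<Sum>i<2 * n. 0\<^sub>v (2 * n) $ i * z $ i)"
    by (rule pair[OF colV zeroV col_P[OF c2] zero_carrier_vec, symmetric])
  also have "\<dots> = 0" by simp
  finally show "mip n m (p c) (\<lambda>i. z $ (2 * n + i)) = 0" .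
  have "(\<Sum>i<2 * n. p c i * z $ i) = (\<Sum>i<2 * n. col P c $ i * z $ i)"
    by (intro sum.cong) (use colc in auto)
  also have "\<dots> = mip n m (($) (0\<^sub>v (2 * n))) (\<lambda>i. z $ (2 * n + i))"
    by (rule pair[OF zeroV colV zero_carrier_vec col_P[OF c2]])
  also have "\<dots> = 0" by (simp add: mip_def)
  finally show "(\<Sum>i<2 * n. p c i * z $ i) = 0" .
qed

text \<open>A phase vector is determined by all frame coordinates of its positions and momenta, and
  in \<open>E3\<close> the first four of each vanish.\<close>

lemma E3_nonzero:
  assumes z: "z \<in> E3 n m a" and nz: "z \<noteq> 0\<^sub>v (4 * n)"
  shows "\<exists>c<k. sig (\<lambda>i. z $ (2 * n + i)) c \<noteq> 0 \<or> (\<Sum>i<2 * n. p (c + 4) i * z $ i) \<noteq> 0"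
proof (rule ccontr)
  assume c: "\<not> ?thesis"
  have all: "mip n m (p c) (\<lambda>i. z $ (2 * n + i)) = 0 \<and> (\<Sum>i<2 * n. p c i * z $ i) = 0" if "c < 2 * n" for c
  proof (cases "c < 4")
    case True
    then show ?thesis using E3_orth[OF z] by blast
  next
    case False
    then have "c - 4 < k" "c - 4 + 4 = c" using that by auto
    then show ?thesis using c unfolding sig_def by metis
  qed
  have pos: "z $ (2 * n + i) = 0" if "i < 2 * n" for i
    using frame_expand[OF that, of "\<lambda>i. z $ (2 * n + i)"] all by simp
  have mom: "z $ i = 0" if "i < 2 * n" for i
  proof -
    \<comment> \<open>Division by the masses turns the plain pairing of momenta with a column into
      the mass pairing of \<open>frame_expand\<close>.\<close>
    have "mip n m (p c) (\<lambda>i. z $ i / m (i div 2)) = 0" if "c < 2 * n" for c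
    proof -
      have "mip n m (p c) (\<lambda>i. z $ i / m (i div 2)) = (\<Sum>i<2 * n. p c i * z $ i)"
        unfolding mip_def
      proof (intro sum.cong refl)
        fix i assume "i \<in> {..<2 * n}"
        then show "m (i div 2) * p c i * (z $ i / m (i div 2)) = p c i * z $ i"
          using mass_div_pos[of i] by simp
      qed
      then show ?thesis using all[OF that] by simp
    qed
    then have "z $ i / m (i div 2) = 0"
      using frame_expand[OF \<open>i < 2 * n\<close>, of "\<lambda>i. z $ i / m (i div 2)"] by simp
    then show ?thesis using mass_div_pos[OF \<open>i < 2 * n\<close>] by simp
  qed
  have "z = 0\<^sub>v (4 * n)"
  proof
    show "dim_vec z = dim_vec (0\<^sub>v (4 * n))" using z by (auto simp: E3_def)
    fix i assume "i < dim_vec (0\<^sub>v (4 * n))"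
    then have i: "i < 4 * n" by simp
    show "z $ i = 0\<^sub>v (4 * n) $ i"
      using mom[of i] pos[of "i - 2 * n"] i by (cases "i < 2 * n") auto
  qed
  then show False using nz by contradiction
qed

text \<open>The eigenvector may be complex, but its real or its imaginary part is nonzero, and both
  lie in \<open>E3\<close>. The real solution through that part is bounded because the multiplier
  has modulus one, and \<open>E3_nonzero\<close> at time 0 makes its reduction nonzero.\<close>

lemma non_hyperbolic_solution:
  assumes "\<not> ERE_hyperbolic n m a e" "e < 1"
  shows "\<exists>X Y C. lin_kepler k Rf e UNIV X Y \<and> (\<forall>t. ip k (X t) (X t) \<le> C) \<and>
    (\<exists>t. 0 < ip k (X t) (X t) + ip k (Y t) (Y t))"
proof -
  obtain T x \<Gamma> v \<mu> where ERE: "elliptic_relative_equilibrium n m a e T x"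
    and fs: "fundamental_solution (4 * n) (\<lambda>t. Jmat (2 * n) * hamiltonian_hessian n m (x t)) \<Gamma>"
    and ev: "eigenvector (map_mat complex_of_real (\<Gamma> T)) v \<mu>"
    and vE3: "map_vec Re v \<in> E3 n m a" "map_vec Im v \<in> E3 n m a" and \<mu>: "cmod \<mu> = 1"
    using assms(1) unfolding ERE_hyperbolic_def by blast
  have e: "0 \<le> e" "e < 1" and T: "0 < T" and motion: "n_body_motion n m x"
    using ERE unfolding elliptic_relative_equilibrium_def by auto
  have xc: "x t \<in> carrier_vec (2 * n)" and xf: "collision_free n (x t)" for t
    using motion unfolding n_body_motion_def by auto
  obtain l \<omega> \<theta> h where l: "0 < l" and h: "0 < h" "h\<^sup>2 = U * l"
    and d\<theta>: "\<And>t. (\<theta> has_real_derivative h * (1 + e * cos (\<theta> t))\<^sup>2 / l\<^sup>2) (at t)"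
    and per: "\<And>t. \<theta> (t + T) = \<theta> t + 2 * pi" and xper: "\<And>t. x (t + T) = x t"
    and xw: "\<And>t i. i < 2 * n \<Longrightarrow> x t $ i = cact (kepler_pos l e \<omega> (\<theta> t)) av i"
    using ERE_kepler[OF ERE] by blast
  note pos = one_plus_e_cos_pos[OF e]
  have "0 < h * (1 + e * cos (\<theta> t))\<^sup>2 / l\<^sup>2" for t
    using h l pos[of "\<theta> t"] by simp
  from anomaly_inverse[OF T per d\<theta> this] obtain g where g\<theta>: "\<And>t. g (\<theta> t) = t" and \<theta>g: "\<And>s. \<theta> (g s) = s"
    and dg: "\<And>s. (g has_real_derivative inverse (h * (1 + e * cos (\<theta> (g s)))\<^sup>2 / l\<^sup>2)) (at s)" by blast
  define A where "A t = Jmat (2 * n) * hamiltonian_hessian n m (x t)" for t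
  have A4: "A t \<in> carrier_mat (4 * n) (4 * n)" for t
  proof -
    have "A t \<in> carrier_mat (2 * (2 * n)) (2 * (2 * n))"
      unfolding A_def by (rule mult_carrier_mat[OF Jmat_carrier hamiltonian_hessian_carrier[OF xc]])
    then show ?thesis by simp
  qed
  have hess: "hessian (potential n m) (x t) $$ (i, j) = hpot n m (cact (kepler_pos l e \<omega> (\<theta> t)) av)
      (unitf i) (unitf j)"
    if "i < 2 * n" "j < 2 * n" for t i j
    unfolding hessian_potential[OF xc xf that] by (rule hpot_cong) (use xw in auto)
  have w: "kepler_pos l e \<omega> s \<noteq> 0" "cmod (1 / kepler_pos l e \<omega> s) \<le> 2 / l" for s
  proof -
    have n: "cmod (kepler_pos l e \<omega> s) = l / (1 + e * cos s)"
      unfolding kepler_pos_def norm_mult norm_of_real norm_cis using pos[of s] l by simp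
    show "kepler_pos l e \<omega> s \<noteq> 0" using n pos[of s] l by auto
    have "e * cos s \<le> e * 1" using e by (intro mult_left_mono) auto
    then have "1 + e * cos s \<le> 2" using e by simp
    then show "cmod (1 / kepler_pos l e \<omega> s) \<le> 2 / l"
      unfolding norm_divide n using l by (simp add: divide_right_mono)
  qed
  have "0 < 2 / l" using l by simp
  from hpot_unitf_bounded[OF this] obtain \<kappa>1 where
    \<kappa>1: "\<And>t i j. i < 2 * n \<Longrightarrow> j < 2 * n \<Longrightarrow> \<bar>hessian (potential n m) (x t) $$ (i, j)\<bar> \<le> \<kappa>1"
    using w hess by metis
  \<comment> \<open>The sum of the positive entries stands in for their maximum.\<close>
  define \<kappa>2 where "\<kappa>2 = (\<Sum>i<2 * n. 1 / m (i div 2))"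
  have \<kappa>2: "1 / m (i div 2) \<le> \<kappa>2" if "i < 2 * n" for i
    unfolding \<kappa>2_def by (rule member_le_sum) (use that mass_div_pos in \<open>auto intro: less_imp_le\<close>)
  have bdA: "\<bar>A t $$ (i, j)\<bar> \<le> \<bar>\<kappa>1\<bar> + \<bar>\<kappa>2\<bar>" if "i < 4 * n" "j < 4 * n" for t i j
  proof -
    have split: "i < 2 * n \<or> (\<exists>i'<2 * n. i = 2 * n + i')" if "i < 4 * n" for i
    proof (cases "i < 2 * n")
      case False
      then have "i - 2 * n < 2 * n" "i = 2 * n + (i - 2 * n)" using that by auto
      then show ?thesis by blast
    qed simp
    show ?thesis
      using split[OF that(1)] split[OF that(2)]
    proof (elim disjE exE conjE)
      assume "i < 2 * n" "j < 2 * n"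
      then show ?thesis using flow_entry(1)[OF xc[of t]] by (simp add: A_def)
    next
      fix j' assume "i < 2 * n" "j' < 2 * n" "j = 2 * n + j'"
      then show ?thesis using flow_entry(2)[OF xc[of t]] \<kappa>1[of i j' t] by (simp add: A_def)
    next
      fix i' assume "i' < 2 * n" "i = 2 * n + i'" "j < 2 * n"
      then show ?thesis using flow_entry(3)[OF xc[of t]] \<kappa>2[of i'] mass_div_pos[of i'] by (auto simp: A_def)
    next
      fix i' j' assume "i' < 2 * n" "i = 2 * n + i'" "j' < 2 * n" "j = 2 * n + j'"
      then show ?thesis using flow_entry(4)[OF xc[of t]] by (simp add: A_def)
    qed
  qed
  have dimv: "dim_vec v = 4 * n" and v0: "v \<noteq> 0\<^sub>v (4 * n)"
  proof -
    have "\<Gamma> T \<in> carrier_mat (4 * n) (4 * n)" using fs unfolding fundamental_solution_def by blast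
    then have "dim_row (\<Gamma> T) = 4 * n" by (rule carrier_matD(1))
    then show "dim_vec v = 4 * n" "v \<noteq> 0\<^sub>v (4 * n)" using ev unfolding eigenvector_def by auto
  qed
  have "map_vec Re v \<noteq> 0\<^sub>v (4 * n) \<or> map_vec Im v \<noteq> 0\<^sub>v (4 * n)"
  proof (rule ccontr)
    assume c: "\<not> ?thesis"
    have "v = 0\<^sub>v (4 * n)"
    proof
      fix i assume "i < dim_vec (0\<^sub>v (4 * n))"
      then have i: "i < 4 * n" by simp
      have "map_vec Re v $ i = 0" "map_vec Im v $ i = 0" using c i by auto
      then show "v $ i = 0\<^sub>v (4 * n) $ i" using i dimv by (simp add: complex_eq_iff)
    qed (simp add: dimv)
    then show False using v0 by contradiction
  qed
  then obtain r where r: "r = map_vec Re v \<or> r = map_vec Im v" "r \<noteq> 0\<^sub>v (4 * n)" by blast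
  then have rE3: "r \<in> E3 n m a" using vE3 by blast
  define z where "z t i = (\<Sum>j<4 * n. \<Gamma> t $$ (i, j) * r $ j)" for t i
  have Aper: "A (t + T) = A t" for t by (simp add: A_def xper)
  obtain B where B: "\<And>t i. i < 4 * n \<Longrightarrow> \<bar>z t i\<bar> \<le> B"
    using unit_multiplier_bounded[OF fs[folded A_def] A4 Aper T bdA ev \<mu> r(1)] unfolding z_def by blast
  have dz: "((\<lambda>s. z s i) has_real_derivative app (4 * n) (\<lambda>i j. A t $$ (i, j)) (z t) i) (at t)"
      if "i < 4 * n" for t i
    unfolding z_def[abs_def] by (rule fundamental_solution_apply[OF fs[folded A_def] A4 that])
  have z0: "z 0 i = r $ i" if "i < 4 * n" for i
    unfolding z_def by (rule fundamental_solution_0[OF fs that])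
  have four: "4 * n = 2 * (2 * n)" by simp
  \<comment> \<open>Positions are the second half of phase space, in accordance with
    \<open>hamiltonian_hessian\<close>.\<close>
  define \<xi> where "\<xi> t i = z t (2 * n + i)" for t i
  have d\<xi>: "((\<lambda>s. \<xi> s i) has_real_derivative z t i / m (i div 2)) (at t)" if i: "i < 2 * n" for t i
  proof -
    have "((\<lambda>s. \<xi> s i) has_real_derivative app (4 * n) (\<lambda>i j. A t $$ (i, j)) (z t) (2 * n + i)) (at t)"
      unfolding \<xi>_def by (rule dz) (use i in simp)
    also have "app (4 * n) (\<lambda>i j. A t $$ (i, j)) (z t) (2 * n + i) = (\<Sum>l<2 * n. if l
        = i then z t l / m (i div 2) else 0) + 0"
      unfolding app_def four sum_lessThan_double[of _ "2 * n"]
      by (intro arg_cong2[of _ _ _ _ "(+)"] sum.cong sum.neutral ballI)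
        (use flow_entry(3,4)[OF xc[of t] i] in \<open>auto simp: A_def\<close>)
    also have "\<dots> = z t i / m (i div 2)" using i by simp
    finally show ?thesis .
  qed
  have dq: "((\<lambda>s. z s i) has_real_derivative
      hpot n m (cact (kepler_pos l e \<omega> (\<theta> t)) av) (unitf i) (\<xi> t)) (at t)" if i: "i < 2 * n" for t i
  proof -
    have "((\<lambda>s. z s i) has_real_derivative app (4 * n) (\<lambda>i j. A t $$ (i, j)) (z t) i) (at t)"
      by (rule dz) (use i in simp)
    also have "app (4 * n) (\<lambda>i j. A t $$ (i, j)) (z t) i = 0 + (\<Sum>j<2 * n. \<xi> t j *
        hpot n m (cact (kepler_pos l e \<omega> (\<theta> t)) av) (unitf i) (unitf j))"
      unfolding app_def four sum_lessThan_double[of _ "2 * n"]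
      by (intro arg_cong2[of _ _ _ _ "(+)"] sum.cong sum.neutral ballI)
        (use flow_entry(1,2)[OF xc[of t] i] hess[OF i] in \<open>auto simp: A_def \<xi>_def\<close>)
    also have "\<dots> = hpot n m (cact (kepler_pos l e \<omega> (\<theta> t)) av) (unitf i) (\<xi> t)"
      unfolding add_0_left by (rule hpot_expand_right[symmetric])
    finally show ?thesis .
  qed
  obtain c where c: "c < k" "sig (\<lambda>i. r $ (2 * n + i)) c \<noteq> 0 \<or> (\<Sum>i<2 * n. p (c + 4) i * r $ i) \<noteq> 0"
    using E3_nonzero[OF rE3 r(2)] by blast
  have s0: "sig (\<xi> 0) c = sig (\<lambda>i. r $ (2 * n + i)) c"
    unfolding sig_def by (rule mip_cong) (simp_all add: \<xi>_def z0)
  have p0: "(\<Sum>i<2 * n. p (c + 4) i * z 0 i) = (\<Sum>i<2 * n. p (c + 4) i * r $ i)"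
    by (intro sum.cong) (simp_all add: z0)
  show ?thesis
  proof (rule reduced_solution[OF e l h \<theta>g _ d\<xi> dq])
    show "(g has_real_derivative inverse (h * (1 + e * cos s)\<^sup>2 / l\<^sup>2)) (at s)" for s
      using dg[of s] unfolding \<theta>g .
    show "\<bar>\<xi> t i\<bar> \<le> B" if "i < 2 * n" for t i unfolding \<xi>_def by (rule B) (use that in simp)
    show "c < k" by (rule c(1))
    show "sig (\<xi> 0) c \<noteq> 0 \<or> (\<Sum>i<2 * n. p (c + 4) i * z 0 i) \<noteq> 0" unfolding s0 p0 by (rule c(2))
    show "g (\<theta> 0) = 0" by (rule g\<theta>)
  qed
qed

text \<open>Reassembles the componentwise solution as a vector, with \<open>y\<close> in the first
  half as in \<open>coll_mat\<close>; a bound \<open>C\<close> on the square norms bounds every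
  entry by \<open>sqrt C\<close>.\<close>

lemma coll_solution_excluded:
  assumes nd: "collision_nondegenerate n m a P"
    and cs: "coll_solution k Rf x y"
    and bd: "\<And>\<tau>. ip k (x \<tau>) (x \<tau>) \<le> C" "\<And>\<tau>. ip k (y \<tau>) (y \<tau>) \<le> C"
    and i0: "i0 < k"
  shows "x \<tau> i0 = 0 \<and> y \<tau> i0 = 0"
proof -
  let ?R = "regularized_hessian n m a P"
  have kk: "2 * (n - 2) = k" by simp
  have R: "?R \<in> carrier_mat k k" by (simp add: regularized_hessian_def Let_def)
  define z where "z \<tau> = vec (2 * k) (\<lambda>i. if i < k then y \<tau> i else x \<tau> (i - k))" for \<tau>
  have zc: "z \<tau> \<in> carrier_vec (2 * k)" for \<tau> by (simp add: z_def)
  have zy: "z \<tau> $ i = y \<tau> i" and zx: "z \<tau> $ (k + i) = x \<tau> i" if "i < k" for \<tau> i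
    using that by (auto simp: z_def)
  note C = coll_mat_carrier[OF kk R]
  have top: "(coll_mat (n - 2) ?R \<tau> *\<^sub>v z \<tau>) $ i = y \<tau> i + coll_Q \<tau> / 4 * x \<tau> i - coll_q \<tau> * jj (x \<tau>) i"
    and bot: "(coll_mat (n - 2) ?R \<tau> *\<^sub>v z \<tau>) $ (k + i) = coll_Q \<tau> / 4 * y \<tau> i + coll_q \<tau> * jj (y \<tau>) i
      + (coll_q \<tau>)\<^sup>2 * x \<tau> i - app k Rf (x \<tau>) i" if i: "i < k" for \<tau> i
    by (rule coll_mat_apply[OF kk R zc zy zx i]; assumption)+
  have Cz: "coll_mat (n - 2) ?R \<tau> *\<^sub>v z \<tau> \<in> carrier_vec (2 * k)" for \<tau>
    by (rule mult_mat_vec_carrier[OF C zc])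
  have "linear_system_solution (2 * k) (\<lambda>\<tau>. Jmat k * coll_mat (n - 2) ?R \<tau>) z"
    unfolding linear_system_solution_def
  proof (intro allI conjI impI)
    fix \<tau> i assume i: "i < 2 * k"
    have A: "Jmat k * coll_mat (n - 2) ?R \<tau> *\<^sub>v z \<tau> = Jmat k *\<^sub>v (coll_mat (n - 2) ?R \<tau> *\<^sub>v z \<tau>)"
      by (rule assoc_mult_mat_vec[OF Jmat_carrier C zc])
    show "((\<lambda>s. z s $ i) has_real_derivative (Jmat k * coll_mat (n - 2) ?R \<tau> *\<^sub>v z \<tau>) $ i) (at \<tau>)"
    proof (cases "i < k")
      case True
      have "((\<lambda>s. y s i) has_real_derivative
          - coll_Q \<tau> / 4 * y \<tau> i - coll_q \<tau> * jj (y \<tau>) i - (coll_q \<tau>)\<^sup>2 * x \<tau> i + app k Rf (x \<tau>) i) (at \<tau>)"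
        using cs True unfolding coll_solution_def by blast
      moreover have "(Jmat k *\<^sub>v (coll_mat (n - 2) ?R \<tau> *\<^sub>v z \<tau>)) $ i =
          - coll_Q \<tau> / 4 * y \<tau> i - coll_q \<tau> * jj (y \<tau>) i - (coll_q \<tau>)\<^sup>2 * x \<tau> i + app k Rf (x \<tau>) i"
        unfolding Jmat_vec(1)[OF Cz True] bot[OF True] by simp
      ultimately show ?thesis unfolding A zy[OF True] by (simp only:)
    next
      case False
      then obtain i' where i': "i = k + i'" "i' < k" using i by (metis add_diff_inverse_nat mult_2
          nat_add_left_cancel_less)
      have "((\<lambda>s. x s i') has_real_derivative y \<tau> i' + coll_Q \<tau> / 4 * x \<tau> i' - coll_q \<tau> * jj (x \<tau>)
          i') (at \<tau>)"
        using cs i'(2) unfolding coll_solution_def by blast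
      then show ?thesis
        unfolding A i'(1) zx[OF i'(2)] Jmat_vec(2)[OF Cz i'(2)] top[OF i'(2)] .
    qed
  qed (rule zc)
  moreover have "\<forall>\<tau>. \<forall>i<2 * k. \<bar>z \<tau> $ i\<bar> \<le> sqrt C"
  proof (intro allI impI)
    fix \<tau> i assume i: "i < 2 * k"
    show "\<bar>z \<tau> $ i\<bar> \<le> sqrt C"
    proof (cases "i < k")
      case True
      have "\<bar>y \<tau> i\<bar> \<le> sqrt (ip k (y \<tau>) (y \<tau>))" by (rule abs_le_sqrt_ip[OF True])
      also have "\<dots> \<le> sqrt C" by (rule real_sqrt_le_mono[OF bd(2)])
      finally show ?thesis unfolding zy[OF True] .
    next
      case False
      then have i': "i - k < k" "z \<tau> $ i = x \<tau> (i - k)" using i by (auto simp: z_def)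
      have "\<bar>x \<tau> (i - k)\<bar> \<le> sqrt (ip k (x \<tau>) (x \<tau>))" by (rule abs_le_sqrt_ip[OF i'(1)])
      also have "\<dots> \<le> sqrt C" by (rule real_sqrt_le_mono[OF bd(1)])
      finally show ?thesis unfolding i'(2) .
    qed
  qed
  ultimately have "\<forall>\<tau>. z \<tau> = 0\<^sub>v (2 * k)"
    using nd unfolding collision_nondegenerate_def Let_def by blast
  then show ?thesis
    using zx[OF i0, of \<tau>] zy[OF i0, of \<tau>] i0 by simp
qed

end

theorem theorem1p3:
  fixes n :: nat and m :: "nat \<Rightarrow> real" and a0 :: "real Matrix.vec" and P :: "real Matrix.mat"
  assumes "n \<ge> 3"
    and "\<And>i. i < n \<Longrightarrow> m i > 0"
    and "planar_central_configuration n m a0"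
    and "nondegenerate_minimizer n m a0"
    and "adapted_frame n m a0 P"
    and "collision_nondegenerate n m a0 P"
  shows "\<exists>\<epsilon>>0. \<forall>e::real. 0 \<le> e \<and> 0 < 1 - e \<and> 1 - e < \<epsilon> \<longrightarrow> ERE_hyperbolic n m a0 e"
proof (rule ccontr)
  assume neg: "\<not> ?thesis"
  interpret cc_frame n m a0 P
    using assms by unfold_locales auto
  obtain \<rho> where "coercive k Rf \<rho>" using coercive_Rf[OF assms(4)] ..
  then interpret coercive k Rf \<rho> .
  \<comment> \<open>If every threshold \<open>\<epsilon>\<close> fails, the resulting eccentricities
    provide the hypothesis of \<open>bounded_coll_solution\<close>.\<close>
  have "\<exists>e X Y C. 0 \<le> e \<and> e < 1 \<and> 1 - e < \<epsilon> \<and> lin_kepler k Rf e UNIV X Y \<and>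
      (\<forall>t. ip k (X t) (X t) \<le> C) \<and> (\<exists>t. 0 < ip k (X t) (X t) + ip k (Y t) (Y t))" if "0 < \<epsilon>" for \<epsilon>
  proof -
    obtain e where e: "0 \<le> e" "e < 1" "1 - e < \<epsilon>" "\<not> ERE_hyperbolic n m a0 e"
      using neg \<open>0 < \<epsilon>\<close> by auto
    from non_hyperbolic_solution[OF e(4,2)] e(1-3) show ?thesis by blast
  qed
  from bounded_coll_solution[OF this] obtain x y C where "coll_solution k Rf x y"
    "\<And>\<tau>. ip k (x \<tau>) (x \<tau>) \<le> C" "\<And>\<tau>. ip k (y \<tau>) (y \<tau>) \<le> C" "\<exists>i<k. x 0 i \<noteq> 0 \<or> y 0 i \<noteq> 0" by blast
  with coll_solution_excluded[OF assms(6)] show False by blast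
qed

end
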